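(* Let $p\in[1,\infty]$. For $\alpha,\beta\in V$, $$\mathcal X_\alpha\otimes_p\mathcal X_\beta=\mathcal X_{\alpha\beta}.$$ Furthermore, the map $V\ni\alpha\mapsto\mathcal X_\alpha\in\{\mathcal X_\beta\mid\beta\in V\}$ is an isomorphism of topological monoids, where $V$ carries the $\ell_\infty$-topology and the product $(\alpha,\beta)\mapsto\alpha\beta$, and $\{\mathcal X_\beta\mid\beta\in V\}\subset\Pi$ carries the weak topology and the product $\otimes_p$.
   Context: A pm-space is a triple $X=(X,d_X,m_X)$ with $(X,d_X)$ a complete separable metric space and $m_X$ a Borel probability measure. Two pm-spaces are isomorphic if there is an isometry $\operatorname{supp} m_X\to\operatorname{supp} m_Y$ pushing $m_X$ forward to $m_Y$; $\mathcal X$ is the set of isomorphism classes, and a class is always represented by a space with $\operatorname{supp}m_X=X$. Lipschitz order: $Y\prec X$ iff there is a $1$-Lipschitz map $\phi:X\to Y$ with $\phi_\#m_X=m_Y$. Box distance: a parameter of $X$ is a Borel map $a:[0,1]\to X$ with $a_\#\mathcal L^1=m_X$; $\square(X,Y)$ is the infimum of $\epsilon>0$ such that there are parameters $a$ of $X$, $b$ of $Y$ and a Borel set $I_0\subset[0,1]$ with $\mathcal L^1(I_0)\ge1-\epsilon$ and $|d_X(a(s),a(t))-d_Y(b(s),b(t))|\le\epsilon$ for all $s,t\in I_0$. A pyramid is a non-empty, $\square$-closed subset $P\subset\mathcal X$ that is downward-closed for $\prec$ and directed (any $X,Y\in P$ have some $Z\in P$ with $X,Y\prec Z$). $\Pi$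 is the set of pyramids; $\mathcal PX=\{Y\in\mathcal X\mid Y\prec X\}\in\Pi$. Pyramids $P_n$ converge weakly to $P$ if (1) every $X\in P$ is a $\square$-limit of some $X_n\in P_n$, and (2) $\liminf_n\inf_{Y\in P_n}\square(X,Y)>0$ for every $X\notin P$; this is convergence for a compact metrizable topology on $\Pi$ (the weak topology). For $P,Q\in\Pi$, the pyramid $P\otimes_pQ$ is the $\square$-closure of $\bigcup\{\mathcal P(X\times_pY)\mid X\in P,Y\in Q\}$, where $X\times_pY$ is the product space with the $\ell_p$-product metric and product measure. $V=\{\alpha=(\alpha_i)_{i\ge1}\in[0,\infty)^{\mathbb N}\mid\sum_i\alpha_i\le1,\ \alpha_i\ge\alpha_{i+1}\ \forall i\}$. For $\alpha,\beta\in V$, the product $\alpha\beta\in V$ is the nonincreasing rearrangement of the countable family $(\alpha_i\beta_j)_{(i,j)\in\mathbb N^2}$ (positive entries listed in nonincreasing order with multiplicity, followed by zeros if there are only finitely many positive entries); the identity is $1=(1,0,0,\dots)$. For $\alpha\in V$, $\mathcal X_\alpha$ is the set of $X\in\mathcal X$ for which there is a map $f:\mathbb N\to X$ such that $m_X-\sum_{i=1}^\infty\alpha_i\delta_{f(i)}$ is a nonnegative measure; it is a pyramid. *)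

theory Defs
  imports "HOL-Probability.Probability" "HOL-Algebra.Group"
begin

section \<open>Spaces with a metric and a probability measure\<close>

record 'a pm =
  pm_metric :: "'a metric"
  pm_measure :: "'a measure"

definition pm_space :: "'a pm \<Rightarrow> bool" where
  "pm_space X \<longleftrightarrow>
     mcomplete_of (pm_metric X) \<and>
     separable_space (mtopology_of (pm_metric X)) \<and>
     prob_space (pm_measure X) \<and>
     space (pm_measure X) = mspace (pm_metric X) \<and>
     sets (pm_measure X) =
       sigma_sets (mspace (pm_metric X)) {U. openin (mtopology_of (pm_metric X)) U}"

definition pm_supp :: "'a pm \<Rightarrow> 'a set" where
  "pm_supp X = {x \<in> mspace (pm_metric X).
     \<forall>U. openin (mtopology_of (pm_metric X)) U \<and> x \<in> U \<longrightarrow> emeasure (pm_measure X) U > 0}"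

definition full_support :: "'a pm \<Rightarrow> bool" where
  "full_support X \<longleftrightarrow> pm_supp X = mspace (pm_metric X)"

definition pm_isometric :: "'a pm \<Rightarrow> 'b pm \<Rightarrow> bool" where
  "pm_isometric X Y \<longleftrightarrow> (\<exists>f.
     f ` pm_supp X = pm_supp Y \<and>
     (\<forall>x\<in>pm_supp X. \<forall>x'\<in>pm_supp X. mdist (pm_metric Y) (f x) (f x') = mdist (pm_metric X) x x') \<and>
     distr (restrict_space (pm_measure X) (pm_supp X)) (pm_measure Y) f = pm_measure Y)"

definition pm_lipschitz_le :: "'a pm \<Rightarrow> 'b pm \<Rightarrow> bool" where
  "pm_lipschitz_le Y X \<longleftrightarrow> (\<exists>\<phi>.
     \<phi> \<in> mspace (pm_metric X) \<rightarrow> mspace (pm_metric Y) \<and>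
     (\<forall>x\<in>mspace (pm_metric X). \<forall>x'\<in>mspace (pm_metric X).
        mdist (pm_metric Y) (\<phi> x) (\<phi> x') \<le> mdist (pm_metric X) x x') \<and>
     distr (pm_measure X) (pm_measure Y) \<phi> = pm_measure Y)"

definition unit_lebesgue :: "real measure" where
  "unit_lebesgue = restrict_space lborel {0..1}"

definition parameter :: "'a pm \<Rightarrow> (real \<Rightarrow> 'a) \<Rightarrow> bool" where
  "parameter X a \<longleftrightarrow>
     a \<in> measurable unit_lebesgue (pm_measure X) \<and>
     distr unit_lebesgue (pm_measure X) a = pm_measure X"

definition pm_box :: "'a pm \<Rightarrow> 'b pm \<Rightarrow> real" where
  "pm_box X Y = Inf {\<epsilon>. \<epsilon> > 0 \<and> (\<exists>a b I\<^sub>0.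
     parameter X a \<and> parameter Y b \<and>
     I\<^sub>0 \<in> sets borel \<and> I\<^sub>0 \<subseteq> {0..1} \<and> measure lborel I\<^sub>0 \<ge> 1 - \<epsilon> \<and>
     (\<forall>s\<in>I\<^sub>0. \<forall>t\<in>I\<^sub>0.
        \<bar>mdist (pm_metric X) (a s) (a t) - mdist (pm_metric Y) (b s) (b t)\<bar> \<le> \<epsilon>))}"

subsection \<open>Products\<close>

definition lp_norm2 :: "ereal \<Rightarrow> real \<Rightarrow> real \<Rightarrow> real" where
  "lp_norm2 p r s = (if p = \<infinity> then max r s
     else (r powr real_of_ereal p + s powr real_of_ereal p) powr (1 / real_of_ereal p))"

definition lp_prod_dist ::
  "ereal \<Rightarrow> ('a \<Rightarrow> 'a \<Rightarrow> real) \<Rightarrow> ('b \<Rightarrow> 'b \<Rightarrow> real) \<Rightarrow> 'a \<times> 'b \<Rightarrow> 'a \<times> 'b \<Rightarrow> real" where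
  "lp_prod_dist p d\<^sub>1 d\<^sub>2 = (\<lambda>(x, y) (x', y'). lp_norm2 p (d\<^sub>1 x x') (d\<^sub>2 y y'))"

definition pm_prod :: "ereal \<Rightarrow> 'a pm \<Rightarrow> 'b pm \<Rightarrow> ('a \<times> 'b) pm" where
  "pm_prod p X Y = \<lparr>
     pm_metric = metric (mspace (pm_metric X) \<times> mspace (pm_metric Y),
                         lp_prod_dist p (mdist (pm_metric X)) (mdist (pm_metric Y))),
     pm_measure = pm_measure X \<Otimes>\<^sub>M pm_measure Y\<rparr>"


section \<open>Isomorphism classes\<close>

text \<open>A complete separable metric space has at most the cardinality of the continuum. So every
  isomorphism class has representatives whose carrier is a set of reals (with a metric unrelated to
  the usual one), and a class is modelled as the set of these representatives. The argument of
  \<open>pm_class\<close> has an arbitrary carrier type, so that the class of a product makes sense.\<close>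

type_synonym pm_iso_class = "real pm set"

definition pm_class :: "'a pm \<Rightarrow> pm_iso_class" where
  "pm_class X = {Z. pm_space Z \<and> pm_isometric X Z}"

definition pm_classes :: "pm_iso_class set" where
  "pm_classes = pm_class ` {X :: real pm. pm_space X}"

text \<open>Classes are always represented by a space of full support; the relations below do not
  depend on the choice.\<close>

definition pm_rep :: "pm_iso_class \<Rightarrow> real pm" where
  "pm_rep A = (SOME X. X \<in> A \<and> full_support X)"

definition lipschitz_le :: "pm_iso_class \<Rightarrow> pm_iso_class \<Rightarrow> bool" where
  "lipschitz_le A B \<longleftrightarrow> pm_lipschitz_le (pm_rep A) (pm_rep B)"

definition box_dist :: "pm_iso_class \<Rightarrow> pm_iso_class \<Rightarrow> real" where
  "box_dist A B = pm_box (pm_rep A) (pm_rep B)"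

definition prod_class :: "ereal \<Rightarrow> pm_iso_class \<Rightarrow> pm_iso_class \<Rightarrow> pm_iso_class" where
  "prod_class p A B = pm_class (pm_prod p (pm_rep A) (pm_rep B))"

definition box_closure :: "pm_iso_class set \<Rightarrow> pm_iso_class set" where
  "box_closure S = {A \<in> pm_classes. \<forall>\<epsilon>>0. \<exists>B\<in>S. box_dist A B < \<epsilon>}"


section \<open>Pyramids\<close>

definition pyramid :: "pm_iso_class set \<Rightarrow> bool" where
  "pyramid P \<longleftrightarrow>
     P \<subseteq> pm_classes \<and> P \<noteq> {} \<and>
     box_closure P = P \<and>
     (\<forall>A\<in>P. \<forall>B\<in>pm_classes. lipschitz_le B A \<longrightarrow> B \<in> P) \<and>
     (\<forall>A\<in>P. \<forall>B\<in>P. \<exists>C\<in>P. lipschitz_le A C \<and> lipschitz_le B C)"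

definition pyramids :: "pm_iso_class set set" where
  "pyramids = {P. pyramid P}"

definition pyramid_of :: "pm_iso_class \<Rightarrow> pm_iso_class set" where
  "pyramid_of A = {B \<in> pm_classes. lipschitz_le B A}"

definition pyramid_prod ::
  "ereal \<Rightarrow> pm_iso_class set \<Rightarrow> pm_iso_class set \<Rightarrow> pm_iso_class set" where
  "pyramid_prod p P Q = box_closure (\<Union>A\<in>P. \<Union>B\<in>Q. pyramid_of (prod_class p A B))"

definition weakly_converges :: "(nat \<Rightarrow> pm_iso_class set) \<Rightarrow> pm_iso_class set \<Rightarrow> bool" where
  "weakly_converges S P \<longleftrightarrow>
     (\<forall>A\<in>P. \<exists>B. (\<forall>n. B n \<in> S n) \<and> (\<lambda>n. box_dist A (B n)) \<longlonglongrightarrow> 0) \<and>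
     (\<forall>A\<in>pm_classes - P. liminf (\<lambda>n. INF B\<in>S n. ereal (box_dist A B)) > 0)"

text \<open>Weak convergence is convergence of sequences for a metrizable topology. Metrizable
  topologies are sequential, so the open sets of that topology are the sequentially open ones.\<close>

definition weakly_open :: "pm_iso_class set set \<Rightarrow> bool" where
  "weakly_open U \<longleftrightarrow> U \<subseteq> pyramids \<and>
     (\<forall>P\<in>U. \<forall>S. (\<forall>n. S n \<in> pyramids) \<and> weakly_converges S P \<longrightarrow>
        (\<forall>\<^sub>F n in sequentially. S n \<in> U))"

definition weak_topology :: "pm_iso_class set topology" where
  "weak_topology = topology weakly_open"


section \<open>Sequences of weights and their pyramids\<close>

text \<open>Sequences are indexed from \<open>0\<close>.\<close>

definition weights :: "(nat \<Rightarrow> real) set" where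
  "weights = {\<alpha>. (\<forall>i. 0 \<le> \<alpha> i) \<and> summable \<alpha> \<and> suminf \<alpha> \<le> 1 \<and> (\<forall>i. \<alpha> (Suc i) \<le> \<alpha> i)}"

text \<open>The metric of \<open>funspace UNIV euclidean_metric\<close> is the supremum distance on the set of all
  bounded functions.\<close>

definition weights_topology :: "(nat \<Rightarrow> real) topology" where
  "weights_topology = subtopology (mtopology_of (funspace UNIV euclidean_metric)) weights"

definition nonincreasing_rearrangement :: "('i \<Rightarrow> real) \<Rightarrow> nat \<Rightarrow> real" where
  "nonincreasing_rearrangement u = (THE \<gamma>.
     (\<forall>k. 0 \<le> \<gamma> k) \<and> (\<forall>k. \<gamma> (Suc k) \<le> \<gamma> k) \<and>
     (\<exists>\<sigma>. bij_betw \<sigma> {k. \<gamma> k > 0} {i. u i > 0} \<and> (\<forall>k. \<gamma> k > 0 \<longrightarrow> u (\<sigma> k) = \<gamma> k)))"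

definition weights_mult :: "(nat \<Rightarrow> real) \<Rightarrow> (nat \<Rightarrow> real) \<Rightarrow> nat \<Rightarrow> real" where
  "weights_mult \<alpha> \<beta> = nonincreasing_rearrangement (\<lambda>(i, j). \<alpha> i * \<beta> j)"

definition weights_one :: "nat \<Rightarrow> real" where
  "weights_one i = (if i = 0 then 1 else 0)"

text \<open>The inequality below says that \<open>m - (\<Sum>i. \<alpha> i * \<delta>(f i))\<close> is a nonnegative measure.\<close>

definition atom_pyramid :: "(nat \<Rightarrow> real) \<Rightarrow> pm_iso_class set" where
  "atom_pyramid \<alpha> = {A \<in> pm_classes. \<exists>f :: nat \<Rightarrow> real.
     (\<forall>i. f i \<in> mspace (pm_metric (pm_rep A))) \<and>
     (\<forall>E\<in>sets (pm_measure (pm_rep A)).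
        (\<Sum>i. ennreal (\<alpha> i) * indicator E (f i)) \<le> emeasure (pm_measure (pm_rep A)) E)}"


section \<open>Topological monoids\<close>

definition topological_monoid :: "('a, 'm) monoid_scheme \<Rightarrow> 'a topology \<Rightarrow> bool" where
  "topological_monoid G T \<longleftrightarrow>
     Group.monoid G \<and> topspace T = carrier G \<and>
     continuous_map (prod_topology T T) T (\<lambda>(x, y). x \<otimes>\<^bsub>G\<^esub> y)"

definition topological_monoid_iso ::
  "('a, 'm) monoid_scheme \<Rightarrow> 'a topology \<Rightarrow> ('b, 'n) monoid_scheme \<Rightarrow> 'b topology \<Rightarrow> ('a \<Rightarrow> 'b) \<Rightarrow> bool"
  where
  "topological_monoid_iso G T H S h \<longleftrightarrow>
     topological_monoid G T \<and> topological_monoid H S \<and>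
     h \<in> Group.iso G H \<and> h \<one>\<^bsub>G\<^esub> = \<one>\<^bsub>H\<^esub> \<and> homeomorphic_map T S h"

definition weights_monoid :: "(nat \<Rightarrow> real) monoid" where
  "weights_monoid =
     \<lparr>carrier = weights, monoid.mult = weights_mult, one = weights_one\<rparr>"

definition atom_pyramid_monoid :: "ereal \<Rightarrow> pm_iso_class set monoid" where
  "atom_pyramid_monoid p =
     \<lparr>carrier = atom_pyramid ` weights, monoid.mult = pyramid_prod p, one = atom_pyramid weights_one\<rparr>"

definition atom_pyramid_topology :: "pm_iso_class set topology" where
  "atom_pyramid_topology = subtopology weak_topology (atom_pyramid ` weights)"


section \<open>Well-definedness\<close>

lemma istopology_weakly_open: "istopology weakly_open"
  unfolding istopology_def
proof (intro conjI allI impI)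
  fix U V assume "weakly_open U" "weakly_open V"
  then show "weakly_open (U \<inter> V)"
    unfolding weakly_open_def by (auto simp: eventually_conj_iff)
next
  fix K assume K: "\<forall>U\<in>K. weakly_open U"
  show "weakly_open (\<Union> K)"
    unfolding weakly_open_def
  proof (intro conjI ballI allI impI)
    show "\<Union> K \<subseteq> pyramids" using K unfolding weakly_open_def by blast
    fix P S assume "P \<in> \<Union> K" and S: "(\<forall>n. S n \<in> pyramids) \<and> weakly_converges S P"
    then obtain U where U: "U \<in> K" "P \<in> U" by blast
    then have "\<forall>\<^sub>F n in sequentially. S n \<in> U"
      using K S unfolding weakly_open_def by blast
    then show "\<forall>\<^sub>F n in sequentially. S n \<in> \<Union> K"
      by (rule eventually_mono) (use U in blast)
  qed
qed

lemma openin_weak_topology: "openin weak_topology = weakly_open"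
  unfolding weak_topology_def using istopology_weakly_open by (rule topology_inverse')

lemma topspace_weak_topology: "topspace weak_topology = pyramids"
proof -
  have "weakly_open pyramids"
    unfolding weakly_open_def by simp
  then show ?thesis
    unfolding topspace_def openin_weak_topology weakly_open_def by blast
qed

lemma powr_convex_combination:
  fixes p :: real
  assumes p: "1 \<le> p" and t: "0 \<le> t" "t \<le> 1" and xy: "0 \<le> x" "0 \<le> y"
  shows "((1 - t) * x + t * y) powr p \<le> (1 - t) * x powr p + t * y powr p"
proof -
  have le: "c powr p \<le> c" if "0 \<le> c" "c \<le> 1" for c :: real
    using powr_mono'[of 1 p c] that p by (cases "c = 0") auto
  consider "x = 0" | "y = 0" | "x > 0" "y > 0" using xy by linarith
  then show ?thesis
  proof cases
    case 1
    then show ?thesis using le[of t] t xy p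
      by (simp add: powr_mult mult_right_mono)
  next
    case 2
    then show ?thesis using le[of "1 - t"] t xy p
      by (simp add: powr_mult mult_right_mono)
  next
    case 3
    then show ?thesis
      using convex_onD[OF powr_convex[OF p], of t x y] t by simp
  qed
qed

lemma lp_norm2_triangle:
  assumes p: "1 \<le> p" and nn: "0 \<le> a" "0 \<le> b" "0 \<le> c" "0 \<le> d"
  shows "lp_norm2 p (a + c) (b + d) \<le> lp_norm2 p a b + lp_norm2 p c d"
proof (cases "p = \<infinity>")
  case True
  then show ?thesis by (auto simp: lp_norm2_def)
next
  case False
  define q where "q = real_of_ereal p"
  have q: "1 \<le> q" using p False unfolding q_def by (cases p) auto
  define N where "N r s = (r powr q + s powr q) powr (1 / q)" for r s :: real
  have Nq: "N r s powr q = r powr q + s powr q" for r s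
    using q by (simp add: N_def powr_powr)
  have N0: "r = 0 \<and> s = 0" if "N r s = 0" for r s
  proof -
    have "r powr q + s powr q = 0" using that Nq[of r s] q by simp
    then have "r powr q = 0" "s powr q = 0"
      using powr_ge_zero[of r q] powr_ge_zero[of s q] by linarith+
    then show ?thesis by simp
  qed
  have Nnn: "0 \<le> N r s" for r s by (simp add: N_def)
  have "N (a + c) (b + d) \<le> N a b + N c d"
  proof (cases "N a b = 0 \<or> N c d = 0")
    case True
    then show ?thesis using N0[of a b] N0[of c d] Nnn by auto
  next
    case False
    define A where "A = N a b"
    define C where "C = N c d"
    have AC: "A > 0" "C > 0" using False Nnn[of a b] Nnn[of c d] by (auto simp: A_def C_def)
    define t where "t = C / (A + C)"
    have t: "0 \<le> t" "t \<le> 1" "1 - t = A / (A + C)" using AC by (auto simp: t_def field_simps)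
    have key: "(x + y) powr q \<le> (A + C) powr q * ((1 - t) * (x powr q / A powr q) + t * (y powr q / C powr q))"
      if "0 \<le> x" "0 \<le> y" for x y
    proof -
      have "x + y = (A + C) * ((1 - t) * (x / A) + t * (y / C))"
      proof -
        have "(A + C) * (1 - t) = A" "(A + C) * t = C" using AC t by (auto simp: t_def)
        then have "(A + C) * ((1 - t) * (x / A)) = x" "(A + C) * (t * (y / C)) = y"
          using AC by (simp_all flip: mult.assoc)
        then show ?thesis by (simp add: distrib_left)
      qed
      then have "(x + y) powr q = (A + C) powr q * ((1 - t) * (x / A) + t * (y / C)) powr q"
        using AC t that by (simp add: powr_mult)
      also have "\<dots> \<le> (A + C) powr q * ((1 - t) * (x / A) powr q + t * (y / C) powr q)"
        using powr_convex_combination[OF q t(1,2), of "x / A" "y / C"] AC that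
        by (intro mult_left_mono) auto
      finally show ?thesis using AC that by (simp add: powr_divide)
    qed
    have Ap: "A powr q = a powr q + b powr q" "C powr q = c powr q + d powr q"
      by (simp_all add: A_def C_def Nq)
    have pos: "A powr q > 0" "C powr q > 0" using AC by auto
    have "(a + c) powr q + (b + d) powr q \<le>
        (A + C) powr q * ((1 - t) * (a powr q / A powr q) + t * (c powr q / C powr q)) +
        (A + C) powr q * ((1 - t) * (b powr q / A powr q) + t * (d powr q / C powr q))"
      using key[of a c] key[of b d] nn by linarith
    also have "\<dots> = (A + C) powr q * ((1 - t) * ((a powr q + b powr q) / A powr q)
        + t * ((c powr q + d powr q) / C powr q))"
      by (simp add: algebra_simps add_divide_distrib)
    also have "\<dots> = (A + C) powr q" using pos by (simp flip: Ap)
    finally have "N (a + c) (b + d) \<le> ((A + C) powr q) powr (1 / q)"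
      unfolding N_def using q by (intro powr_mono2) auto
    also have "\<dots> = A + C" using q AC by (simp add: powr_powr)
    finally show ?thesis by (simp add: A_def C_def)
  qed
  then show ?thesis using False by (simp add: lp_norm2_def N_def q_def)
qed

lemma lp_norm2_mono:
  assumes p: "1 \<le> p" and "0 \<le> r" "r \<le> r'" "0 \<le> s" "s \<le> s'"
  shows "lp_norm2 p r s \<le> lp_norm2 p r' s'"
proof (cases p)
  case (real q)
  then show ?thesis using assms by (auto simp: lp_norm2_def intro!: powr_mono2 add_mono)
qed (use assms in \<open>auto simp: lp_norm2_def\<close>)

lemma lp_norm2_eq_0_iff:
  assumes p: "1 \<le> p" and "0 \<le> r" "0 \<le> s"
  shows "lp_norm2 p r s = 0 \<longleftrightarrow> r = 0 \<and> s = 0"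
proof (cases p)
  case (real q)
  have "r powr q + s powr q = 0 \<longleftrightarrow> r powr q = 0 \<and> s powr q = 0"
    by (rule add_nonneg_eq_0_iff) auto
  then show ?thesis using real by (simp add: lp_norm2_def)
qed (use assms in \<open>auto simp: lp_norm2_def max_def\<close>)

lemma Metric_space_lp_prod:
  assumes p: "1 \<le> p" and "Metric_space M\<^sub>1 d\<^sub>1" "Metric_space M\<^sub>2 d\<^sub>2"
  shows "Metric_space (M\<^sub>1 \<times> M\<^sub>2) (lp_prod_dist p d\<^sub>1 d\<^sub>2)"
proof -
  interpret M1: Metric_space M\<^sub>1 d\<^sub>1 by fact
  interpret M2: Metric_space M\<^sub>2 d\<^sub>2 by fact
  show ?thesis
  proof
    fix x y :: "'a \<times> 'b"
    show "0 \<le> lp_prod_dist p d\<^sub>1 d\<^sub>2 x y"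
      by (auto simp: lp_prod_dist_def lp_norm2_def le_max_iff_disj split: prod.split)
    show "lp_prod_dist p d\<^sub>1 d\<^sub>2 x y = lp_prod_dist p d\<^sub>1 d\<^sub>2 y x"
      by (simp add: lp_prod_dist_def M1.commute M2.commute split: prod.split)
  next
    fix x y assume "x \<in> M\<^sub>1 \<times> M\<^sub>2" "y \<in> M\<^sub>1 \<times> M\<^sub>2"
    then show "lp_prod_dist p d\<^sub>1 d\<^sub>2 x y = 0 \<longleftrightarrow> x = y"
      by (auto simp: lp_prod_dist_def lp_norm2_eq_0_iff[OF p])
  next
    fix x y z assume *: "x \<in> M\<^sub>1 \<times> M\<^sub>2" "y \<in> M\<^sub>1 \<times> M\<^sub>2" "z \<in> M\<^sub>1 \<times> M\<^sub>2"
    obtain x1 x2 y1 y2 z1 z2 where e: "x = (x1, x2)" "y = (y1, y2)" "z = (z1, z2)"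
      by (metis surj_pair)
    have "lp_norm2 p (d\<^sub>1 x1 z1) (d\<^sub>2 x2 z2)
        \<le> lp_norm2 p (d\<^sub>1 x1 y1 + d\<^sub>1 y1 z1) (d\<^sub>2 x2 y2 + d\<^sub>2 y2 z2)"
      using * e by (intro lp_norm2_mono p) (auto intro: M1.triangle M2.triangle)
    also have "\<dots> \<le> lp_norm2 p (d\<^sub>1 x1 y1) (d\<^sub>2 x2 y2) + lp_norm2 p (d\<^sub>1 y1 z1) (d\<^sub>2 y2 z2)"
      by (intro lp_norm2_triangle p) auto
    finally show "lp_prod_dist p d\<^sub>1 d\<^sub>2 x z \<le> lp_prod_dist p d\<^sub>1 d\<^sub>2 x y + lp_prod_dist p d\<^sub>1 d\<^sub>2 y z"
      by (simp add: lp_prod_dist_def e)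
  qed
qed

lemma pm_prod_metric:
  assumes "1 \<le> p"
  shows "mspace (pm_metric (pm_prod p X Y)) = mspace (pm_metric X) \<times> mspace (pm_metric Y)"
    and "mdist (pm_metric (pm_prod p X Y)) = lp_prod_dist p (mdist (pm_metric X)) (mdist (pm_metric Y))"
  using Metric_space_lp_prod[OF assms, of "mspace (pm_metric X)" _ "mspace (pm_metric Y)"]
  by (simp_all add: pm_prod_def Metric_space.mspace_metric Metric_space.mdist_metric)

end

theory Submission
  imports Defs "HOL-Library.Diagonal_Subsequence"
begin

text \<open>A measure on a space dominates \<open>\<Sum>i. \<alpha> i * \<delta>(f i)\<close> iff the space has a parameter that is constant
  on consecutive intervals of lengths \<open>\<alpha> i\<close>; gluing parameters along such intervals gives common
  bounds of two spaces and approximations along convergent weights, and Fatou's lemma shows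
  that box limits keep their atoms. A space whose atoms are prescribed by \<open>\<alpha>\<beta>\<close> is approximated by finite
  spaces, and each of these is dominated by a product of two discrete spaces with widely
  separated points, the mass of \<open>\<alpha>\<close> and \<open>\<beta>\<close> that is missing to \<open>1\<close> being distributed in proportion to
  the residual measure. The sums \<open>\<alpha> 0 + \<dots> + \<alpha> k\<close> are lower bounds for the maximal mass of \<open>k + 1\<close> points
  in the spaces of the pyramid of \<open>\<alpha>\<close>, attained by suitable spaces, so the pyramid determines \<open>\<alpha>\<close>.
  As \<open>weights\<close> is compact and weak limits are unique, the continuous bijection is closed.\<close>

subsection \<open>Spaces with a metric and a measure\<close>

text \<open>The product formula rests on one identity. If a and b are the totals of \<alpha> and
  \<beta>, the pairs of points that are not both atoms have mass a (1 - b) + (1 - a) = 1 - a b, the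
  missing mass of \<alpha>\<beta>. Both factors spread their missing mass by the same law of labels,
  so the product is pushed exactly onto the quantized target. The metric enters through the bound of
  each coordinate distance by the product distance, which holds for every p. The obstacle to
  approximation along \<alpha>' is that only finitely many weights are under control at a given
  precision. Monotonicity gives \<alpha>' i \<le> 1 / (i + 1) uniformly, so all later atoms sit on
  short intervals, and few of these meet an endpoint of the finite partition used for the limit.
  Parameters of arbitrary spaces come from coding points by reals in a Borel way, taking the
  quantile function of the coded law, and decoding. Isomorphisms see only supports, whereas
  domination and parameters see whole carriers; hence the attention to full support and to null
  sets. The weak topology is given by sequentially open sets, so continuity and closedness are
  proved with sequences.\<close>

locale pm_sp =
  fixes X :: "'a pm"
  assumes pm_space: "pm_space X"
begin

abbreviation "M \<equiv> mspace (pm_metric X)"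
abbreviation "d \<equiv> mdist (pm_metric X)"
abbreviation "m \<equiv> pm_measure X"

sublocale Metric_space M d by simp

sublocale P: prob_space m
  using pm_space by (simp add: pm_space_def)

lemma mtopology_of_eq [simp]: "mtopology_of (pm_metric X) = mtopology"
  by (simp add: mtopology_of_def)

lemma space_m [simp]: "space m = M"
  using pm_space by (simp add: pm_space_def)

lemma sets_m: "sets m = sigma_sets M {U. openin mtopology U}"
  using pm_space by (simp add: pm_space_def)

lemma complete: "mcomplete"
  using pm_space by (simp add: pm_space_def mcomplete_of_def)

lemma separable: "separable_space mtopology"
  using pm_space by (simp add: pm_space_def)

lemma nonempty: "M \<noteq> {}"
  using P.not_empty by simp

lemma open_sets: "openin mtopology U \<Longrightarrow> U \<in> sets m"
  by (auto simp: sets_m)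

lemma closed_sets: assumes "closedin mtopology C" shows "C \<in> sets m"
proof -
  have "M - C \<in> sets m" "C \<subseteq> M"
    using assms by (auto intro!: open_sets simp: closedin_def)
  then have "space m - (M - C) \<in> sets m" "space m - (M - C) = C"
    by (auto simp: sets.compl_sets[of "M - C" m, simplified])
  then show ?thesis by simp
qed

lemma ball_sets [simp]: "mball x r \<in> sets m" "mcball x r \<in> sets m"
  by (auto intro: open_sets closed_sets)

lemma finite_sets: "finite F \<Longrightarrow> F \<subseteq> M \<Longrightarrow> F \<in> sets m"
  using Hausdorff_space_mtopology
  by (intro closed_sets compactin_imp_closedin) (auto simp: finite_imp_compactin)

lemma ex_dense_seq: "\<exists>z :: nat \<Rightarrow> 'a. range z \<subseteq> M \<and> (\<forall>x\<in>M. \<forall>e>0. \<exists>k. d x (z k) < e)"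
proof -
  obtain C where C: "countable C" "C \<subseteq> M" "mtopology closure_of C = M"
    using separable unfolding separable_space_def by auto
  have "C \<noteq> {}" using C nonempty by auto
  then have z: "range (from_nat_into C) = C" using C by simp
  have "\<exists>k. d x (from_nat_into C k) < e" if x: "x \<in> M" "e > 0" for x e
  proof -
    have "x \<in> mtopology closure_of C" using x C by simp
    then obtain y where "y \<in> C" "d x y < e"
      using x unfolding metric_closure_of by auto
    then show ?thesis using z by (metis imageE)
  qed
  then show ?thesis using z C by (intro exI[of _ "from_nat_into C"]) auto
qed

definition dense_seq :: "nat \<Rightarrow> 'a" where
  "dense_seq = (SOME z. range z \<subseteq> M \<and> (\<forall>x\<in>M. \<forall>e>0. \<exists>k. d x (z k) < e))"

lemma dense_seq_in [simp]: "dense_seq k \<in> M"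
  and dense_seq_near: "x \<in> M \<Longrightarrow> e > 0 \<Longrightarrow> \<exists>k. d x (dense_seq k) < e"
  using someI_ex[OF ex_dense_seq] unfolding dense_seq_def[symmetric] by auto

definition basic_ball :: "nat \<times> nat \<Rightarrow> 'a set" where
  "basic_ball p = mball (dense_seq (fst p)) (1 / real (Suc (snd p)))"

lemma open_eq_Union_basic_balls:
  assumes "openin mtopology U"
  shows "U = \<Union>(basic_ball ` {p. basic_ball p \<subseteq> U})"
proof (intro equalityI subsetI)
  fix x assume x: "x \<in> U"
  then obtain r where r: "r > 0" "mball x r \<subseteq> U" and xM: "x \<in> M"
    using assms unfolding openin_mtopology by blast
  obtain n where n: "1 / real (Suc n) < r / 2"
    using nat_approx_posE[of "r/2"] r by (auto simp: field_simps)
  obtain k where k: "d x (dense_seq k) < 1 / real (Suc n)"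
    using dense_seq_near[OF xM, of "1 / real (Suc n)"] by auto
  have "basic_ball (k, n) \<subseteq> mball x r"
    using k n xM unfolding basic_ball_def by (intro mball_subset) (auto simp: commute)
  moreover have "x \<in> basic_ball (k, n)"
    using k xM by (auto simp: commute basic_ball_def)
  ultimately show "x \<in> \<Union>(basic_ball ` {p. basic_ball p \<subseteq> U})"
    using r by blast
qed auto

text \<open>The balls \<open>basic_ball\<close> form a countable base, so the preimage of an open
  set is a countable union of sets of the tested form.\<close>

lemma measurable_ballI:
  assumes f: "f \<in> space N \<rightarrow> M"
    and b: "\<And>k r. {w \<in> space N. d (dense_seq k) (f w) < r} \<in> sets N"
  shows "f \<in> measurable N m"
proof (rule measurable_sigma_sets[OF sets_m _ f])
  show "{U. openin mtopology U} \<subseteq> Pow M"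
    using openin_subset by fastforce
next
  fix U assume "U \<in> {U. openin mtopology U}"
  then have U: "openin mtopology U" by simp
  have "f -` U \<inter> space N = f -` (\<Union>(basic_ball ` {p. basic_ball p \<subseteq> U})) \<inter> space N"
    using open_eq_Union_basic_balls[OF U] by simp
  also have "\<dots> = (\<Union>p\<in>{p. basic_ball p \<subseteq> U}. {w \<in> space N. d (dense_seq (fst p)) (f w) < 1 / real (Suc (snd p))})"
    using f by (force simp: basic_ball_def Pi_iff)
  also have "\<dots> \<in> sets N"
    by (intro sets.countable_UN'') (auto intro: b)
  finally show "f -` U \<inter> space N \<in> sets N" .
qed

lemma dist_measurable [measurable]: "x \<in> M \<Longrightarrow> (\<lambda>y. d x y) \<in> borel_measurable m"
proof (rule borel_measurableI_less)
  fix r assume "x \<in> M"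
  then have "{y \<in> space m. d x y < r} = mball x r" by auto
  then show "{y \<in> space m. d x y < r} \<in> sets m" by simp
qed

section \<open>The support of the measure\<close>

abbreviation "S \<equiv> pm_supp X"

lemma supp_subset: "S \<subseteq> M" by (auto simp: pm_supp_def)

lemma notin_supp: "x \<in> M - S \<longleftrightarrow> x \<in> M \<and> (\<exists>U. openin mtopology U \<and> x \<in> U \<and> emeasure m U = 0)"
  by (auto simp: pm_supp_def zero_less_iff_neq_zero)

lemma open_compl_supp: "openin mtopology (M - S)"
proof (subst openin_subopen, intro ballI)
  fix x assume "x \<in> M - S"
  then obtain U where U: "openin mtopology U" "x \<in> U" "emeasure m U = 0"
    using notin_supp by blast
  then have "U \<subseteq> M - S" using openin_subset[OF U(1)] notin_supp by auto
  then show "\<exists>T. openin mtopology T \<and> x \<in> T \<and> T \<subseteq> M - S" using U by blast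
qed

lemma closed_supp: "closedin mtopology S"
  using open_compl_supp supp_subset by (auto simp: closedin_def)

lemma supp_sets [measurable, simp]: "S \<in> sets m"
  using closed_supp by (rule closed_sets)

text \<open>Lindeloef argument: every point off the support lies in a null basic ball, and there are
  countably many of these. This is where separability makes the support carry all the mass.\<close>

lemma null_compl_supp: "emeasure m (M - S) = 0"
proof -
  define K where "K = {p. basic_ball p \<subseteq> M - S \<and> emeasure m (basic_ball p) = 0}"
  have "M - S = (\<Union>p\<in>K. basic_ball p)"
  proof (intro equalityI subsetI)
    fix x assume "x \<in> M - S"
    then obtain U where U: "openin mtopology U" "x \<in> U" "emeasure m U = 0"
      using notin_supp by blast
    then have US: "U \<subseteq> M - S" using openin_subset[OF U(1)] notin_supp by auto
    obtain p where p: "basic_ball p \<subseteq> U" "x \<in> basic_ball p"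
      using open_eq_Union_basic_balls[OF U(1)] U(2) by blast
    then have "emeasure m (basic_ball p) \<le> emeasure m U"
      using U by (intro emeasure_mono open_sets)
    then have "p \<in> K" using U p US by (auto simp: K_def)
    then show "x \<in> (\<Union>p\<in>K. basic_ball p)" using p by auto
  qed (auto simp: K_def)
  moreover have "emeasure m (\<Union>p\<in>K. basic_ball p) = 0"
    using null_sets_UN'[of K basic_ball m] by (auto simp: K_def basic_ball_def null_sets_def)
  ultimately show ?thesis by simp
qed

lemma AE_supp: "AE x in m. x \<in> S"
  using null_compl_supp by (intro AE_I[of _ _ "M - S"]) (auto intro: open_sets open_compl_supp)

lemma emeasure_supp: "E \<in> sets m \<Longrightarrow> emeasure m (S \<inter> E) = emeasure m E"
  using AE_supp by (intro emeasure_eq_AE) auto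

lemma supp_Int_M [simp]: "S \<inter> M = S" "M \<inter> S = S"
  using supp_subset by auto

lemma space_restrict_supp [simp]: "space (restrict_space m S) = S"
  by (simp add: space_restrict_space)

lemma sets_restrict_supp_iff: "A \<in> sets (restrict_space m S) \<longleftrightarrow> A \<subseteq> S \<and> A \<in> sets m"
  using supp_sets by (simp add: sets_restrict_space_iff)

lemma emeasure_restrict_supp: "A \<subseteq> S \<Longrightarrow> emeasure (restrict_space m S) A = emeasure m A"
  using supp_sets by (simp add: emeasure_restrict_space)

lemma prob_space_restrict_supp: "prob_space (restrict_space m S)"
  using emeasure_supp[of M] P.emeasure_space_1
  by (intro prob_spaceI) (simp add: emeasure_restrict_supp open_sets)

end

lemma pm_space_change_measure:
  assumes "pm_space X" "prob_space N" "sets N = sets (pm_measure X)"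
  shows "pm_space (X\<lparr>pm_measure := N\<rparr>)"
proof -
  interpret X: pm_sp X by standard fact
  have "space N = X.M" using sets_eq_imp_space_eq[OF assms(3)] by simp
  then show ?thesis using assms by (simp add: pm_space_def)
qed

lemma (in Metric_space) separable_spaceI:
  assumes "countable C" "C \<subseteq> M" "\<And>x e. x \<in> M \<Longrightarrow> e > 0 \<Longrightarrow> \<exists>c\<in>C. d x c < e"
  shows "separable_space mtopology"
  unfolding separable_space_def metric_closure_of
  using assms by (intro exI[of _ C]) (auto, blast)

text \<open>If the distance from \<open>f w\<close> to q is less than r, the same holds on the ball
  around w whose radius is the remaining slack, so the preimage of a ball is the trace of an open
  set. The subset \<open>A\<close> allows for isometries, which are controlled only on
  supports.\<close>

lemma lipschitz_measurable:
  assumes X: "pm_space X" and Y: "pm_space Y" and A: "A \<subseteq> mspace (pm_metric X)"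
    and f: "f \<in> A \<rightarrow> mspace (pm_metric Y)"
    and lip: "\<And>x x'. x \<in> A \<Longrightarrow> x' \<in> A \<Longrightarrow> mdist (pm_metric Y) (f x) (f x') \<le> mdist (pm_metric X) x x'"
  shows "f \<in> measurable (restrict_space (pm_measure X) A) (pm_measure Y)"
proof -
  interpret X: pm_sp X by standard fact
  interpret Y: pm_sp Y by standard fact
  have sp: "space (restrict_space X.m A) = A"
    using A by (auto simp: space_restrict_space)
  show ?thesis
  proof (rule Y.measurable_ballI, unfold sp, fact f)
    fix k r
    let ?q = "Y.dense_seq k"
    define U where "U = (\<Union>w\<in>{w\<in>A. Y.d ?q (f w) < r}. X.mball w (r - Y.d ?q (f w)))"
    have "openin X.mtopology U" by (auto simp: U_def)
    moreover have "{w \<in> A. Y.d ?q (f w) < r} = A \<inter> U"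
    proof (intro equalityI subsetI)
      fix v assume v: "v \<in> A \<inter> U"
      then obtain w where w: "w \<in> A" "X.d w v < r - Y.d ?q (f w)" by (auto simp: U_def)
      then have "f w \<in> Y.M" "f v \<in> Y.M" using v f by auto
      then have "Y.d ?q (f v) \<le> Y.d ?q (f w) + X.d w v"
        using Y.triangle[of ?q "f w" "f v"] lip[of w v] v w by simp
      then show "v \<in> {w \<in> A. Y.d ?q (f w) < r}" using w v by auto
    qed (use A in \<open>force simp: U_def\<close>)
    ultimately show "{w \<in> A. Y.d ?q (f w) < r} \<in> sets (restrict_space X.m A)"
      using X.open_sets by (auto simp: sets_restrict_space)
  qed
qed

subsection \<open>Isometries of the supports\<close>

text \<open>The pushforward condition is spelled out with preimages cut down to the support, so that
  inverses and compositions become set computations.\<close>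

definition pm_isometry :: "'a pm \<Rightarrow> 'b pm \<Rightarrow> ('a \<Rightarrow> 'b) \<Rightarrow> bool" where
  "pm_isometry X Y f \<longleftrightarrow>
     f ` pm_supp X = pm_supp Y \<and>
     (\<forall>x\<in>pm_supp X. \<forall>x'\<in>pm_supp X. mdist (pm_metric Y) (f x) (f x') = mdist (pm_metric X) x x') \<and>
     (\<forall>B\<in>sets (pm_measure Y). pm_supp X \<inter> f -` B \<in> sets (pm_measure X) \<and>
        emeasure (pm_measure X) (pm_supp X \<inter> f -` B) = emeasure (pm_measure Y) B)"

lemma pm_isometryD:
  assumes "pm_isometry X Y f"
  shows "f ` pm_supp X = pm_supp Y"
    and "x \<in> pm_supp X \<Longrightarrow> x' \<in> pm_supp X \<Longrightarrow> mdist (pm_metric Y) (f x) (f x') = mdist (pm_metric X) x x'"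
    and "B \<in> sets (pm_measure Y) \<Longrightarrow> pm_supp X \<inter> f -` B \<in> sets (pm_measure X)"
    and "B \<in> sets (pm_measure Y) \<Longrightarrow> emeasure (pm_measure X) (pm_supp X \<inter> f -` B) = emeasure (pm_measure Y) B"
  using assms unfolding pm_isometry_def by simp_all

lemma pm_isometric_iff:
  assumes X: "pm_space X" and Y: "pm_space Y"
  shows "pm_isometric X Y \<longleftrightarrow> (\<exists>f. pm_isometry X Y f)"
proof -
  interpret X: pm_sp X by standard fact
  interpret Y: pm_sp Y by standard fact
  have "distr (restrict_space X.m X.S) Y.m f = Y.m \<longleftrightarrow>
     (\<forall>B\<in>Y.P.events. X.S \<inter> f -` B \<in> X.P.events \<and> emeasure X.m (X.S \<inter> f -` B) = emeasure Y.m B)"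
    if f: "f ` X.S = Y.S" "\<forall>x\<in>X.S. \<forall>x'\<in>X.S. Y.d (f x) (f x') = X.d x x'" for f
  proof -
    have mf: "f \<in> measurable (restrict_space X.m X.S) Y.m"
      using f Y.supp_subset by (intro lipschitz_measurable X Y X.supp_subset) auto
    have em: "emeasure (distr (restrict_space X.m X.S) Y.m f) B = emeasure X.m (X.S \<inter> f -` B)"
      if "B \<in> Y.P.events" for B
      using that mf X.supp_subset
      by (simp add: emeasure_distr X.emeasure_restrict_supp Int_commute)
    have "X.S \<inter> f -` B \<in> X.P.events" if "B \<in> Y.P.events" for B
    proof -
      have "f -` B \<inter> X.S \<in> sets (restrict_space X.m X.S)"
        using measurable_sets[OF mf that] by simp
      then show ?thesis
        by (simp add: X.sets_restrict_supp_iff Int_commute)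
    qed
    moreover have "distr (restrict_space X.m X.S) Y.m f = Y.m \<longleftrightarrow>
        (\<forall>B\<in>Y.P.events. emeasure (distr (restrict_space X.m X.S) Y.m f) B = emeasure Y.m B)"
      by (auto intro: measure_eqI)
    ultimately show ?thesis using em by simp
  qed
  then show ?thesis unfolding pm_isometric_def pm_isometry_def by blast
qed

lemma pm_isometry_inj:
  assumes "pm_isometry X Y f" shows "inj_on f (pm_supp X)"
proof (rule inj_onI)
  fix x x' assume *: "x \<in> pm_supp X" "x' \<in> pm_supp X" "f x = f x'"
  then have "f x' \<in> mspace (pm_metric Y)"
    using assms by (auto simp: pm_isometry_def pm_supp_def)
  then have "mdist (pm_metric X) x x' = 0"
    using pm_isometryD(2)[OF assms *(1,2)] *(3) mdist_zero[of "f x'" "pm_metric Y" "f x'"] by simp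
  then show "x = x'" using * by (simp add: pm_supp_def)
qed

lemma pm_isometry_id: "pm_space X \<Longrightarrow> pm_isometry X X id"
  unfolding pm_isometry_def by (auto simp: pm_sp.emeasure_supp pm_sp.intro intro!: sets.Int pm_sp.supp_sets)

lemma pm_isometry_inv:
  assumes X: "pm_space X" and Y: "pm_space Y" and f: "pm_isometry X Y f"
  shows "pm_isometry Y X (inv_into (pm_supp X) f)"
proof -
  interpret X: pm_sp X by standard fact
  interpret Y: pm_sp Y by standard fact
  let ?g = "inv_into X.S f"
  have inj: "inj_on f X.S" by (rule pm_isometry_inj[OF f])
  have img: "f ` X.S = Y.S" and dist: "\<And>x x'. x \<in> X.S \<Longrightarrow> x' \<in> X.S \<Longrightarrow> Y.d (f x) (f x') = X.d x x'"
    and meas: "\<And>B. B \<in> Y.P.events \<Longrightarrow> emeasure X.m (X.S \<inter> f -` B) = emeasure Y.m B"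
    using pm_isometryD[OF f] by blast+
  have gS: "?g ` Y.S = X.S" using inj img by (auto simp: image_image simp flip: img)
  have dg: "X.d (?g y) (?g y') = Y.d y y'" if "y \<in> Y.S" "y' \<in> Y.S" for y y'
    using that inj img dist by (metis f_inv_into_f inv_into_into)
  have mg: "?g \<in> measurable (restrict_space Y.m Y.S) X.m"
    using gS X.supp_subset by (intro lipschitz_measurable X Y Y.supp_subset) (auto simp: dg)
  have "Y.S \<inter> ?g -` B \<in> Y.P.events \<and> emeasure Y.m (Y.S \<inter> ?g -` B) = emeasure X.m B"
    if B: "B \<in> X.P.events" for B
  proof -
    have "?g -` B \<inter> space (restrict_space Y.m Y.S) \<in> sets (restrict_space Y.m Y.S)"
      using measurable_sets[OF mg B] .
    then have s: "Y.S \<inter> ?g -` B \<in> Y.P.events"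
      by (simp add: Y.sets_restrict_supp_iff Int_commute)
    have "emeasure Y.m (Y.S \<inter> ?g -` B) = emeasure X.m (X.S \<inter> f -` (Y.S \<inter> ?g -` B))"
      using meas[OF s] by simp
    also have "X.S \<inter> f -` (Y.S \<inter> ?g -` B) = X.S \<inter> B"
      using inj img by auto
    finally show ?thesis using s B by (simp add: X.emeasure_supp)
  qed
  then show ?thesis using gS dg by (simp add: pm_isometry_def)
qed

lemma pm_isometry_comp:
  assumes f: "pm_isometry X Y f" and g: "pm_isometry Y Z g" and X: "pm_space X" and Y: "pm_space Y"
  shows "pm_isometry X Z (g \<circ> f)"
proof -
  interpret X: pm_sp X by standard fact
  interpret Y: pm_sp Y by standard fact
  note f' = pm_isometryD[OF f] and g' = pm_isometryD[OF g]
  have "X.S \<inter> (g \<circ> f) -` B = X.S \<inter> f -` (Y.S \<inter> g -` B)" for B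
    unfolding f'(1)[symmetric] by auto
  moreover have "(g \<circ> f) ` X.S = pm_supp Z"
    by (simp only: image_comp[symmetric] f' g')
  moreover have "mdist (pm_metric Z) ((g \<circ> f) x) ((g \<circ> f) x') = X.d x x'" if "x \<in> X.S" "x' \<in> X.S" for x x'
  proof -
    have "f x \<in> Y.S" "f x' \<in> Y.S" using that f'(1) by blast+
    then show ?thesis using that by (simp add: f'(2) g'(2))
  qed
  ultimately show ?thesis
    unfolding pm_isometry_def using f'(3)[OF g'(3)] f'(4)[OF g'(3)] g'(4) by auto
qed

lemma pm_isometric_sym:
  assumes "pm_space X" "pm_space Y" "pm_isometric X Y"
  shows "pm_isometric Y X"
proof -
  obtain f where "pm_isometry X Y f" using assms pm_isometric_iff by blast
  from pm_isometry_inv[OF assms(1,2) this] show ?thesis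
    using pm_isometric_iff[OF assms(2,1)] by blast
qed

lemma pm_isometric_trans:
  assumes "pm_space X" "pm_space Y" "pm_space Z" "pm_isometric X Y" "pm_isometric Y Z"
  shows "pm_isometric X Z"
proof -
  obtain f g where "pm_isometry X Y f" "pm_isometry Y Z g"
    using assms(4,5) pm_isometric_iff[OF assms(1,2)] pm_isometric_iff[OF assms(2,3)] by blast
  from pm_isometry_comp[OF this assms(1,2)] show ?thesis
    using pm_isometric_iff[OF assms(1,3)] by blast
qed

text \<open>With the identity for \<iota> this yields representatives of full support; with an
  injection into the reals it brings spaces on other carrier types into \<open>pm_classes\<close>.
  Only the support is copied, and completeness survives because the support is closed.\<close>

lemma ex_full_support_transport:
  fixes X :: "'a pm" and \<iota> :: "'a \<Rightarrow> 'b"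
  assumes X: "pm_space X" and inj: "inj_on \<iota> (mspace (pm_metric X))"
  shows "\<exists>Z :: 'b pm. pm_space Z \<and> full_support Z \<and> pm_isometry X Z \<iota>"
proof -
  interpret X: pm_sp X by standard fact
  define g where "g = inv_into X.S \<iota>"
  have injS: "inj_on \<iota> X.S" by (rule inj_on_subset[OF inj X.supp_subset])
  have g\<iota> [simp]: "g (\<iota> x) = x" if "x \<in> X.S" for x using that injS by (simp add: g_def inv_into_f_f)
  define T where "T = \<iota> ` X.S"
  define \<delta> where "\<delta> a b = X.d (g a) (g b)" for a b
  have gS: "g a \<in> X.S" if "a \<in> T" for a using that by (auto simp: T_def)
  have gM: "g a \<in> X.M" if "a \<in> T" for a using gS[OF that] X.supp_subset by auto
  have \<iota>g: "\<iota> (g a) = a" if "a \<in> T" for a using that by (auto simp: T_def)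
  interpret T: Metric_space T \<delta>
  proof
    show "0 \<le> \<delta> x y" "\<delta> x y = \<delta> y x" for x y by (simp_all add: \<delta>_def X.commute)
    show "\<delta> x y = 0 \<longleftrightarrow> x = y" if "x \<in> T" "y \<in> T" for x y
      using X.zero[OF gM gM, OF that] \<iota>g[OF that(1)] \<iota>g[OF that(2)] unfolding \<delta>_def by metis
    show "\<delta> x z \<le> \<delta> x y + \<delta> y z" if "x \<in> T" "y \<in> T" "z \<in> T" for x y z
      using X.triangle[OF gM gM gM, OF that] unfolding \<delta>_def .
  qed
  have \<iota>T: "\<iota> x \<in> T" if "x \<in> X.S" for x using that by (simp add: T_def)
  have \<delta>\<iota>: "\<delta> (\<iota> x) (\<iota> y) = X.d x y" if "x \<in> X.S" "y \<in> X.S" for x y using that by (simp add: \<delta>_def)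
  have pre: "\<exists>U. openin X.mtopology U \<and> X.S \<inter> \<iota> -` V = X.S \<inter> U" if V: "openin T.mtopology V" for V
  proof -
    define U where "U = (\<Union>w\<in>X.S. \<Union>r\<in>{r. T.mball (\<iota> w) r \<subseteq> V}. X.mball w r)"
    have "openin X.mtopology U" unfolding U_def by (intro openin_Union) blast
    moreover have "X.S \<inter> \<iota> -` V = X.S \<inter> U"
    proof (intro equalityI subsetI)
      fix v assume v: "v \<in> X.S \<inter> \<iota> -` V"
      then obtain r where r: "r > 0" "T.mball (\<iota> v) r \<subseteq> V"
        using V unfolding T.openin_mtopology by blast
      have "v \<in> X.mball v r" using v r X.supp_subset by auto
      then show "v \<in> X.S \<inter> U" using v r unfolding U_def by blast
    next
      fix v assume v: "v \<in> X.S \<inter> U"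
      then obtain w r where w: "w \<in> X.S" "T.mball (\<iota> w) r \<subseteq> V" "v \<in> X.mball w r"
        unfolding U_def by blast
      then have "\<iota> v \<in> T.mball (\<iota> w) r" using v \<iota>T[of v] \<iota>T[of w] \<delta>\<iota>[of w v] by simp
      then show "v \<in> X.S \<inter> \<iota> -` V" using v w by blast
    qed
    ultimately show ?thesis by blast
  qed
  define N where "N = sigma T {U. openin T.mtopology U}"
  have opT: "{U. openin T.mtopology U} \<subseteq> Pow T"
    using openin_subset by fastforce
  have N: "space N = T" "sets N = sigma_sets T {U. openin T.mtopology U}"
    using opT by (simp_all add: N_def space_measure_of sets_measure_of)
  let ?R = "restrict_space X.m X.S"
  have m\<iota>: "\<iota> \<in> measurable ?R N"
  proof (rule measurable_sigma_sets[OF N(2) opT])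
    show "\<iota> \<in> space ?R \<rightarrow> T" using \<iota>T by simp
    fix V assume "V \<in> {U. openin T.mtopology U}"
    then obtain U where "openin X.mtopology U" "X.S \<inter> \<iota> -` V = X.S \<inter> U" using pre by blast
    then show "\<iota> -` V \<inter> space ?R \<in> sets ?R"
      using X.open_sets by (auto simp: sets_restrict_space Int_commute)
  qed
  have pR: "prob_space ?R"
    by (rule X.prob_space_restrict_supp)
  define Z where "Z = \<lparr>pm_metric = metric (T, \<delta>), pm_measure = distr ?R N \<iota>\<rparr>"
  have top: "mtopology_of (pm_metric Z) = T.mtopology" and mZ: "pm_measure Z = distr ?R N \<iota>"
    and MZ: "mspace (pm_metric Z) = T" and dZ: "mdist (pm_metric Z) = \<delta>"
    by (simp_all add: Z_def)
  have em: "X.S \<inter> \<iota> -` B \<in> X.P.events" "emeasure (pm_measure Z) B = emeasure X.m (X.S \<inter> \<iota> -` B)" if "B \<in> sets N" for B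
  proof -
    show "X.S \<inter> \<iota> -` B \<in> X.P.events"
      using measurable_sets[OF m\<iota> that] by (simp add: X.sets_restrict_supp_iff Int_commute)
    show "emeasure (pm_measure Z) B = emeasure X.m (X.S \<inter> \<iota> -` B)"
      using that m\<iota> by (simp add: mZ emeasure_distr X.emeasure_restrict_supp Int_commute)
  qed
  have "T.mcomplete"
    unfolding T.mcomplete_def
  proof (intro allI impI)
    fix \<sigma> assume \<sigma>: "T.MCauchy \<sigma>"
    then have \<sigma>T: "\<sigma> n \<in> T" for n by (auto simp: T.MCauchy_def)
    have "X.MCauchy (g \<circ> \<sigma>)"
      using \<sigma> gM \<sigma>T by (auto simp: T.MCauchy_def X.MCauchy_def \<delta>_def)
    then obtain x where x: "limitin X.mtopology (g \<circ> \<sigma>) x sequentially"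
      using X.complete by (auto simp: X.mcomplete_def)
    have xS: "x \<in> X.S"
    proof -
      have "range (g \<circ> \<sigma>) \<subseteq> X.S" using gS \<sigma>T by auto
      then show ?thesis
        using X.closed_supp x unfolding X.metric_closedin_iff_sequentially_closed by blast
    qed
    have "limitin T.mtopology \<sigma> (\<iota> x) sequentially"
      using x \<iota>T[OF xS] \<sigma>T xS unfolding T.limitin_metric X.limitin_metric
      by (auto simp: \<delta>_def elim: eventually_mono)
    then show "\<exists>x. limitin T.mtopology \<sigma> x sequentially" ..
  qed
  moreover have "separable_space T.mtopology"
  proof -
    \<comment> \<open>The dense sequence may miss the support, so one point of the support is picked
      from each basic ball that meets it.\<close>
    define c where "c p = (SOME x. x \<in> X.S \<inter> X.basic_ball p)" for p
    define C where "C = {p. X.S \<inter> X.basic_ball p \<noteq> {}}"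
    have c: "c p \<in> X.S \<inter> X.basic_ball p" if "p \<in> C" for p
      unfolding c_def by (rule someI_ex) (use that in \<open>auto simp: C_def\<close>)
    show ?thesis
    proof (rule T.separable_spaceI)
      show "countable ((\<iota> \<circ> c) ` C)" by simp
      show "(\<iota> \<circ> c) ` C \<subseteq> T" using c \<iota>T by auto
      fix y and e :: real assume y: "y \<in> T" and e: "e > 0"
      have "g y \<in> X.mball (g y) e" using e gM[OF y] by simp
      then obtain p where p: "X.basic_ball p \<subseteq> X.mball (g y) e" "g y \<in> X.basic_ball p"
        using X.open_eq_Union_basic_balls[OF X.openin_mball[of "g y" e]] by blast
      then have "p \<in> C" using gS[OF y] by (auto simp: C_def)
      then have "\<iota> (c p) \<in> (\<iota> \<circ> c) ` C" "\<delta> y (\<iota> (c p)) < e"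
        using c[of p] p by (auto simp: \<delta>_def)
      then show "\<exists>c\<in>(\<iota> \<circ> c) ` C. \<delta> y c < e" by blast
    qed
  qed
  ultimately have Z: "pm_space Z"
    using pR m\<iota> by (auto simp: pm_space_def top mZ MZ N prob_space.prob_space_distr) (simp add: Z_def)
  have supp: "pm_supp Z = T"
  proof (intro equalityI subsetI)
    fix y assume y: "y \<in> T"
    have "emeasure (pm_measure Z) V > 0" if V: "openin T.mtopology V" "y \<in> V" for V
    proof -
      obtain U where U: "openin X.mtopology U" "X.S \<inter> \<iota> -` V = X.S \<inter> U" using pre V by blast
      have "g y \<in> X.S \<inter> \<iota> -` V" using gS \<iota>g y V by auto
      then have "g y \<in> U" "g y \<in> X.S" using U by auto
      then have "emeasure X.m U > 0" using U(1) by (auto simp: pm_supp_def)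
      moreover have "V \<in> sets N" using V by (auto simp: N)
      ultimately show ?thesis using em U by (simp add: X.emeasure_supp X.open_sets)
    qed
    then show "y \<in> pm_supp Z" using y by (simp add: pm_supp_def top MZ)
  qed (auto simp: pm_supp_def MZ)
  have "pm_isometry X Z \<iota>"
    using em by (auto simp: pm_isometry_def supp T_def[symmetric] dZ \<delta>\<iota> mZ)
  then show ?thesis using Z supp by (auto simp: full_support_def MZ)
qed

subsection \<open>Parameters and the box distance\<close>

lemma space_unit_lebesgue [simp]: "space unit_lebesgue = {0..1}"
  by (simp add: unit_lebesgue_def space_restrict_space)

lemma sets_unit_lebesgue: "A \<in> sets unit_lebesgue \<longleftrightarrow> A \<in> sets borel \<and> A \<subseteq> {0..1}"
  unfolding unit_lebesgue_def by (subst sets_restrict_space_iff) auto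

lemma emeasure_unit_lebesgue: "A \<subseteq> {0..1} \<Longrightarrow> emeasure unit_lebesgue A = emeasure lborel A"
  by (simp add: unit_lebesgue_def emeasure_restrict_space)

lemma parameter_iff:
  assumes "pm_space X"
  shows "parameter X a \<longleftrightarrow> a \<in> {0..1} \<rightarrow> mspace (pm_metric X) \<and>
    (\<forall>E\<in>sets (pm_measure X). {t\<in>{0..1}. a t \<in> E} \<in> sets borel \<and>
       emeasure lborel {t\<in>{0..1}. a t \<in> E} = emeasure (pm_measure X) E)"
proof -
  interpret X: pm_sp X by standard fact
  have eq: "a -` E \<inter> {0..1} = {t\<in>{0..1}. a t \<in> E}" for E by auto
  have sets: "{t\<in>{0..1}. a t \<in> E} \<in> sets unit_lebesgue \<longleftrightarrow> {t\<in>{0..1}. a t \<in> E} \<in> sets borel" for E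
    by (auto simp: sets_unit_lebesgue)
  have em: "emeasure unit_lebesgue {t\<in>{0..1}. a t \<in> E} = emeasure lborel {t\<in>{0..1}. a t \<in> E}" for E
    by (intro emeasure_unit_lebesgue) auto
  have meas: "a \<in> measurable unit_lebesgue X.m \<longleftrightarrow> a \<in> {0..1} \<rightarrow> X.M \<and>
      (\<forall>E\<in>X.P.events. {t\<in>{0..1}. a t \<in> E} \<in> sets borel)"
    by (simp only: measurable_def eq sets Pi_iff space_unit_lebesgue X.space_m mem_Collect_eq)
  have "distr unit_lebesgue X.m a = X.m \<longleftrightarrow>
     (\<forall>E\<in>X.P.events. emeasure lborel {t\<in>{0..1}. a t \<in> E} = emeasure X.m E)"
    if "a \<in> measurable unit_lebesgue X.m"
  proof -
    have *: "emeasure (distr unit_lebesgue X.m a) E = emeasure lborel {t\<in>{0..1}. a t \<in> E}"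
      if "E \<in> X.P.events" for E
      using that \<open>a \<in> measurable unit_lebesgue X.m\<close> by (simp only: emeasure_distr eq em space_unit_lebesgue)
    show ?thesis
    proof
      assume "distr unit_lebesgue X.m a = X.m"
      then show "\<forall>E\<in>X.P.events. emeasure lborel {t\<in>{0..1}. a t \<in> E} = emeasure X.m E"
        using * by simp
    next
      assume "\<forall>E\<in>X.P.events. emeasure lborel {t\<in>{0..1}. a t \<in> E} = emeasure X.m E"
      then show "distr unit_lebesgue X.m a = X.m"
        using * by (intro measure_eqI) auto
    qed
  qed
  then show ?thesis unfolding parameter_def meas by blast
qed

definition box_le :: "'a pm \<Rightarrow> 'b pm \<Rightarrow> real \<Rightarrow> bool" where
  "box_le X Y \<epsilon> \<longleftrightarrow> (\<exists>a b I.
     parameter X a \<and> parameter Y b \<and>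
     I \<in> sets borel \<and> I \<subseteq> {0..1} \<and> measure lborel I \<ge> 1 - \<epsilon> \<and>
     (\<forall>s\<in>I. \<forall>t\<in>I.
        \<bar>mdist (pm_metric X) (a s) (a t) - mdist (pm_metric Y) (b s) (b t)\<bar> \<le> \<epsilon>))"

lemma pm_box_eq: "pm_box X Y = Inf {\<epsilon>. \<epsilon> > 0 \<and> box_le X Y \<epsilon>}"
  by (simp add: pm_box_def box_le_def)

lemma pm_box_le: "box_le X Y \<epsilon> \<Longrightarrow> \<epsilon> > 0 \<Longrightarrow> pm_box X Y \<le> \<epsilon>"
  unfolding pm_box_eq by (intro cInf_lower bdd_belowI[of _ 0]) auto

text \<open>A parameter of \<open>Y\<close> may leave the support of \<open>Y\<close> on a null set,
  where \<open>f\<close> is not controlled. There the new parameter takes an arbitrary value z, and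
  the null set is removed from the good set, so \<epsilon> does not change.\<close>

lemma box_le_isometry:
  assumes Y: "pm_space Y" and Z: "pm_space Z" and f: "pm_isometry Y Z f" and le: "box_le X Y \<epsilon>"
  shows "box_le X Z \<epsilon>"
proof -
  interpret Y: pm_sp Y by standard fact
  interpret Z: pm_sp Z by standard fact
  obtain a b I where ab: "parameter X a" "parameter Y b" "I \<in> sets borel" "I \<subseteq> {0..1}"
    "measure lborel I \<ge> 1 - \<epsilon>"
    and I: "\<And>s t. s \<in> I \<Longrightarrow> t \<in> I \<Longrightarrow> \<bar>mdist (pm_metric X) (a s) (a t) - Y.d (b s) (b t)\<bar> \<le> \<epsilon>"
    using le unfolding box_le_def by blast
  have b: "b \<in> {0..1} \<rightarrow> Y.M" "\<And>E. E \<in> Y.P.events \<Longrightarrow> {t\<in>{0..1}. b t \<in> E} \<in> sets borel"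
     "\<And>E. E \<in> Y.P.events \<Longrightarrow> emeasure lborel {t\<in>{0..1}. b t \<in> E} = emeasure Y.m E"
    using ab(2) unfolding parameter_iff[OF Y] by blast+
  obtain z where z: "z \<in> Z.M" using Z.nonempty by blast
  define W where "W = {t\<in>{0..1}. b t \<in> Y.S}"
  define V where "V = {t\<in>{0..1}. b t \<in> Y.M - Y.S}"
  have compl: "Y.M - Y.S \<in> Y.P.events" by (intro Y.open_sets Y.open_compl_supp)
  have W: "W \<in> sets borel" unfolding W_def by (rule b) simp
  have V: "V \<in> sets borel" "emeasure lborel V = 0"
    unfolding V_def using b(2,3)[OF compl] Y.null_compl_supp by simp_all
  have WV: "W \<union> V = {0..1}" "W \<inter> V = {}" using b(1) by (auto simp: W_def V_def)
  define c where "c t = (if b t \<in> Y.S then f (b t) else z)" for t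
  have fS: "f y \<in> Z.M" if "y \<in> Y.S" for y
    using pm_isometryD(1)[OF f] Z.supp_subset that by blast
  have "parameter Z c"
    unfolding parameter_iff[OF Z]
  proof (intro conjI ballI)
    show "c \<in> {0..1} \<rightarrow> Z.M" using z fS by (auto simp: c_def)
    fix E assume E: "E \<in> Z.P.events"
    define B where "B = {t\<in>{0..1}. b t \<in> Y.S \<inter> f -` E}"
    define N where "N = (if z \<in> E then V else {})"
    have N: "N \<in> null_sets lborel" using V by (auto simp: N_def null_sets_def)
    have eq: "{t\<in>{0..1}. c t \<in> E} = B \<union> N"
    proof (rule Set.set_eqI)
      fix t
      show "t \<in> {t\<in>{0..1}. c t \<in> E} \<longleftrightarrow> t \<in> B \<union> N"
        using funcset_mem[OF b(1), of t] by (cases "b t \<in> Y.S") (auto simp: B_def N_def c_def V_def)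
    qed
    have B: "B \<in> sets borel" "emeasure lborel B = emeasure Z.m E"
      unfolding B_def using b(2,3)[OF pm_isometryD(3)[OF f E]] pm_isometryD(4)[OF f E] by simp_all
    show "{t\<in>{0..1}. c t \<in> E} \<in> sets borel"
      using B N unfolding eq by (auto simp: null_sets_def)
    show "emeasure lborel {t\<in>{0..1}. c t \<in> E} = emeasure Z.m E"
      using B N unfolding eq by (simp add: emeasure_Un_null_set)
  qed
  moreover have "measure lborel (I \<inter> W) = measure lborel I"
  proof -
    have "emeasure lborel (I - V) = emeasure lborel I"
      using V ab(3) by (intro emeasure_Diff_null_set) (auto simp: null_sets_def)
    moreover have "I - V = I \<inter> W" using WV ab(4) by auto
    ultimately show ?thesis by (simp add: measure_def)
  qed
  moreover have "\<bar>mdist (pm_metric X) (a s) (a t) - Z.d (c s) (c t)\<bar> \<le> \<epsilon>"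
    if "s \<in> I \<inter> W" "t \<in> I \<inter> W" for s t
    using that I[of s t] pm_isometryD(2)[OF f] by (auto simp: c_def W_def)
  ultimately show ?thesis
    unfolding box_le_def using ab W
    by (intro exI[of _ a] exI[of _ c] exI[of _ "I \<inter> W"]) auto
qed

section \<open>Existence of parameters through a Borel coding of points by reals\<close>

primrec ternary_shift :: "nat \<Rightarrow> real \<Rightarrow> real" where
  "ternary_shift 0 y = y"
| "ternary_shift (Suc k) y = 3 * ternary_shift k y - (if ternary_shift k y \<ge> 1 / 3 then 1 else 0)"

text \<open>Bits are written as digits 0 and 1 in base 3. If the first bit is 0, the rest
  contributes at most 1/6 < 1/3, so the bits can be read off without the ambiguity of binary
  expansions.\<close>

definition ternary_code :: "(nat \<Rightarrow> bool) \<Rightarrow> real" where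
  "ternary_code b = (\<Sum>k. of_bool (b k) * (1 / 3) ^ Suc k)"

lemma ternary_geometric: "(\<lambda>k. (1 / 3 :: real) ^ Suc k) sums (1 / 2)"
  using sums_mult[OF geometric_sums[of "1/3 :: real"], of "1/3"] by simp

lemma summable_ternary: "summable (\<lambda>k. of_bool (b k) * (1 / 3 :: real) ^ Suc k)"
  by (rule summable_comparison_test'[OF sums_summable[OF ternary_geometric], of 0]) auto

lemma ternary_code_bounds: "0 \<le> ternary_code b" "ternary_code b \<le> 1 / 2"
proof -
  show "0 \<le> ternary_code b"
    unfolding ternary_code_def by (intro suminf_nonneg summable_ternary) auto
  have "ternary_code b \<le> (\<Sum>k. (1 / 3 :: real) ^ Suc k)"
    unfolding ternary_code_def
    by (intro suminf_le summable_ternary sums_summable[OF ternary_geometric]) auto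
  then show "ternary_code b \<le> 1 / 2" using ternary_geometric by (simp add: sums_iff)
qed

lemma ternary_code_split: "ternary_code b = of_bool (b 0) / 3 + ternary_code (\<lambda>j. b (Suc j)) / 3"
proof -
  have "ternary_code b = of_bool (b 0) * (1/3) ^ Suc 0 + (\<Sum>k. of_bool (b (Suc k)) * (1 / 3) ^ Suc (Suc k))"
    unfolding ternary_code_def using suminf_split_head[OF summable_ternary[of b]] by simp
  also have "(\<Sum>k. of_bool (b (Suc k)) * (1 / 3 :: real) ^ Suc (Suc k)) =
     (\<Sum>k. (1 / 3) * (of_bool (b (Suc k)) * (1 / 3) ^ Suc k))"
    by (intro suminf_cong) simp
  also have "\<dots> = 1 / 3 * ternary_code (\<lambda>j. b (Suc j))"
    unfolding ternary_code_def by (rule suminf_mult[OF summable_ternary])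
  finally show ?thesis by simp
qed

lemma ternary_code_ge_iff: "ternary_code b \<ge> 1 / 3 \<longleftrightarrow> b 0"
  using ternary_code_split[of b] ternary_code_bounds[of "\<lambda>j. b (Suc j)"] by (cases "b 0") auto

lemma ternary_shift_code: "ternary_shift k (ternary_code b) = ternary_code (\<lambda>j. b (k + j))"
proof (induction k)
  case (Suc k)
  then show ?case
    using ternary_code_split[of "\<lambda>j. b (k + j)"] ternary_code_ge_iff[of "\<lambda>j. b (k + j)"]
    by (cases "b k") (simp_all add: field_simps)
qed simp

lemma ternary_digit: "ternary_shift k (ternary_code b) \<ge> 1 / 3 \<longleftrightarrow> b k"
  using ternary_code_ge_iff[of "\<lambda>j. b (k + j)"] by (simp add: ternary_shift_code)

lemma measurable_ternary_shift [measurable]: "ternary_shift k \<in> borel_measurable borel"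
  by (induction k) simp_all

lemma measurable_ternary_code [measurable (raw)]:
  assumes [measurable]: "\<And>k. Measurable.pred N (\<lambda>x. b x k)"
  shows "(\<lambda>x. ternary_code (b x)) \<in> borel_measurable N"
  unfolding ternary_code_def of_bool_def by measurable

context pm_sp
begin

text \<open>The code of a point records which balls around the dense sequence contain it. A point is
  recovered as the limit of centres of such balls, which makes the decoding Borel.\<close>

definition code :: "'a \<Rightarrow> real" where
  "code x = ternary_code (\<lambda>k. d (dense_seq (snd (prod_decode k))) x < 1 / real (Suc (fst (prod_decode k))))"

definition decode_index :: "real \<Rightarrow> nat \<Rightarrow> nat" where
  "decode_index y n = (LEAST i. ternary_shift (prod_encode (n, i)) y \<ge> 1 / 3)"

text \<open>Codes of points satisfy this by the triangle inequality, and it forces the decoded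
  centres to be Cauchy. It delimits the reals on which the limit is taken, so that
  \<open>decode\<close> is total and Borel.\<close>

definition decodable :: "real \<Rightarrow> bool" where
  "decodable y \<longleftrightarrow> (\<forall>n k. d (dense_seq (decode_index y n)) (dense_seq (decode_index y k))
      \<le> 1 / real (Suc n) + 1 / real (Suc k))"

definition decode :: "real \<Rightarrow> 'a" where
  "decode y = (if decodable y
     then SOME l. limitin mtopology (\<lambda>n. dense_seq (decode_index y n)) l sequentially
     else dense_seq 0)"

lemma measurable_code [measurable]: "code \<in> borel_measurable m"
  unfolding code_def by measurable

lemma measurable_decode_index [measurable]: "(\<lambda>y. decode_index y n) \<in> measurable borel (count_space UNIV)"
  unfolding decode_index_def by measurable

lemma measurable_decodable [measurable]: "Measurable.pred borel decodable"
proof -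
  have [measurable]: "(\<lambda>y. d (dense_seq (decode_index y n)) (dense_seq (decode_index y k))) \<in> borel_measurable borel" for n k
    by (rule measurable_compose_countable[of "\<lambda>i y. d (dense_seq i) (dense_seq (decode_index y k))"])
       (rule measurable_compose_countable[of "\<lambda>j y. d (dense_seq _) (dense_seq j)"], auto)
  show ?thesis unfolding decodable_def by measurable
qed

lemma decode_limit:
  assumes "decodable y"
  shows "limitin mtopology (\<lambda>n. dense_seq (decode_index y n)) (decode y) sequentially"
proof -
  have "MCauchy (\<lambda>n. dense_seq (decode_index y n))"
    unfolding MCauchy_def
  proof (intro conjI allI impI)
    fix \<epsilon> :: real assume "\<epsilon> > 0"
    then obtain N where N: "1 / real (Suc N) < \<epsilon> / 2" using nat_approx_posE[of "\<epsilon>/2"] by auto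
    have "d (dense_seq (decode_index y n)) (dense_seq (decode_index y n')) < \<epsilon>" if "N \<le> n" "N \<le> n'" for n n'
    proof -
      have "1 / real (Suc n) \<le> 1 / real (Suc N)" "1 / real (Suc n') \<le> 1 / real (Suc N)"
        using that by (auto intro!: divide_left_mono)
      moreover have "d (dense_seq (decode_index y n)) (dense_seq (decode_index y n')) \<le> 1 / real (Suc n) + 1 / real (Suc n')"
        using assms unfolding decodable_def by blast
      ultimately show ?thesis using N by linarith
    qed
    then show "\<exists>N. \<forall>n n'. N \<le> n \<longrightarrow> N \<le> n' \<longrightarrow>
        d (dense_seq (decode_index y n)) (dense_seq (decode_index y n')) < \<epsilon>" by blast
  qed auto
  then have "\<exists>l. limitin mtopology (\<lambda>n. dense_seq (decode_index y n)) l sequentially"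
    using complete unfolding mcomplete_def by blast
  then show ?thesis using assms unfolding decode_def by (auto intro: someI_ex)
qed

lemma decode_in [simp]: "decode y \<in> M"
  using decode_limit[of y] limitin_mspace by (cases "decodable y") (auto simp: decode_def)

lemma limitin_imp_dist_tendsto:
  assumes "limitin mtopology \<sigma> l sequentially" "x \<in> M" "\<And>n. \<sigma> n \<in> M"
  shows "(\<lambda>n. d x (\<sigma> n)) \<longlonglongrightarrow> d x l"
proof (rule tendstoI)
  fix e :: real assume "e > 0"
  then have "\<forall>\<^sub>F n in sequentially. d (\<sigma> n) l < e"
    using assms(1) unfolding limitin_metric by (auto elim: eventually_mono)
  then show "\<forall>\<^sub>F n in sequentially. dist (d x (\<sigma> n)) (d x l) < e"
  proof eventually_elim
    case (elim n)
    have "l \<in> M" using assms(1) by (rule limitin_mspace)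
    then show ?case
      using elim assms(2) assms(3)[of n] mdist_reverse_triangle[of "\<sigma> n" x l] by (simp add: dist_real_def commute)
  qed
qed

lemma measurable_decode [measurable]: "decode \<in> measurable borel m"
proof (rule measurable_ballI)
  fix k r
  have "(\<lambda>y. d (dense_seq k) (decode y)) \<in> borel_measurable borel"
  proof (rule borel_measurable_LIMSEQ_real)
    fix n
    have [measurable]: "(\<lambda>y. d (dense_seq k) (dense_seq (decode_index y n))) \<in> borel_measurable borel"
      by (rule measurable_compose_countable[of "\<lambda>i y. d (dense_seq k) (dense_seq i)"]) auto
    show "(\<lambda>y. if decodable y then d (dense_seq k) (dense_seq (decode_index y n)) else d (dense_seq k) (dense_seq 0)) \<in> borel_measurable borel"
      by measurable
  next
    fix y
    show "(\<lambda>n. if decodable y then d (dense_seq k) (dense_seq (decode_index y n)) else d (dense_seq k) (dense_seq 0)) \<longlonglongrightarrow> d (dense_seq k) (decode y)"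
      using limitin_imp_dist_tendsto[OF decode_limit[of y]] by (cases "decodable y") (auto simp: decode_def)
  qed
  then show "{w \<in> space borel. d (dense_seq k) (decode w) < r} \<in> sets borel" by simp
qed auto

lemma decode_code [simp]:
  assumes x: "x \<in> M" shows "decode (code x) = x"
proof -
  have idx: "decode_index (code x) n = (LEAST i. d (dense_seq i) x < 1 / real (Suc n))" for n
    unfolding decode_index_def code_def ternary_digit by (simp only: prod_encode_inverse fst_conv snd_conv)
  have near: "d (dense_seq (decode_index (code x) n)) x < 1 / real (Suc n)" for n
  proof -
    have "\<exists>i. d (dense_seq i) x < 1 / real (Suc n)"
      using dense_seq_near[OF x, of "1 / real (Suc n)"] by (simp add: commute[of _ x])
    then show ?thesis unfolding idx by (rule LeastI_ex)
  qed
  have dec: "decodable (code x)"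
    unfolding decodable_def
  proof (intro allI)
    fix n k
    show "d (dense_seq (decode_index (code x) n)) (dense_seq (decode_index (code x) k)) \<le> 1 / real (Suc n) + 1 / real (Suc k)"
      using triangle'[of "dense_seq (decode_index (code x) n)" x "dense_seq (decode_index (code x) k)"]
        triangle[of "dense_seq (decode_index (code x) n)" x "dense_seq (decode_index (code x) k)"]
        near[of n] near[of k] x by (simp add: commute)
  qed
  have "limitin mtopology (\<lambda>n. dense_seq (decode_index (code x) n)) x sequentially"
    unfolding limitin_metric
  proof (intro conjI allI impI x)
    fix \<epsilon> :: real assume "\<epsilon> > 0"
    then obtain N where N: "1 / real (Suc N) < \<epsilon>" using nat_approx_posE by blast
    have "d (dense_seq (decode_index (code x) n)) x < \<epsilon>" if "N \<le> n" for n
    proof -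
      have "1 / real (Suc n) \<le> 1 / real (Suc N)" using that by (auto intro!: divide_left_mono)
      then show ?thesis using near[of n] N by linarith
    qed
    then show "\<forall>\<^sub>F n in sequentially. dense_seq (decode_index (code x) n) \<in> M \<and> d (dense_seq (decode_index (code x) n)) x < \<epsilon>"
      unfolding eventually_sequentially by auto
  qed
  from limitin_metric_unique[OF decode_limit[OF dec] this] show ?thesis by simp
qed

text \<open>The law of the code is a probability on the reals; its quantile function maps Lebesgue
  measure on the open unit interval to it, and \<open>decode\<close> undoes the coding. The two
  endpoints form a null set and get a fixed value.\<close>

lemma ex_parameter: "\<exists>a. parameter X a"
proof -
  define \<mu> where "\<mu> = distr m borel code"
  interpret cdf_distribution \<mu>
    unfolding cdf_distribution_def \<mu>_def by (intro P.real_distribution_distr measurable_code)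
  let ?\<Omega> = "restrict_space lborel {0<..<1} :: real measure"
  obtain q :: "real \<Rightarrow> real" where q: "q \<in> borel_measurable (restrict_space borel {0<..<1})"
    "distr ?\<Omega> borel q = \<mu>"
    using measurable_CI distr_I_eq_M by blast
  have [measurable]: "q \<in> borel_measurable ?\<Omega>"
    using q(1) by (simp add: measurable_def space_restrict_space sets_restrict_space)
  define a where "a t = (if 0 < t \<and> t < 1 then decode (q t) else dense_seq 0)" for t
  have "parameter X a"
    unfolding parameter_iff[OF pm_space]
  proof (intro conjI ballI)
    show "a \<in> {0..1} \<rightarrow> M" by (auto simp: a_def)
    fix E assume [measurable]: "E \<in> P.events"
    have D: "decode -` E \<in> sets borel"
      using measurable_sets[OF measurable_decode \<open>E \<in> P.events\<close>] by simp
    define B where "B = q -` (decode -` E) \<inter> space ?\<Omega>"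
    have B: "B \<in> sets ?\<Omega>" unfolding B_def using D by (intro measurable_sets) auto
    then have B': "B \<in> sets borel" "B \<subseteq> {0<..<1}"
      by (subst (asm) sets_restrict_space_iff; auto)+
    define N where "N = (if dense_seq 0 \<in> E then {0, 1} else {} :: real set)"
    have N: "N \<in> null_sets lborel" by (auto simp: N_def intro!: finite_imp_null_set_lborel)
    have eq: "{t\<in>{0..1}. a t \<in> E} = B \<union> N"
      by (auto simp: a_def B_def N_def space_restrict_space)
    show "{t\<in>{0..1}. a t \<in> E} \<in> sets borel"
      unfolding eq using B' N by (auto simp: null_sets_def)
    have "emeasure lborel B = emeasure ?\<Omega> B"
      using B' by (simp add: emeasure_restrict_space)
    also have "\<dots> = emeasure (distr ?\<Omega> borel q) (decode -` E)"
      unfolding B_def using D by (simp add: emeasure_distr)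
    also have "\<dots> = emeasure m (code -` (decode -` E) \<inter> M)"
      unfolding q(2) \<mu>_def using D by (simp add: emeasure_distr)
    also have "code -` (decode -` E) \<inter> M = E"
      using sets.sets_into_space[OF \<open>E \<in> P.events\<close>] by auto
    finally show "emeasure lborel {t\<in>{0..1}. a t \<in> E} = emeasure m E"
      unfolding eq using B' N by (simp add: emeasure_Un_null_set)
  qed
  then show ?thesis by blast
qed

end

lemma box_le_1:
  assumes "pm_space X" "pm_space Y" shows "box_le X Y 1"
proof -
  obtain a b where "parameter X a" "parameter Y b"
    using pm_sp.ex_parameter[of X] pm_sp.ex_parameter[of Y] assms by (auto simp: pm_sp_def)
  then show ?thesis unfolding box_le_def by (intro exI[of _ a] exI[of _ b] exI[of _ "{}"]) auto
qed

lemma pm_box_nonneg: "pm_space X \<Longrightarrow> pm_space Y \<Longrightarrow> 0 \<le> pm_box X Y"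
  unfolding pm_box_eq using box_le_1 by (intro cInf_greatest) (auto intro!: exI[of _ 1])

lemma box_le_of_pm_box:
  assumes "pm_space X" "pm_space Y" "pm_box X Y < \<epsilon>"
  shows "\<exists>\<epsilon>'. 0 < \<epsilon>' \<and> \<epsilon>' < \<epsilon> \<and> box_le X Y \<epsilon>'"
proof -
  have "{\<epsilon>. \<epsilon> > 0 \<and> box_le X Y \<epsilon>} \<noteq> {}" using box_le_1[OF assms(1,2)] by (auto intro!: exI[of _ 1])
  from cInf_lessD[OF this, of \<epsilon>] show ?thesis using assms(3) by (auto simp: pm_box_eq)
qed

subsection \<open>Nonincreasing rearrangements\<close>

definition rearranges :: "(nat \<Rightarrow> real) \<Rightarrow> ('i \<Rightarrow> real) \<Rightarrow> (nat \<Rightarrow> 'i) \<Rightarrow> bool" where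
  "rearranges \<gamma> u \<sigma> \<longleftrightarrow> (\<forall>k. 0 \<le> \<gamma> k) \<and> (\<forall>k. \<gamma> (Suc k) \<le> \<gamma> k) \<and>
     bij_betw \<sigma> {k. \<gamma> k > 0} {i. u i > 0} \<and> (\<forall>k. \<gamma> k > 0 \<longrightarrow> u (\<sigma> k) = \<gamma> k)"

lemma rearrangesD:
  assumes "rearranges \<gamma> u \<sigma>"
  shows "0 \<le> \<gamma> k" "\<gamma> (Suc k) \<le> \<gamma> k" "j \<le> k \<Longrightarrow> \<gamma> k \<le> \<gamma> j"
    "bij_betw \<sigma> {k. \<gamma> k > 0} {i. u i > 0}" "\<gamma> k > 0 \<Longrightarrow> u (\<sigma> k) = \<gamma> k"
  using assms unfolding rearranges_def by (auto intro: lift_Suc_antimono_le)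

text \<open>Pigeonhole: if the bound failed at k, each of the first k + 1 indices listed by \<sigma>
  would have a u'-value above \<open>\<gamma>' k\<close> and so be among the first k listed by
  \<sigma>'. With \<delta> = 0 this is uniqueness of the rearrangement; with \<delta> > 0 it gives
  continuity of the product of weights.\<close>

lemma rearranges_close:
  assumes \<gamma>: "rearranges \<gamma> u \<sigma>" and \<gamma>': "rearranges \<gamma>' u' \<sigma>'" and \<delta>: "0 \<le> \<delta>"
    and le: "\<And>i. u i \<le> u' i + \<delta>"
  shows "\<gamma> k \<le> \<gamma>' k + \<delta>"
proof (rule ccontr)
  assume "\<not> ?thesis"
  then have gt: "\<gamma> k > \<gamma>' k + \<delta>" by simp
  have pos: "\<gamma> j > \<gamma>' k + \<delta>" "\<gamma> j > 0" if "j \<le> k" for j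
    using rearrangesD(3)[OF \<gamma> that] gt \<delta> rearrangesD(1)[OF \<gamma>', of k] by linarith+
  have sub: "\<sigma> ` {..k} \<subseteq> \<sigma>' ` {..<k}"
  proof
    fix i assume "i \<in> \<sigma> ` {..k}"
    then obtain j where j: "j \<le> k" "i = \<sigma> j" by auto
    have "u i = \<gamma> j" using rearrangesD(5)[OF \<gamma> pos(2)[OF j(1)]] j by simp
    then have u': "u' i > \<gamma>' k" using le[of i] pos(1)[OF j(1)] by linarith
    then have "i \<in> {i. u' i > 0}" using rearrangesD(1)[OF \<gamma>', of k] by simp
    then have "i \<in> \<sigma>' ` {k. \<gamma>' k > 0}"
      unfolding bij_betw_imp_surj_on[OF rearrangesD(4)[OF \<gamma>']] .
    then obtain k' where k': "\<gamma>' k' > 0" "\<sigma>' k' = i" by blast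
    then have "\<gamma>' k' > \<gamma>' k" using u' rearrangesD(5)[OF \<gamma>' k'(1)] by simp
    then have "k' < k" using rearrangesD(3)[OF \<gamma>', of k k'] by (meson not_le)
    then show "i \<in> \<sigma>' ` {..<k}" using k' by blast
  qed
  have "inj_on \<sigma> {..k}"
    by (rule inj_on_subset[OF bij_betw_imp_inj_on[OF rearrangesD(4)[OF \<gamma>]]]) (use pos(2) in blast)
  then have "Suc k = card (\<sigma> ` {..k})" by (simp add: card_image)
  also have "\<dots> \<le> card (\<sigma>' ` {..<k})" using sub by (intro card_mono) auto
  also have "\<dots> \<le> k" using card_image_le[of "{..<k}" \<sigma>'] by simp
  finally show False by simp
qed

lemma rearranges_unique:
  assumes "rearranges \<gamma> u \<sigma>" "rearranges \<gamma>' u \<sigma>'"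
  shows "\<gamma> = \<gamma>'"
proof
  fix k
  show "\<gamma> k = \<gamma>' k"
    using rearranges_close[OF assms, of 0 k] rearranges_close[OF assms(2,1), of 0 k] by simp
qed

lemma nonincreasing_rearrangement_eq:
  assumes "rearranges \<gamma> u \<sigma>" shows "nonincreasing_rearrangement u = \<gamma>"
proof -
  have "nonincreasing_rearrangement u = (THE \<gamma>. \<exists>\<sigma>. rearranges \<gamma> u \<sigma>)"
    by (simp add: nonincreasing_rearrangement_def rearranges_def)
  also have "\<dots> = \<gamma>"
    by (rule the_equality) (use assms rearranges_unique in blast)+
  finally show ?thesis .
qed

text \<open>The index with exactly \<open>k\<close> predecessors in the order by decreasing value, ties broken by a
  fixed enumeration, is put in position \<open>k\<close>.\<close>

lemma ex_rearrangement:
  fixes u :: "'i :: countable \<Rightarrow> real"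
  assumes fin: "\<And>t. t > 0 \<Longrightarrow> finite {i. u i \<ge> t}"
  shows "\<exists>\<gamma> \<sigma>. rearranges \<gamma> u \<sigma>"
proof -
  define before where "before j i \<longleftrightarrow> u j > u i \<or> (u j = u i \<and> to_nat j < to_nat i)" for i j
  define S where "S = {i. u i > 0}"
  define pr where "pr i = {j. before j i}" for i
  define rank where "rank i = card (pr i)" for i
  have fpr: "finite (pr i)" if "i \<in> S" for i
    by (rule finite_subset[OF _ fin[of "u i"]]) (use that in \<open>auto simp: pr_def before_def S_def\<close>)
  have less: "rank j < rank i" if "i \<in> S" "before j i" for i j
  proof -
    have "pr j \<subset> pr i"
      using that(2) unfolding pr_def before_def by fastforce
    then show ?thesis unfolding rank_def by (rule psubset_card_mono[OF fpr[OF that(1)]])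
  qed
  have inj: "inj_on rank S"
  proof (rule inj_onI)
    fix i j assume ij: "i \<in> S" "j \<in> S" "rank i = rank j"
    have "before i j \<or> before j i \<or> i = j"
      unfolding before_def by (metis less_linear to_nat_split inj_to_nat injD)
    then show "i = j" using ij less by fastforce
  qed
  have img: "rank ` pr i = {..<rank i}" if i: "i \<in> S" for i
  proof (rule card_subset_eq)
    show "rank ` pr i \<subseteq> {..<rank i}" using less[OF i] by (auto simp: pr_def)
    have "pr i \<subseteq> S" using i by (auto simp: pr_def before_def S_def)
    then have "inj_on rank (pr i)" using inj inj_on_subset by blast
    then have "card (rank ` pr i) = card (pr i)" by (rule card_image)
    also have "\<dots> = rank i" by (simp add: rank_def)
    finally show "card (rank ` pr i) = card {..<rank i}" by simp
  qed simp
  define \<sigma> where "\<sigma> = inv_into S rank"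
  define \<gamma> where "\<gamma> k = (if k \<in> rank ` S then u (\<sigma> k) else 0)" for k
  have \<sigma>S: "\<sigma> k \<in> S" if "k \<in> rank ` S" for k using that by (auto simp: \<sigma>_def intro: inv_into_into)
  have \<sigma>r: "\<sigma> (rank i) = i" if "i \<in> S" for i using inj that by (simp add: \<sigma>_def)
  have pos: "{k. \<gamma> k > 0} = rank ` S" using \<sigma>S by (auto simp: \<gamma>_def S_def)
  have "rearranges \<gamma> u \<sigma>"
    unfolding rearranges_def pos
  proof (intro conjI allI impI)
    fix k
    show "0 \<le> \<gamma> k" using \<sigma>S[of k] by (auto simp: \<gamma>_def S_def)
    show "\<gamma> (Suc k) \<le> \<gamma> k"
    proof (cases "Suc k \<in> rank ` S")
      case True
      then obtain i where i: "i \<in> S" "rank i = Suc k" by auto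
      then have "k \<in> rank ` pr i" using img by auto
      then obtain j where j: "before j i" "rank j = k" by (auto simp: pr_def)
      then have "j \<in> S" using i by (auto simp: before_def S_def)
      then have "\<gamma> k = u j" "\<gamma> (Suc k) = u i" using i j \<sigma>r unfolding \<gamma>_def by (metis imageI)+
      then show ?thesis using j by (auto simp: before_def)
    next
      case False
      then show ?thesis using \<sigma>S[of k] by (auto simp: \<gamma>_def S_def)
    qed
    show "bij_betw \<sigma> (rank ` S) {i. u i > 0}"
      unfolding \<sigma>_def S_def[symmetric] by (rule bij_betw_inv_into) (simp add: bij_betw_def inj)
  next
    fix k assume "\<gamma> k > 0"
    then show "u (\<sigma> k) = \<gamma> k" by (auto simp: \<gamma>_def split: if_splits)
  qed
  then show ?thesis by blast
qed

lemma rearranges_transport: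
  assumes \<gamma>: "rearranges \<gamma> u \<sigma>" and \<tau>: "bij_betw \<tau> {i. u i > 0} {i. v i > 0}"
    and v: "\<And>i. u i > 0 \<Longrightarrow> v (\<tau> i) = u i"
  shows "rearranges \<gamma> v (\<tau> \<circ> \<sigma>)"
  unfolding rearranges_def
  using rearrangesD[OF \<gamma>] v bij_betw_trans[OF rearrangesD(4)[OF \<gamma>] \<tau>] by auto

lemma nn_integral_rearranges:
  fixes u :: "'i \<Rightarrow> real" and h :: "'i \<Rightarrow> ennreal"
  assumes \<gamma>: "rearranges \<gamma> u \<sigma>"
  shows "(\<Sum>k. ennreal (\<gamma> k) * h (\<sigma> k)) = (\<integral>\<^sup>+i. ennreal (u i) * h i \<partial>count_space UNIV)"
proof -
  have "(\<Sum>k. ennreal (\<gamma> k) * h (\<sigma> k)) = (\<integral>\<^sup>+k. ennreal (\<gamma> k) * h (\<sigma> k) \<partial>count_space UNIV)"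
    by (rule nn_integral_count_space_nat[symmetric])
  also have "\<dots> = (\<integral>\<^sup>+k. ennreal (\<gamma> k) * h (\<sigma> k) \<partial>count_space {k. \<gamma> k > 0})"
    by (rule nn_integral_count_space_eq) (auto simp: ennreal_eq_0_iff)
  also have "\<dots> = (\<integral>\<^sup>+k. ennreal (u (\<sigma> k)) * h (\<sigma> k) \<partial>count_space {k. \<gamma> k > 0})"
    by (rule nn_integral_cong) (simp add: rearrangesD(5)[OF \<gamma>])
  also have "\<dots> = (\<integral>\<^sup>+i. ennreal (u i) * h i \<partial>count_space {i. u i > 0})"
    by (rule nn_integral_bij_count_space[OF rearrangesD(4)[OF \<gamma>]])
  also have "\<dots> = (\<integral>\<^sup>+i. ennreal (u i) * h i \<partial>count_space UNIV)"
    by (rule nn_integral_count_space_eq) (auto simp: ennreal_eq_0_iff not_less)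
  finally show ?thesis .
qed

subsection \<open>The monoid of weights\<close>

lemma weightsD:
  assumes "\<alpha> \<in> weights"
  shows "0 \<le> \<alpha> i" "summable \<alpha>" "suminf \<alpha> \<le> 1" "\<alpha> (Suc i) \<le> \<alpha> i" "i \<le> j \<Longrightarrow> \<alpha> j \<le> \<alpha> i"
  using assms unfolding weights_def by (auto intro: lift_Suc_antimono_le)

lemma suminf_ennreal_weights:
  assumes "\<alpha> \<in> weights"
  shows "(\<Sum>i. ennreal (\<alpha> i)) = ennreal (suminf \<alpha>)" "(\<Sum>i. ennreal (\<alpha> i)) \<le> 1"
proof -
  show "(\<Sum>i. ennreal (\<alpha> i)) = ennreal (suminf \<alpha>)"
    by (rule suminf_ennreal2) (use weightsD[OF assms] in auto)
  then show "(\<Sum>i. ennreal (\<alpha> i)) \<le> 1" using weightsD(3)[OF assms] by simp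
qed

lemma weightsI:
  assumes "\<And>i. 0 \<le> \<alpha> i" "\<And>i. \<alpha> (Suc i) \<le> \<alpha> i" "(\<Sum>i. ennreal (\<alpha> i)) \<le> 1"
  shows "\<alpha> \<in> weights"
proof -
  have fin: "(\<Sum>i. ennreal (\<alpha> i)) \<noteq> Orderings.top" using assms(3) by (auto simp: top_unique)
  have s: "summable \<alpha>" using summable_suminf_not_top[of \<alpha>] assms(1) fin by simp
  have "ennreal (suminf \<alpha>) \<le> 1" using assms(3) suminf_ennreal2[OF assms(1) s] by simp
  then have "suminf \<alpha> \<le> 1" by simp
  then show ?thesis using s assms unfolding weights_def by auto
qed

text \<open>The first i + 1 terms are at least \<open>\<alpha> i\<close> and sum to at most 1. This
  tail bound, uniform in the weights, makes pointwise and uniform convergence agree and controls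
  interval lengths in the approximation argument.\<close>

lemma weights_le:
  assumes "\<alpha> \<in> weights" shows "\<alpha> i \<le> 1 / real (Suc i)"
proof -
  have "real (Suc i) * \<alpha> i = (\<Sum>j<Suc i. \<alpha> i)" by simp
  also have "\<dots> \<le> (\<Sum>j<Suc i. \<alpha> j)" by (intro sum_mono weightsD(5)[OF assms]) auto
  also have "\<dots> \<le> suminf \<alpha>" using weightsD[OF assms] by (intro sum_le_suminf) auto
  also have "\<dots> \<le> 1" by (rule weightsD(3)[OF assms])
  finally show ?thesis by (simp add: field_simps)
qed

lemma weights_le_1: "\<alpha> \<in> weights \<Longrightarrow> \<alpha> i \<le> 1"
  using weights_le[of \<alpha> i] by (rule order_trans) (simp_all add: field_simps)

lemma finite_weights_ge:
  assumes "\<alpha> \<in> weights" "t > 0" shows "finite {i. \<alpha> i \<ge> t}"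
proof -
  have "\<alpha> \<longlonglongrightarrow> 0" using weightsD(2)[OF assms(1)] by (rule summable_LIMSEQ_zero)
  then have "\<forall>\<^sub>F i in sequentially. \<alpha> i < t" using assms(2) by (rule order_tendstoD)
  then show ?thesis by (simp add: cofinite_eq_sequentially[symmetric] eventually_cofinite not_less)
qed

lemma ex_rearrangement_mult:
  assumes \<alpha>: "\<alpha> \<in> weights" and \<beta>: "\<beta> \<in> weights"
  shows "\<exists>\<sigma>. rearranges (weights_mult \<alpha> \<beta>) (\<lambda>(i, j). \<alpha> i * \<beta> j) \<sigma>"
proof -
  have "finite {p. (case p of (i, j) \<Rightarrow> \<alpha> i * \<beta> j) \<ge> t}" if t: "t > 0" for t
  proof (rule finite_subset)
    \<comment> \<open>All weights are at most 1, so a product that is at least t has both factors at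
      least t.\<close>
    show "{p. (case p of (i, j) \<Rightarrow> \<alpha> i * \<beta> j) \<ge> t} \<subseteq> {i. \<alpha> i \<ge> t} \<times> {j. \<beta> j \<ge> t}"
    proof safe
      fix i j assume *: "t \<le> \<alpha> i * \<beta> j"
      have "\<alpha> i * \<beta> j \<le> \<alpha> i" "\<alpha> i * \<beta> j \<le> \<beta> j"
        using weightsD(1)[OF \<alpha>, of i] weightsD(1)[OF \<beta>, of j] weights_le_1[OF \<alpha>, of i] weights_le_1[OF \<beta>, of j]
        by (auto simp: mult_left_le mult_left_le_one_le)
      then show "t \<le> \<alpha> i" "t \<le> \<beta> j" using * by linarith+
    qed
    show "finite ({i. \<alpha> i \<ge> t} \<times> {j. \<beta> j \<ge> t})"
      using finite_weights_ge[OF \<alpha> t] finite_weights_ge[OF \<beta> t] by simp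
  qed
  then obtain \<gamma> \<sigma> where "rearranges \<gamma> (\<lambda>(i, j). \<alpha> i * \<beta> j) \<sigma>" using ex_rearrangement by blast
  then show ?thesis using nonincreasing_rearrangement_eq unfolding weights_mult_def by blast
qed

text \<open>Tonelli on pairs of indices, in \<open>ennreal\<close> so that no summability has to be
  checked. The test function h makes it usable for total masses as well as for atoms lying in a
  set.\<close>

lemma suminf_weights_mult:
  fixes h :: "nat \<times> nat \<Rightarrow> ennreal"
  assumes \<alpha>: "\<alpha> \<in> weights" and \<beta>: "\<beta> \<in> weights"
    and \<sigma>: "rearranges \<gamma> (\<lambda>(i, j). \<alpha> i * \<beta> j) \<sigma>"
  shows "(\<Sum>k. ennreal (\<gamma> k) * h (\<sigma> k)) = (\<Sum>i. ennreal (\<alpha> i) * (\<Sum>j. ennreal (\<beta> j) * h (i, j)))"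
proof -
  have "(\<Sum>k. ennreal (\<gamma> k) * h (\<sigma> k)) =
     (\<integral>\<^sup>+p. ennreal (case p of (i, j) \<Rightarrow> \<alpha> i * \<beta> j) * h p \<partial>count_space UNIV)"
    by (rule nn_integral_rearranges[OF \<sigma>])
  also have "\<dots> = (\<integral>\<^sup>+i. \<integral>\<^sup>+j. ennreal (\<alpha> i * \<beta> j) * h (i, j) \<partial>count_space UNIV \<partial>count_space UNIV)"
    by (subst nn_integral_fst_count_space[symmetric]) simp
  also have "\<dots> = (\<Sum>i. \<Sum>j. ennreal (\<alpha> i) * (ennreal (\<beta> j) * h (i, j)))"
    by (simp add: nn_integral_count_space_nat ennreal_mult weightsD[OF \<alpha>] weightsD[OF \<beta>] mult.assoc)
  finally show ?thesis by simp
qed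

lemma weights_mult_in:
  assumes \<alpha>: "\<alpha> \<in> weights" and \<beta>: "\<beta> \<in> weights"
  shows "weights_mult \<alpha> \<beta> \<in> weights"
proof -
  obtain \<sigma> where \<sigma>: "rearranges (weights_mult \<alpha> \<beta>) (\<lambda>(i, j). \<alpha> i * \<beta> j) \<sigma>"
    using ex_rearrangement_mult[OF \<alpha> \<beta>] by blast
  have "(\<Sum>k. ennreal (weights_mult \<alpha> \<beta> k)) = (\<Sum>i. ennreal (\<alpha> i)) * (\<Sum>j. ennreal (\<beta> j))"
    using suminf_weights_mult[OF \<alpha> \<beta> \<sigma>, of "\<lambda>_. 1"] by simp
  also have "\<dots> \<le> 1 * 1" by (intro mult_mono suminf_ennreal_weights \<alpha> \<beta>) auto
  finally show ?thesis by (intro weightsI rearrangesD(1,2)[OF \<sigma>]) simp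
qed

lemma weights_one_in: "weights_one \<in> weights"
proof (rule weightsI)
  have "(\<Sum>i. ennreal (weights_one i)) = (\<Sum>i\<in>{0}. ennreal (weights_one i))"
    by (rule suminf_finite) (auto simp: weights_one_def)
  then show "(\<Sum>i. ennreal (weights_one i)) \<le> 1" by (simp add: weights_one_def)
qed (auto simp: weights_one_def)

lemma weights_mult_one_left:
  assumes "\<beta> \<in> weights" shows "weights_mult weights_one \<beta> = \<beta>"
proof -
  have "bij_betw (\<lambda>k. (0 :: nat, k)) {k. \<beta> k > 0} {p. (case p of (i, j) \<Rightarrow> weights_one i * \<beta> j) > 0}"
    by (auto simp: bij_betw_def inj_on_def weights_one_def split: if_splits)
  then have "rearranges \<beta> (\<lambda>(i, j). weights_one i * \<beta> j) (\<lambda>k. (0, k))"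
    using weightsD[OF assms] by (simp add: rearranges_def weights_one_def)
  then show ?thesis unfolding weights_mult_def by (rule nonincreasing_rearrangement_eq)
qed

lemma weights_mult_one_right:
  assumes "\<beta> \<in> weights" shows "weights_mult \<beta> weights_one = \<beta>"
proof -
  have "bij_betw (\<lambda>k. (k, 0 :: nat)) {k. \<beta> k > 0} {p. (case p of (i, j) \<Rightarrow> \<beta> i * weights_one j) > 0}"
    by (auto simp: bij_betw_def inj_on_def weights_one_def split: if_splits)
  then have "rearranges \<beta> (\<lambda>(i, j). \<beta> i * weights_one j) (\<lambda>k. (k, 0))"
    using weightsD[OF assms] by (simp add: rearranges_def weights_one_def)
  then show ?thesis unfolding weights_mult_def by (rule nonincreasing_rearrangement_eq)
qed

text \<open>Both bracketings are rearrangements of one family of triple products, and rearrangements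
  are unique.\<close>

lemma weights_mult_assoc:
  assumes \<alpha>: "\<alpha> \<in> weights" and \<beta>: "\<beta> \<in> weights" and \<gamma>: "\<gamma> \<in> weights"
  shows "weights_mult (weights_mult \<alpha> \<beta>) \<gamma> = weights_mult \<alpha> (weights_mult \<beta> \<gamma>)"
proof -
  define v where "v = (\<lambda>(i, j, l). \<alpha> i * (\<beta> j * \<gamma> l))"
  note nn = weightsD(1)[OF \<alpha>] weightsD(1)[OF \<beta>] weightsD(1)[OF \<gamma>]
    weightsD(1)[OF weights_mult_in[OF \<alpha> \<beta>]] weightsD(1)[OF weights_mult_in[OF \<beta> \<gamma>]]
  obtain \<sigma> where \<sigma>: "rearranges (weights_mult \<alpha> \<beta>) (\<lambda>(i, j). \<alpha> i * \<beta> j) \<sigma>"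
    using ex_rearrangement_mult[OF \<alpha> \<beta>] by blast
  obtain \<sigma>' where \<sigma>': "rearranges (weights_mult \<beta> \<gamma>) (\<lambda>(i, j). \<beta> i * \<gamma> j) \<sigma>'"
    using ex_rearrangement_mult[OF \<beta> \<gamma>] by blast
  obtain \<rho> where \<rho>: "rearranges (weights_mult (weights_mult \<alpha> \<beta>) \<gamma>) (\<lambda>(k, l). weights_mult \<alpha> \<beta> k * \<gamma> l) \<rho>"
    using ex_rearrangement_mult[OF weights_mult_in[OF \<alpha> \<beta>] \<gamma>] by blast
  obtain \<rho>' where \<rho>': "rearranges (weights_mult \<alpha> (weights_mult \<beta> \<gamma>)) (\<lambda>(i, k). \<alpha> i * weights_mult \<beta> \<gamma> k) \<rho>'"
    using ex_rearrangement_mult[OF \<alpha> weights_mult_in[OF \<beta> \<gamma>]] by blast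
  have pos: "x * y > 0 \<longleftrightarrow> x > 0 \<and> y > 0" if "0 \<le> x" "0 \<le> y" for x y :: real
    using that by (auto simp: zero_less_mult_iff)
  have b: "inj_on \<sigma> {k. weights_mult \<alpha> \<beta> k > 0}" "\<sigma> ` {k. weights_mult \<alpha> \<beta> k > 0} = {p. (case p of (i, j) \<Rightarrow> \<alpha> i * \<beta> j) > 0}"
    "inj_on \<sigma>' {k. weights_mult \<beta> \<gamma> k > 0}" "\<sigma>' ` {k. weights_mult \<beta> \<gamma> k > 0} = {p. (case p of (i, j) \<Rightarrow> \<beta> i * \<gamma> j) > 0}"
    using rearrangesD(4)[OF \<sigma>] rearrangesD(4)[OF \<sigma>'] by (simp_all add: bij_betw_def)
  define \<tau> where "\<tau> = (\<lambda>(k, l). (fst (\<sigma> k), snd (\<sigma> k), l :: nat))"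
  define \<tau>' where "\<tau>' = (\<lambda>(i :: nat, k). (i, \<sigma>' k))"
  have D: "{p. (case p of (k, l) \<Rightarrow> weights_mult \<alpha> \<beta> k * \<gamma> l) > 0} = {k. weights_mult \<alpha> \<beta> k > 0} \<times> {l. \<gamma> l > 0}"
    "{p. (case p of (i, k) \<Rightarrow> \<alpha> i * weights_mult \<beta> \<gamma> k) > 0} = {i. \<alpha> i > 0} \<times> {k. weights_mult \<beta> \<gamma> k > 0}"
    using nn by (auto simp: pos)
  have V: "{p. v p > 0} = {i. \<alpha> i > 0} \<times> ({j. \<beta> j > 0} \<times> {l. \<gamma> l > 0})"
    using nn by (auto simp: pos v_def)
  have b': "\<sigma> ` {k. weights_mult \<alpha> \<beta> k > 0} = {i. \<alpha> i > 0} \<times> {j. \<beta> j > 0}"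
    "\<sigma>' ` {k. weights_mult \<beta> \<gamma> k > 0} = {i. \<beta> i > 0} \<times> {j. \<gamma> j > 0}"
    unfolding b using nn by (auto simp: pos)
  have "bij_betw \<tau> ({k. weights_mult \<alpha> \<beta> k > 0} \<times> {l. \<gamma> l > 0}) {p. v p > 0}"
    unfolding bij_betw_def
  proof
    show "inj_on \<tau> ({k. weights_mult \<alpha> \<beta> k > 0} \<times> {l. \<gamma> l > 0})"
      by (rule inj_onI) (auto simp: \<tau>_def intro: inj_onD[OF b(1)] prod_eqI)
    have "\<tau> ` ({k. weights_mult \<alpha> \<beta> k > 0} \<times> {l. \<gamma> l > 0}) =
        (\<lambda>((i, j), l). (i, j, l)) ` (\<sigma> ` {k. weights_mult \<alpha> \<beta> k > 0} \<times> {l. \<gamma> l > 0})"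
      by (force simp: \<tau>_def split_beta)
    also have "\<dots> = {p. v p > 0}" unfolding b' V by force
    finally show "\<tau> ` ({k. weights_mult \<alpha> \<beta> k > 0} \<times> {l. \<gamma> l > 0}) = {p. v p > 0}" .
  qed
  moreover have "v (\<tau> p) = (case p of (k, l) \<Rightarrow> weights_mult \<alpha> \<beta> k * \<gamma> l)"
    if "p \<in> {k. weights_mult \<alpha> \<beta> k > 0} \<times> {l. \<gamma> l > 0}" for p
    using that rearrangesD(5)[OF \<sigma>, of "fst p"] by (cases p) (simp add: v_def \<tau>_def split_beta)
  ultimately have 1: "rearranges (weights_mult (weights_mult \<alpha> \<beta>) \<gamma>) v (\<tau> \<circ> \<rho>)"
    by (intro rearranges_transport[OF \<rho>]) (simp add: D, use D(1) in blast)
  have "bij_betw \<tau>' ({i. \<alpha> i > 0} \<times> {k. weights_mult \<beta> \<gamma> k > 0}) {p. v p > 0}"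
    unfolding bij_betw_def
  proof
    show "inj_on \<tau>' ({i. \<alpha> i > 0} \<times> {k. weights_mult \<beta> \<gamma> k > 0})"
      by (rule inj_onI) (auto simp: \<tau>'_def intro: inj_onD[OF b(3)])
    have "\<tau>' ` ({i. \<alpha> i > 0} \<times> {k. weights_mult \<beta> \<gamma> k > 0}) =
        {i. \<alpha> i > 0} \<times> \<sigma>' ` {k. weights_mult \<beta> \<gamma> k > 0}"
      by (force simp: \<tau>'_def)
    then show "\<tau>' ` ({i. \<alpha> i > 0} \<times> {k. weights_mult \<beta> \<gamma> k > 0}) = {p. v p > 0}"
      unfolding b' V .
  qed
  moreover have "v (\<tau>' p) = (case p of (i, k) \<Rightarrow> \<alpha> i * weights_mult \<beta> \<gamma> k)"
    if "p \<in> {i. \<alpha> i > 0} \<times> {k. weights_mult \<beta> \<gamma> k > 0}" for p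
    using that rearrangesD(5)[OF \<sigma>', of "snd p"] by (cases p) (simp add: v_def \<tau>'_def split_beta)
  ultimately have 2: "rearranges (weights_mult \<alpha> (weights_mult \<beta> \<gamma>)) v (\<tau>' \<circ> \<rho>')"
    by (intro rearranges_transport[OF \<rho>']) (simp add: D, use D(2) in blast)
  show ?thesis by (rule rearranges_unique[OF 1 2])
qed

text \<open>Weights lie in [0,1], so each product changes by at most \<delta> + \<epsilon>, and
  rearranging does not enlarge a uniform error.\<close>

lemma weights_mult_close:
  assumes w: "\<alpha> \<in> weights" "\<beta> \<in> weights" "\<alpha>' \<in> weights" "\<beta>' \<in> weights"
    and \<delta>: "\<And>i. \<bar>\<alpha> i - \<alpha>' i\<bar> \<le> \<delta>" and \<epsilon>: "\<And>i. \<bar>\<beta> i - \<beta>' i\<bar> \<le> \<epsilon>"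
  shows "\<bar>weights_mult \<alpha> \<beta> k - weights_mult \<alpha>' \<beta>' k\<bar> \<le> \<delta> + \<epsilon>"
proof -
  have le: "weights_mult a b k \<le> weights_mult a' b' k + (\<delta> + \<epsilon>)"
    if w: "a \<in> weights" "b \<in> weights" "a' \<in> weights" "b' \<in> weights"
      and \<delta>: "\<And>i. \<bar>a i - a' i\<bar> \<le> \<delta>" and \<epsilon>: "\<And>i. \<bar>b i - b' i\<bar> \<le> \<epsilon>" for a b a' b'
  proof -
    obtain \<sigma> \<sigma>' where "rearranges (weights_mult a b) (\<lambda>(i, j). a i * b j) \<sigma>"
      "rearranges (weights_mult a' b') (\<lambda>(i, j). a' i * b' j) \<sigma>'"
      using ex_rearrangement_mult w by blast
    moreover have nn: "0 \<le> \<delta> + \<epsilon>" using \<delta>[of 0] \<epsilon>[of 0] by linarith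
    moreover have "(case p of (i, j) \<Rightarrow> a i * b j) \<le> (case p of (i, j) \<Rightarrow> a' i * b' j) + (\<delta> + \<epsilon>)" for p
    proof -
      obtain i j where p: "p = (i, j)" by fastforce
      have "a i * b j - a' i * b' j = (a i - a' i) * b j + a' i * (b j - b' j)" by (simp add: algebra_simps)
      also have "\<dots> \<le> \<bar>a i - a' i\<bar> * \<bar>b j\<bar> + \<bar>a' i\<bar> * \<bar>b j - b' j\<bar>"
        by (metis abs_mult abs_ge_self add_mono)
      also have "\<dots> \<le> \<delta> * 1 + 1 * \<epsilon>"
        using \<delta>[of i] \<epsilon>[of j] weightsD(1)[OF w(2), of j] weights_le_1[OF w(2), of j]
           weightsD(1)[OF w(3), of i] weights_le_1[OF w(3), of i]
        by (intro add_mono mult_mono) auto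
      finally show ?thesis by (simp add: p)
    qed
    ultimately show ?thesis by (rule rearranges_close)
  qed
  show ?thesis
    using le[OF w \<delta> \<epsilon>] le[OF w(3,4,1,2), OF \<delta>[unfolded abs_minus_commute[of "\<alpha> _"]] \<epsilon>[unfolded abs_minus_commute[of "\<beta> _"]]] by linarith
qed

subsection \<open>Gluing maps along consecutive intervals\<close>

text \<open>The intervals are half-open, so a zero weight gives an empty interval and is never hit.
  The value is meaningful for t from 0 up to, but excluding, the total of c; beyond that it is
  unspecified.\<close>

definition piece :: "(nat \<Rightarrow> real) \<Rightarrow> real \<Rightarrow> nat" where
  "piece c t = (LEAST i. t < sum c {..<Suc i})"

lemma partial_sum_mono:
  fixes c :: "nat \<Rightarrow> real"
  assumes "\<And>i. 0 \<le> c i" "i \<le> j" shows "sum c {..<i} \<le> sum c {..<j}"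
  using assms by (intro sum_mono2) auto

lemma piece_eqI:
  fixes c :: "nat \<Rightarrow> real"
  assumes "\<And>i. 0 \<le> c i" "sum c {..<i} \<le> t" "t < sum c {..<Suc i}"
  shows "piece c t = i"
  unfolding piece_def
proof (rule Least_equality)
  fix j assume j: "t < sum c {..<Suc j}"
  show "i \<le> j"
  proof (rule ccontr)
    assume "\<not> i \<le> j"
    then have "sum c {..<Suc j} \<le> sum c {..<i}" using assms(1) by (intro partial_sum_mono) auto
    then show False using j assms(2) by linarith
  qed
qed fact

lemma piece_bounds:
  fixes c :: "nat \<Rightarrow> real"
  assumes "\<And>i. 0 \<le> c i" "summable c" "0 \<le> t" "t < suminf c"
  shows "sum c {..<piece c t} \<le> t" "t < sum c {..<Suc (piece c t)}"
proof -
  have "(\<lambda>n. sum c {..<n}) \<longlonglongrightarrow> suminf c" by (rule summable_LIMSEQ) fact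
  then have "\<forall>\<^sub>F n in sequentially. t < sum c {..<n}" using assms(4) by (rule order_tendstoD)
  then obtain n where "t < sum c {..<n}" unfolding eventually_sequentially by blast
  then have ex: "t < sum c {..<Suc n}" using assms(1)[of n] by simp
  show "t < sum c {..<Suc (piece c t)}" unfolding piece_def by (rule LeastI) fact
  show "sum c {..<piece c t} \<le> t"
  proof (cases "piece c t")
    case (Suc k)
    then have "\<not> t < sum c {..<Suc k}" unfolding piece_def by (intro not_less_Least) simp
    then show ?thesis using Suc by simp
  qed (use assms in simp)
qed

lemma measurable_piece [measurable]: "piece c \<in> measurable borel (count_space UNIV)"
  unfolding piece_def by measurable

text \<open>Each \<open>a i\<close> is run at speed 1 / \<open>c i\<close> over the i-th interval.
  When the lengths sum to 1, the default \<open>a 0 0\<close> concerns, within the unit interval,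
  only the point 1.\<close>

definition glue :: "(nat \<Rightarrow> real) \<Rightarrow> (nat \<Rightarrow> real \<Rightarrow> 'a) \<Rightarrow> real \<Rightarrow> 'a" where
  "glue c a t = (if 0 \<le> t \<and> t < 1
     then a (piece c t) ((t - sum c {..<piece c t}) / c (piece c t)) else a 0 0)"

lemma glue_eq:
  assumes "\<And>i. 0 \<le> c i" "c sums 1" "sum c {..<i} \<le> t" "t < sum c {..<Suc i}"
  shows "glue c a t = a i ((t - sum c {..<i}) / c i)"
proof -
  have "sum c {..<Suc i} \<le> 1"
    using assms(1,2) sum_le_suminf[of c "{..<Suc i}"] by (simp add: sums_iff)
  moreover have "0 \<le> sum c {..<i}" using assms(1) by (intro sum_nonneg)
  ultimately have "0 \<le> t" "t < 1" using assms(3,4) by linarith+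
  then show ?thesis using piece_eqI[of c i t, OF assms(1,3,4)] by (simp add: glue_def)
qed

lemma glue_unfold:
  assumes c: "\<And>i. 0 \<le> c i" "c sums 1" and t: "0 \<le> t" "t < 1"
  shows "\<exists>i u. c i > 0 \<and> sum c {..<i} \<le> t \<and> t < sum c {..<Suc i} \<and> u \<in> {0..1} \<and> glue c a t = a i u"
proof -
  define i where "i = piece c t"
  have b: "sum c {..<i} \<le> t" "t < sum c {..<Suc i}"
    unfolding i_def using piece_bounds[of c t, OF c(1)] c(2) t by (auto simp: sums_iff)
  then have "c i > 0" by simp
  then have "(t - sum c {..<i}) / c i \<in> {0..1}" using b by (simp add: field_simps)
  then show ?thesis using b \<open>c i > 0\<close> glue_eq[of c i t a, OF c b] by blast
qed

lemma glue_in: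
  assumes c: "\<And>i. 0 \<le> c i" "c sums 1" and a: "\<And>i. a i \<in> {0..1} \<rightarrow> M" and t: "t \<in> {0..1}"
  shows "glue c a t \<in> M"
proof (cases "t < 1")
  case True
  obtain i u where "u \<in> {0..1}" "glue c a t = a i u"
    using glue_unfold[of c t a, OF c] t True by auto
  then show ?thesis using a[of i] by auto
next
  case False
  then show ?thesis using a[of 0] by (auto simp: glue_def)
qed

lemma glue_emeasure:
  assumes c: "\<And>i. 0 \<le> c i" "c sums 1" and E: "\<And>i. {u\<in>{0..1}. a i u \<in> E} \<in> sets borel"
  shows "{t\<in>{0..1}. glue c a t \<in> E} \<in> sets borel"
    and "emeasure lborel {t\<in>{0..1}. glue c a t \<in> E} =
      (\<Sum>i. ennreal (c i) * emeasure lborel {u\<in>{0..1}. a i u \<in> E})"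
proof -
  define s where "s i = sum c {..<i}" for i
  define A where "A i = {u\<in>{0..1}. a i u \<in> E}" for i
  define B where "B i = {t. s i \<le> t \<and> t < s (Suc i) \<and> a i ((t - s i) / c i) \<in> E}" for i
  have A [measurable]: "A i \<in> sets borel" for i unfolding A_def by (rule E)
  have Bset: "B i \<in> sets borel" and Bem: "emeasure lborel (B i) = ennreal (c i) * emeasure lborel (A i)" for i
  proof -
    show "B i \<in> sets borel" "emeasure lborel (B i) = ennreal (c i) * emeasure lborel (A i)"
    proof (atomize(full), cases "c i > 0")
      case True
      \<comment> \<open>The rescaled interval is half-open, so the right endpoint 1 of the unit
        interval is dropped; it is a null set.\<close>
      have eq: "B i = (\<lambda>t. (t - s i) / c i) -` (A i - {1}) \<inter> space borel"
      proof (rule Set.set_eqI)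
        fix t
        have 1: "0 \<le> (t - s i) / c i \<longleftrightarrow> s i \<le> t" using True by (simp add: field_simps)
        have 2: "(t - s i) / c i < 1 \<longleftrightarrow> t < s (Suc i)" using True by (simp add: s_def field_simps)
        have "t \<in> B i \<longleftrightarrow> 0 \<le> (t - s i) / c i \<and> (t - s i) / c i < 1 \<and> a i ((t - s i) / c i) \<in> E"
          unfolding 1 2 B_def mem_Collect_eq ..
        also have "\<dots> \<longleftrightarrow> (t - s i) / c i \<in> A i - {1}"
          unfolding A_def by (simp only: Diff_iff mem_Collect_eq atLeastAtMost_iff singleton_iff) linarith
        finally show "t \<in> B i \<longleftrightarrow> t \<in> (\<lambda>t. (t - s i) / c i) -` (A i - {1}) \<inter> space borel" by simp
      qed
      have B [measurable]: "B i \<in> sets borel" unfolding eq by (rule measurable_sets[of _ borel borel]) auto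
      have "emeasure lborel (B i) = (\<integral>\<^sup>+t. indicator (B i) t \<partial>lborel)" by simp
      also have "\<dots> = ennreal \<bar>c i\<bar> * (\<integral>\<^sup>+u. indicator (B i) (s i + c i * u) \<partial>lborel)"
        using True by (intro nn_integral_real_affine) auto
      also have "(\<integral>\<^sup>+u. indicator (B i) (s i + c i * u) \<partial>lborel) = (\<integral>\<^sup>+u. indicator (A i - {1}) u \<partial>lborel)"
        using True by (intro nn_integral_cong) (simp add: eq indicator_def)
      also have "\<dots> = emeasure lborel (A i - {1})" by simp
      also have "\<dots> = emeasure lborel (A i)"
        by (rule emeasure_Diff_null_set) auto
      finally show "B i \<in> sets borel \<and> emeasure lborel (B i) = ennreal (c i) * emeasure lborel (A i)"
        using B True by simp
    next
      case False
      then have "c i = 0" using c(1)[of i] by simp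
      moreover from this have "B i = {}" by (auto simp: B_def s_def)
      ultimately show "B i \<in> sets borel \<and> emeasure lborel (B i) = ennreal (c i) * emeasure lborel (A i)" by simp
    qed
  qed
  have disj: "disjoint_family B"
    unfolding disjoint_family_on_def
  proof (intro ballI impI)
    fix i j :: nat assume "i \<noteq> j"
    have "piece c t = k" if "t \<in> B k" for t k
      using that piece_eqI[of c k t, OF c(1)] by (simp add: B_def s_def)
    then show "B i \<inter> B j = {}" using \<open>i \<noteq> j\<close> by blast
  qed
  define N where "N = (if a 0 0 \<in> E then {1} else {} :: real set)"
  have N: "N \<in> null_sets lborel" by (auto simp: N_def)
  have eq: "{t\<in>{0..1}. glue c a t \<in> E} = (\<Union>i. B i) \<union> N"
  proof (intro equalityI subsetI)
    fix t assume t: "t \<in> {t\<in>{0..1}. glue c a t \<in> E}"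
    show "t \<in> (\<Union>i. B i) \<union> N"
    proof (cases "t < 1")
      case True
      define i where "i = piece c t"
      have b: "s i \<le> t" "t < s (Suc i)"
        unfolding i_def s_def using piece_bounds[of c t, OF c(1)] c(2) t True by (auto simp: sums_iff)
      then have "t \<in> B i" using t glue_eq[of c i t a, OF c] by (auto simp: B_def s_def)
      then show ?thesis by blast
    qed (use t in \<open>auto simp: N_def glue_def\<close>)
  next
    fix t assume "t \<in> (\<Union>i. B i) \<union> N"
    then consider i where "t \<in> B i" | "t \<in> N" by blast
    then show "t \<in> {t\<in>{0..1}. glue c a t \<in> E}"
    proof cases
      case 1
      have "s (Suc i) \<le> 1"
        unfolding s_def using c sum_le_suminf[of c "{..<Suc i}"] by (simp add: sums_iff)
      moreover have "0 \<le> s i" unfolding s_def using c(1) by (intro sum_nonneg)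
      ultimately show ?thesis using 1 glue_eq[of c i t a, OF c] by (auto simp: B_def s_def)
    qed (auto simp: N_def glue_def split: if_splits)
  qed
  have U: "(\<Union>i. B i) \<in> sets borel" using Bset by auto
  show "{t\<in>{0..1}. glue c a t \<in> E} \<in> sets borel"
    unfolding eq using U N by (auto simp: null_sets_def)
  have "emeasure lborel {t\<in>{0..1}. glue c a t \<in> E} = emeasure lborel (\<Union>i. B i)"
    unfolding eq using U N by (simp add: emeasure_Un_null_set)
  also have "\<dots> = (\<Sum>i. emeasure lborel (B i))"
    using Bset disj by (intro suminf_emeasure[symmetric]) auto
  finally show "emeasure lborel {t\<in>{0..1}. glue c a t \<in> E} =
      (\<Sum>i. ennreal (c i) * emeasure lborel {u\<in>{0..1}. a i u \<in> E})"
    by (simp add: Bem A_def)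
qed

subsection \<open>Spaces with prescribed atoms\<close>

definition has_atoms :: "(nat \<Rightarrow> real) \<Rightarrow> 'a pm \<Rightarrow> bool" where
  "has_atoms \<alpha> X \<longleftrightarrow> (\<exists>f. (\<forall>i. f i \<in> mspace (pm_metric X)) \<and>
     (\<forall>E\<in>sets (pm_measure X).
        (\<Sum>i. ennreal (\<alpha> i) * indicator E (f i)) \<le> emeasure (pm_measure X) E))"

lemma atom_pyramid_iff: "A \<in> atom_pyramid \<alpha> \<longleftrightarrow> A \<in> pm_classes \<and> has_atoms \<alpha> (pm_rep A)"
  by (simp add: atom_pyramid_def has_atoms_def)

lemma atoms_le_finite:
  fixes \<alpha> :: "nat \<Rightarrow> real"
  assumes "finite F" "\<And>i. 0 \<le> \<alpha> i" "\<And>i. i \<in> F \<Longrightarrow> f i \<in> E"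
  shows "ennreal (sum \<alpha> F) \<le> (\<Sum>i. ennreal (\<alpha> i) * indicator E (f i))"
proof -
  have "ennreal (sum \<alpha> F) = (\<Sum>i\<in>F. ennreal (\<alpha> i) * indicator E (f i))"
    using assms by (simp add: sum_ennreal)
  also have "\<dots> \<le> (\<Sum>i. ennreal (\<alpha> i) * indicator E (f i))"
    using assms(1) by (intro sum_le_suminf) auto
  finally show ?thesis .
qed

text \<open>Atoms of positive weight cannot lie in the null complement of \<open>D\<close>, so their
  images are defined; those of zero weight are placed at an arbitrary y. Taking \<open>D\<close> to
  be the support covers isometries, the whole space covers Lipschitz maps.\<close>

lemma has_atoms_push:
  assumes X: "pm_space X" and Y: "pm_space Y" and atoms: "has_atoms \<alpha> X" and nn: "\<And>i. 0 \<le> \<alpha> i"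
    and D: "D \<in> sets (pm_measure X)" "emeasure (pm_measure X) (mspace (pm_metric X) - D) = 0"
    and g: "g \<in> D \<rightarrow> mspace (pm_metric Y)"
    and pre: "\<And>B. B \<in> sets (pm_measure Y) \<Longrightarrow> D \<inter> g -` B \<in> sets (pm_measure X)"
    and push: "\<And>B. B \<in> sets (pm_measure Y) \<Longrightarrow>
      emeasure (pm_measure X) (D \<inter> g -` B) \<le> emeasure (pm_measure Y) B"
  shows "has_atoms \<alpha> Y"
proof -
  interpret X: pm_sp X by standard fact
  interpret Y: pm_sp Y by standard fact
  obtain f where f: "\<And>i. f i \<in> X.M"
    and le: "\<And>E. E \<in> X.P.events \<Longrightarrow> (\<Sum>i. ennreal (\<alpha> i) * indicator E (f i)) \<le> emeasure X.m E"
    using atoms unfolding has_atoms_def by blast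
  obtain y where y: "y \<in> Y.M" using Y.nonempty by blast
  have inD: "f i \<in> D" if "\<alpha> i > 0" for i
  proof (rule ccontr)
    assume "f i \<notin> D"
    have "ennreal (sum \<alpha> {i}) \<le> (\<Sum>j. ennreal (\<alpha> j) * indicator (X.M - D) (f j))"
      using \<open>f i \<notin> D\<close> f nn by (intro atoms_le_finite) auto
    also have "\<dots> \<le> emeasure X.m (X.M - D)"
      using D(1) by (intro le) (metis X.space_m sets.compl_sets)
    finally show False using D(2) that by simp
  qed
  define f' where "f' i = (if f i \<in> D then g (f i) else y)" for i
  have "(\<Sum>i. ennreal (\<alpha> i) * indicator B (f' i)) \<le> emeasure Y.m B" if B: "B \<in> Y.P.events" for B
  proof -
    have "ennreal (\<alpha> i) * indicator B (f' i) = ennreal (\<alpha> i) * indicator (D \<inter> g -` B) (f i)" for i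
    proof (cases "\<alpha> i > 0")
      case True
      then show ?thesis using inD[OF True] by (simp add: f'_def indicator_def)
    next
      case False
      then show ?thesis using nn[of i] by simp
    qed
    then have "(\<Sum>i. ennreal (\<alpha> i) * indicator B (f' i)) = (\<Sum>i. ennreal (\<alpha> i) * indicator (D \<inter> g -` B) (f i))"
      by simp
    also have "\<dots> \<le> emeasure X.m (D \<inter> g -` B)" by (rule le[OF pre[OF B]])
    also have "\<dots> \<le> emeasure Y.m B" by (rule push[OF B])
    finally show ?thesis .
  qed
  moreover have "f' i \<in> Y.M" for i using g y by (auto simp: f'_def)
  ultimately show ?thesis unfolding has_atoms_def by (intro exI[of _ f']) blast
qed

lemma has_atoms_isometry:
  assumes X: "pm_space X" and Y: "pm_space Y" and f: "pm_isometry X Y f"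
    and atoms: "has_atoms \<alpha> X" and nn: "\<And>i. 0 \<le> \<alpha> i"
  shows "has_atoms \<alpha> Y"
proof -
  interpret X: pm_sp X by standard fact
  interpret Y: pm_sp Y by standard fact
  show ?thesis
  proof (rule has_atoms_push[OF X Y atoms nn X.supp_sets X.null_compl_supp])
    show "f \<in> X.S \<rightarrow> Y.M" using pm_isometryD(1)[OF f] Y.supp_subset by blast
  qed (simp_all add: pm_isometryD[OF f])
qed

section \<open>Lipschitz domination and its invariance\<close>

lemma pm_lipschitz_le_iff:
  assumes X: "pm_space X" and Y: "pm_space Y"
  shows "pm_lipschitz_le Y X \<longleftrightarrow> (\<exists>\<phi>. \<phi> \<in> mspace (pm_metric X) \<rightarrow> mspace (pm_metric Y) \<and>
     (\<forall>x\<in>mspace (pm_metric X). \<forall>x'\<in>mspace (pm_metric X).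
        mdist (pm_metric Y) (\<phi> x) (\<phi> x') \<le> mdist (pm_metric X) x x') \<and>
     (\<forall>B\<in>sets (pm_measure Y). mspace (pm_metric X) \<inter> \<phi> -` B \<in> sets (pm_measure X) \<and>
       emeasure (pm_measure X) (mspace (pm_metric X) \<inter> \<phi> -` B) = emeasure (pm_measure Y) B))"
proof -
  interpret X: pm_sp X by standard fact
  interpret Y: pm_sp Y by standard fact
  have "distr X.m Y.m \<phi> = Y.m \<longleftrightarrow> (\<forall>B\<in>Y.P.events. X.M \<inter> \<phi> -` B \<in> X.P.events \<and>
       emeasure X.m (X.M \<inter> \<phi> -` B) = emeasure Y.m B)"
    if \<phi>: "\<phi> \<in> X.M \<rightarrow> Y.M" "\<forall>x\<in>X.M. \<forall>x'\<in>X.M. Y.d (\<phi> x) (\<phi> x') \<le> X.d x x'" for \<phi>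
  proof -
    have "\<phi> \<in> measurable (restrict_space X.m X.M) Y.m"
      using \<phi> by (intro lipschitz_measurable X Y) auto
    moreover have "sets (restrict_space X.m X.M) = sets X.m"
    proof (rule Set.set_eqI)
      fix A
      show "A \<in> sets (restrict_space X.m X.M) \<longleftrightarrow> A \<in> sets X.m"
        using sets.sets_into_space[of A X.m] by (subst sets_restrict_space_iff) (auto simp: X.open_sets)
    qed
    moreover have "space (restrict_space X.m X.M) = X.M" by (simp add: space_restrict_space)
    ultimately have m: "\<phi> \<in> measurable X.m Y.m" by (simp add: measurable_def)
    have em: "emeasure (distr X.m Y.m \<phi>) B = emeasure X.m (X.M \<inter> \<phi> -` B)" if "B \<in> Y.P.events" for B
      using that m by (simp add: emeasure_distr Int_commute)
    have "X.M \<inter> \<phi> -` B \<in> X.P.events" if "B \<in> Y.P.events" for B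
      using measurable_sets[OF m that] by (simp add: Int_commute)
    moreover have "distr X.m Y.m \<phi> = Y.m \<longleftrightarrow>
        (\<forall>B\<in>Y.P.events. emeasure (distr X.m Y.m \<phi>) B = emeasure Y.m B)"
      by (auto intro: measure_eqI)
    ultimately show ?thesis using em by simp
  qed
  then show ?thesis unfolding pm_lipschitz_le_def by blast
qed

lemma has_atoms_lipschitz:
  assumes X: "pm_space X" and Y: "pm_space Y" and le: "pm_lipschitz_le Y X"
    and atoms: "has_atoms \<alpha> X" and nn: "\<And>i. 0 \<le> \<alpha> i"
  shows "has_atoms \<alpha> Y"
proof -
  interpret X: pm_sp X by standard fact
  obtain \<phi> where \<phi>: "\<phi> \<in> X.M \<rightarrow> mspace (pm_metric Y)"
    "\<And>B. B \<in> sets (pm_measure Y) \<Longrightarrow> X.M \<inter> \<phi> -` B \<in> X.P.events"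
    "\<And>B. B \<in> sets (pm_measure Y) \<Longrightarrow> emeasure X.m (X.M \<inter> \<phi> -` B) = emeasure (pm_measure Y) B"
    using le unfolding pm_lipschitz_le_iff[OF X Y] by blast
  show ?thesis
    by (rule has_atoms_push[OF X Y atoms nn _ _ \<phi>(1)]) (simp_all add: X.open_sets \<phi>)
qed

text \<open>Since \<open>pm_lipschitz_le\<close> refers to whole carriers, it is invariant under isomorphism only
  between spaces of full support.\<close>

lemma pm_lipschitz_le_isometry:
  assumes X: "pm_space X" and Y: "pm_space Y" and X': "pm_space X'" and Y': "pm_space Y'"
    and full: "full_support X'"
    and le: "pm_lipschitz_le Y X" and f: "pm_isometry X' X f" and g: "pm_isometry Y Y' g"
  shows "pm_lipschitz_le Y' X'"
proof -
  interpret X: pm_sp X by standard fact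
  interpret Y: pm_sp Y by standard fact
  interpret X': pm_sp X' by standard fact
  interpret Y': pm_sp Y' by standard fact
  have S': "X'.S = X'.M" using full by (simp add: full_support_def)
  obtain \<phi> where \<phi>: "\<phi> \<in> X.M \<rightarrow> Y.M" "\<And>x x'. x \<in> X.M \<Longrightarrow> x' \<in> X.M \<Longrightarrow> Y.d (\<phi> x) (\<phi> x') \<le> X.d x x'"
    "\<And>B. B \<in> Y.P.events \<Longrightarrow> X.M \<inter> \<phi> -` B \<in> X.P.events"
    "\<And>B. B \<in> Y.P.events \<Longrightarrow> emeasure X.m (X.M \<inter> \<phi> -` B) = emeasure Y.m B"
    using le unfolding pm_lipschitz_le_iff[OF X Y] by blast
  \<comment> \<open>A 1-Lipschitz map that pushes the measure forward respects supports: every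
    neighbourhood of \<phi> x contains the image of a ball around x, which has positive mass. Hence
    g may be applied after \<phi>.\<close>
  have \<phi>S: "\<phi> x \<in> Y.S" if x: "x \<in> X.S" for x
  proof -
    have xM: "x \<in> X.M" "\<phi> x \<in> Y.M" using x X.supp_subset \<phi>(1) by auto
    have "emeasure Y.m U > 0" if U: "openin Y.mtopology U" "\<phi> x \<in> U" for U
    proof -
      obtain r where r: "r > 0" "Y.mball (\<phi> x) r \<subseteq> U" using U unfolding Y.openin_mtopology by blast
      have "X.mball x r \<subseteq> X.M \<inter> \<phi> -` U"
      proof
        fix v assume v: "v \<in> X.mball x r"
        then have "\<phi> v \<in> Y.mball (\<phi> x) r" using \<phi>(1) \<phi>(2)[of x v] by force
        then show "v \<in> X.M \<inter> \<phi> -` U" using v r by auto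
      qed
      then have "emeasure X.m (X.mball x r) \<le> emeasure Y.m U"
        using \<phi>(3,4) U(1) by (metis Y.open_sets emeasure_mono)
      moreover have "emeasure X.m (X.mball x r) > 0"
        using x r(1) xM by (auto simp: pm_supp_def)
      ultimately show ?thesis by (rule less_le_trans[rotated])
    qed
    then show ?thesis using xM by (simp add: pm_supp_def)
  qed
  have fS: "f x \<in> X.S" "f x \<in> X.M" if "x \<in> X'.M" for x
    using pm_isometryD(1)[OF f] that S' X.supp_subset by blast+
  have gS: "g y \<in> Y'.M" if "y \<in> Y.S" for y
    using pm_isometryD(1)[OF g] that Y'.supp_subset by blast
  show ?thesis
    unfolding pm_lipschitz_le_iff[OF X' Y']
  proof (intro exI[of _ "g \<circ> \<phi> \<circ> f"] conjI ballI)
    show "g \<circ> \<phi> \<circ> f \<in> X'.M \<rightarrow> Y'.M" using fS \<phi>S gS by simp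
    show "Y'.d ((g \<circ> \<phi> \<circ> f) x) ((g \<circ> \<phi> \<circ> f) x') \<le> X'.d x x'" if "x \<in> X'.M" "x' \<in> X'.M" for x x'
      using \<phi>(2)[of "f x" "f x'"] fS[OF that(1)] fS[OF that(2)] pm_isometryD(2)[OF f, of x x']
        pm_isometryD(2)[OF g, of "\<phi> (f x)" "\<phi> (f x')"] \<phi>S that S' by simp
    fix B assume B: "B \<in> Y'.P.events"
    have 1: "Y.S \<inter> g -` B \<in> Y.P.events" by (rule pm_isometryD(3)[OF g B])
    have 2: "X.M \<inter> \<phi> -` (Y.S \<inter> g -` B) \<in> X.P.events" by (rule \<phi>(3)[OF 1])
    have eq: "X'.M \<inter> (g \<circ> \<phi> \<circ> f) -` B = X'.S \<inter> f -` (X.M \<inter> \<phi> -` (Y.S \<inter> g -` B))"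
      using fS \<phi>S S' by auto
    show "X'.M \<inter> (g \<circ> \<phi> \<circ> f) -` B \<in> X'.P.events"
      unfolding eq by (rule pm_isometryD(3)[OF f 2])
    show "emeasure X'.m (X'.M \<inter> (g \<circ> \<phi> \<circ> f) -` B) = emeasure Y'.m B"
      unfolding eq pm_isometryD(4)[OF f 2] \<phi>(4)[OF 1] by (rule pm_isometryD(4)[OF g B])
  qed
qed

subsection \<open>Isomorphism classes and their representatives\<close>

lemma pm_class_eqI:
  assumes X: "pm_space X" and Y: "pm_space Y" and XY: "pm_isometric X Y"
  shows "pm_class X = pm_class Y"
  unfolding pm_class_def
  using pm_isometric_trans[OF X Y _ XY] pm_isometric_trans[OF Y X _ pm_isometric_sym[OF X Y XY]] by blast

lemma pm_rep_props:
  assumes "A \<in> pm_classes"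
  shows "pm_space (pm_rep A)" "full_support (pm_rep A)" "pm_class (pm_rep A) = A"
proof -
  obtain X :: "real pm" where X: "pm_space X" "A = pm_class X" using assms by (auto simp: pm_classes_def)
  obtain Z :: "real pm" where Z: "pm_space Z" "full_support Z" "pm_isometry X Z id"
    using ex_full_support_transport[OF X(1), of id] by auto
  then have "Z \<in> A \<and> full_support Z" using X pm_isometric_iff[OF X(1) Z(1)] by (auto simp: pm_class_def)
  then have rep: "pm_rep A \<in> A \<and> full_support (pm_rep A)" unfolding pm_rep_def by (rule someI)
  then show *: "pm_space (pm_rep A)" "full_support (pm_rep A)" using X by (auto simp: pm_class_def)
  have "pm_isometric X (pm_rep A)" using rep X by (auto simp: pm_class_def)
  then show "pm_class (pm_rep A) = A" using pm_class_eqI[OF X(1) *(1)] X(2) by simp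
qed

text \<open>The injection serves to build a copy of \<open>X\<close> carried by reals, which puts
  the class among \<open>pm_classes\<close>.\<close>

lemma pm_class_props:
  fixes X :: "'a pm" and \<iota> :: "'a \<Rightarrow> real"
  assumes X: "pm_space X" and inj: "inj \<iota>"
  shows "pm_class X \<in> pm_classes" "\<exists>f. pm_isometry X (pm_rep (pm_class X)) f"
    "\<exists>f. pm_isometry (pm_rep (pm_class X)) X f"
proof -
  obtain Z :: "real pm" where Z: "pm_space Z" "pm_isometry X Z \<iota>"
    using ex_full_support_transport[OF X inj_on_subset[OF inj subset_UNIV]] by blast
  then have "pm_class X = pm_class Z"
    using pm_isometric_iff[OF X Z(1)] by (intro pm_class_eqI X) auto
  then show cl: "pm_class X \<in> pm_classes" using Z by (auto simp: pm_classes_def)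
  note R = pm_rep_props[OF cl]
  have "pm_rep (pm_class X) \<in> pm_class (pm_rep (pm_class X))"
    using pm_isometry_id[OF R(1)] R(1) pm_isometric_iff[OF R(1) R(1)] by (auto simp: pm_class_def)
  then have iso: "pm_isometric X (pm_rep (pm_class X))" unfolding R(3) by (simp add: pm_class_def)
  then show "\<exists>f. pm_isometry X (pm_rep (pm_class X)) f"
    using pm_isometric_iff[OF X R(1)] by blast
  then show "\<exists>f. pm_isometry (pm_rep (pm_class X)) X f"
    using pm_isometry_inv[OF X R(1)] by blast
qed

lemma pm_class_in_atom_pyramid:
  fixes X :: "'a pm" and \<iota> :: "'a \<Rightarrow> real"
  assumes X: "pm_space X" and inj: "inj \<iota>" and nn: "\<And>i. 0 \<le> \<alpha> i"
  shows "pm_class X \<in> atom_pyramid \<alpha> \<longleftrightarrow> has_atoms \<alpha> X"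
  using pm_class_props[OF X inj] pm_rep_props(1)[OF pm_class_props(1)[OF X inj]] has_atoms_isometry X nn
  unfolding atom_pyramid_iff by metis

lemma inj_real_pair: "\<exists>\<iota> :: real \<times> real \<Rightarrow> real. inj \<iota>"
proof -
  have "(card_of (UNIV \<times> UNIV :: (real \<times> real) set), card_of (UNIV :: real set)) \<in> ordIso"
    by (rule card_of_Times_same_infinite) (rule infinite_UNIV_char_0)
  then show ?thesis by (metis UNIV_Times_UNIV bij_betw_def card_of_ordIso)
qed

subsection \<open>Products\<close>

lemma lp_norm2_zero [simp]:
  assumes "1 \<le> p" "0 \<le> r" shows "lp_norm2 p r 0 = r" "lp_norm2 p 0 r = r"
  using assms by (cases p; simp add: lp_norm2_def powr_powr one_ereal_def)+

text \<open>Completeness, separability and the Borel sets of the product are derived from this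
  sandwich between maximum and sum, which treats all p alike.\<close>

lemma lp_norm2_bounds:
  assumes "1 \<le> p" "0 \<le> r" "0 \<le> s"
  shows "r \<le> lp_norm2 p r s" "s \<le> lp_norm2 p r s" "lp_norm2 p r s \<le> r + s"
  using lp_norm2_mono[OF assms(1), of r r 0 s] lp_norm2_mono[OF assms(1), of 0 r s s]
    lp_norm2_triangle[OF assms(1), of r 0 0 s] assms by simp_all

locale pm_pair = X: pm_sp X + Y: pm_sp Y for X :: "'a pm" and Y :: "'b pm" +
  fixes p :: ereal
  assumes p: "1 \<le> p"
begin

definition "D = lp_prod_dist p X.d Y.d"

sublocale prod: Metric_space "X.M \<times> Y.M" D
  unfolding D_def by (rule Metric_space_lp_prod[OF p]) simp_all

lemma D_bounds:
  "X.d (fst v) (fst w) \<le> D v w" "Y.d (snd v) (snd w) \<le> D v w"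
  "D v w \<le> X.d (fst v) (fst w) + Y.d (snd v) (snd w)"
  using lp_norm2_bounds[OF p] by (simp_all add: D_def lp_prod_dist_def split_beta)

lemma pm_prod_simps:
  "mspace (pm_metric (pm_prod p X Y)) = X.M \<times> Y.M" "mdist (pm_metric (pm_prod p X Y)) = D"
  "mtopology_of (pm_metric (pm_prod p X Y)) = prod.mtopology"
  "pm_measure (pm_prod p X Y) = X.m \<Otimes>\<^sub>M Y.m"
  unfolding mtopology_of_def pm_prod_metric[OF p] D_def by (simp_all add: pm_prod_def)

lemma mcomplete_prod: "prod.mcomplete"
  unfolding prod.mcomplete_def
proof (intro allI impI)
  fix \<sigma> assume \<sigma>: "prod.MCauchy \<sigma>"
  then have in_M: "\<sigma> n \<in> X.M \<times> Y.M" for n by (auto simp: prod.MCauchy_def)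
  have 1: "X.MCauchy (fst \<circ> \<sigma>)"
    unfolding X.MCauchy_def
  proof (intro conjI allI impI)
    show "range (fst \<circ> \<sigma>) \<subseteq> X.M" using in_M by (auto simp: mem_Times_iff)
    fix e :: real assume "e > 0"
    then obtain N where N: "\<forall>n n'. N \<le> n \<longrightarrow> N \<le> n' \<longrightarrow> D (\<sigma> n) (\<sigma> n') < e"
      using \<sigma> unfolding prod.MCauchy_def by blast
    show "\<exists>N. \<forall>n n'. N \<le> n \<longrightarrow> N \<le> n' \<longrightarrow> X.d ((fst \<circ> \<sigma>) n) ((fst \<circ> \<sigma>) n') < e"
      using le_less_trans[OF D_bounds(1)] N by (intro exI[of _ N]) simp
  qed
  have 2: "Y.MCauchy (snd \<circ> \<sigma>)"
    unfolding Y.MCauchy_def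
  proof (intro conjI allI impI)
    show "range (snd \<circ> \<sigma>) \<subseteq> Y.M" using in_M by (auto simp: mem_Times_iff)
    fix e :: real assume "e > 0"
    then obtain N where N: "\<forall>n n'. N \<le> n \<longrightarrow> N \<le> n' \<longrightarrow> D (\<sigma> n) (\<sigma> n') < e"
      using \<sigma> unfolding prod.MCauchy_def by blast
    show "\<exists>N. \<forall>n n'. N \<le> n \<longrightarrow> N \<le> n' \<longrightarrow> Y.d ((snd \<circ> \<sigma>) n) ((snd \<circ> \<sigma>) n') < e"
      using le_less_trans[OF D_bounds(2)] N by (intro exI[of _ N]) simp
  qed
  obtain x y where x: "limitin X.mtopology (fst \<circ> \<sigma>) x sequentially" and y: "limitin Y.mtopology (snd \<circ> \<sigma>) y sequentially"
    using 1 2 X.complete Y.complete unfolding X.mcomplete_def Y.mcomplete_def by blast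
  have "limitin prod.mtopology \<sigma> (x, y) sequentially"
    unfolding prod.limitin_metric
  proof (intro conjI allI impI)
    show "(x, y) \<in> X.M \<times> Y.M" using x y by (auto simp: X.limitin_metric Y.limitin_metric)
    fix e :: real assume e: "e > 0"
    have "\<forall>\<^sub>F n in sequentially. (fst \<circ> \<sigma>) n \<in> X.M \<and> X.d ((fst \<circ> \<sigma>) n) x < e / 2"
      using x half_gt_zero[OF e] unfolding X.limitin_metric by blast
    moreover have "\<forall>\<^sub>F n in sequentially. (snd \<circ> \<sigma>) n \<in> Y.M \<and> Y.d ((snd \<circ> \<sigma>) n) y < e / 2"
      using y half_gt_zero[OF e] unfolding Y.limitin_metric by blast
    ultimately show "\<forall>\<^sub>F n in sequentially. \<sigma> n \<in> X.M \<times> Y.M \<and> D (\<sigma> n) (x, y) < e"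
    proof eventually_elim
      case (elim n)
      then show ?case using D_bounds(3)[of "\<sigma> n" "(x, y)"] in_M[of n] by simp
    qed
  qed
  then show "\<exists>x. limitin prod.mtopology \<sigma> x sequentially" by blast
qed

lemma separable_prod: "separable_space prod.mtopology"
proof (rule prod.separable_spaceI)
  show "countable (range X.dense_seq \<times> range Y.dense_seq)" by auto
  show "range X.dense_seq \<times> range Y.dense_seq \<subseteq> X.M \<times> Y.M" by auto
  fix w and e :: real assume w: "w \<in> X.M \<times> Y.M" and e: "e > 0"
  obtain k where k: "X.d (fst w) (X.dense_seq k) < e / 2"
    using X.dense_seq_near[of "fst w" "e / 2"] w e by (auto simp: mem_Times_iff)
  obtain l where l: "Y.d (snd w) (Y.dense_seq l) < e / 2"
    using Y.dense_seq_near[of "snd w" "e / 2"] w e by (auto simp: mem_Times_iff)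
  have "D w (X.dense_seq k, Y.dense_seq l) < e"
    using D_bounds(3)[of w "(X.dense_seq k, Y.dense_seq l)"] k l by simp
  then show "\<exists>c\<in>range X.dense_seq \<times> range Y.dense_seq. D w c < e" by blast
qed

lemma openin_eq_Union_rectangles:
  assumes U: "openin prod.mtopology U"
  shows "U = (\<Union>(a, b)\<in>{(a, b). X.basic_ball a \<times> Y.basic_ball b \<subseteq> U}. X.basic_ball a \<times> Y.basic_ball b)"
proof (intro equalityI subsetI)
  fix w assume w: "w \<in> U"
  obtain x y where xy: "w = (x, y)" by fastforce
  have M: "x \<in> X.M" "y \<in> Y.M" using w xy openin_subset[OF U] by auto
  obtain r where r: "r > 0" "prod.mball w r \<subseteq> U" using U w unfolding prod.openin_mtopology by blast
  have xb: "x \<in> X.mball x (r / 2)" "y \<in> Y.mball y (r / 2)" using M r by auto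
  obtain a where a: "X.basic_ball a \<subseteq> X.mball x (r / 2)" "x \<in> X.basic_ball a"
    using X.open_eq_Union_basic_balls[OF X.openin_mball[of x "r / 2"]] xb(1) by blast
  obtain b where b: "Y.basic_ball b \<subseteq> Y.mball y (r / 2)" "y \<in> Y.basic_ball b"
    using Y.open_eq_Union_basic_balls[OF Y.openin_mball[of y "r / 2"]] xb(2) by blast
  have "X.mball x (r / 2) \<times> Y.mball y (r / 2) \<subseteq> prod.mball w r"
  proof
    fix v assume v: "v \<in> X.mball x (r / 2) \<times> Y.mball y (r / 2)"
    then show "v \<in> prod.mball w r" using D_bounds(3)[of w v] xy by (auto simp: mem_Times_iff)
  qed
  then have "X.basic_ball a \<times> Y.basic_ball b \<subseteq> U" using a(1) b(1) r(2) by blast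
  then show "w \<in> (\<Union>(a, b)\<in>{(a, b). X.basic_ball a \<times> Y.basic_ball b \<subseteq> U}. X.basic_ball a \<times> Y.basic_ball b)"
    using a(2) b(2) xy by blast
qed auto

text \<open>The projections are Borel for the product metric, which gives one inclusion. For the
  other, separability writes an open set as a countable union of rectangles of basic balls.\<close>

lemma sets_prod:
  "sets (X.m \<Otimes>\<^sub>M Y.m) = sigma_sets (X.M \<times> Y.M) {U. openin prod.mtopology U}"
proof
  have opens: "{U. openin prod.mtopology U} \<subseteq> Pow (X.M \<times> Y.M)"
    using openin_subset by fastforce
  define N where "N = sigma (X.M \<times> Y.M) {U. openin prod.mtopology U}"
  have N: "space N = X.M \<times> Y.M" "sets N = sigma_sets (X.M \<times> Y.M) {U. openin prod.mtopology U}"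
    using opens by (simp_all add: N_def space_measure_of sets_measure_of)
  have op: "U \<in> sets N" if "openin prod.mtopology U" for U using that by (auto simp: N)
  have f: "fst \<in> measurable N X.m"
  proof (rule X.measurable_ballI)
    fix k r
    have "openin prod.mtopology {w \<in> X.M \<times> Y.M. X.d (X.dense_seq k) (fst w) < r}"
      unfolding prod.openin_mtopology
    proof (intro conjI allI impI)
      fix w assume w: "w \<in> {w \<in> X.M \<times> Y.M. X.d (X.dense_seq k) (fst w) < r}"
      have "prod.mball w (r - X.d (X.dense_seq k) (fst w)) \<subseteq> {w \<in> X.M \<times> Y.M. X.d (X.dense_seq k) (fst w) < r}"
      proof
        fix v assume v: "v \<in> prod.mball w (r - X.d (X.dense_seq k) (fst w))"
        have "X.d (X.dense_seq k) (fst v) \<le> X.d (X.dense_seq k) (fst w) + X.d (fst w) (fst v)"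
          using v w by (intro X.triangle) auto
        then show "v \<in> {w \<in> X.M \<times> Y.M. X.d (X.dense_seq k) (fst w) < r}"
          using v D_bounds(1)[of w v] by auto
      qed
      then show "\<exists>e>0. prod.mball w e \<subseteq> {w \<in> X.M \<times> Y.M. X.d (X.dense_seq k) (fst w) < r}"
        using w by (intro exI[of _ "r - X.d (X.dense_seq k) (fst w)"]) auto
    qed auto
    then show "{w \<in> space N. X.d (X.dense_seq k) (fst w) < r} \<in> sets N" unfolding N(1) by (rule op)
  qed (auto simp: N)
  have s: "snd \<in> measurable N Y.m"
  proof (rule Y.measurable_ballI)
    fix k r
    have "openin prod.mtopology {w \<in> X.M \<times> Y.M. Y.d (Y.dense_seq k) (snd w) < r}"
      unfolding prod.openin_mtopology
    proof (intro conjI allI impI)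
      fix w assume w: "w \<in> {w \<in> X.M \<times> Y.M. Y.d (Y.dense_seq k) (snd w) < r}"
      have "prod.mball w (r - Y.d (Y.dense_seq k) (snd w)) \<subseteq> {w \<in> X.M \<times> Y.M. Y.d (Y.dense_seq k) (snd w) < r}"
      proof
        fix v assume v: "v \<in> prod.mball w (r - Y.d (Y.dense_seq k) (snd w))"
        have "Y.d (Y.dense_seq k) (snd v) \<le> Y.d (Y.dense_seq k) (snd w) + Y.d (snd w) (snd v)"
          using v w by (intro Y.triangle) auto
        then show "v \<in> {w \<in> X.M \<times> Y.M. Y.d (Y.dense_seq k) (snd w) < r}"
          using v D_bounds(2)[of w v] by auto
      qed
      then show "\<exists>e>0. prod.mball w e \<subseteq> {w \<in> X.M \<times> Y.M. Y.d (Y.dense_seq k) (snd w) < r}"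
        using w by (intro exI[of _ "r - Y.d (Y.dense_seq k) (snd w)"]) auto
    qed auto
    then show "{w \<in> space N. Y.d (Y.dense_seq k) (snd w) < r} \<in> sets N" unfolding N(1) by (rule op)
  qed (auto simp: N)
  have "A \<times> B \<in> sets N" if "A \<in> X.P.events" "B \<in> Y.P.events" for A B
  proof -
    have "A \<subseteq> X.M" "B \<subseteq> Y.M"
      using sets.sets_into_space[OF that(1)] sets.sets_into_space[OF that(2)] by simp_all
    then have "A \<times> B = (fst -` A \<inter> space N) \<inter> (snd -` B \<inter> space N)"
      unfolding N(1) by auto
    then show ?thesis using measurable_sets[OF f that(1)] measurable_sets[OF s that(2)] by simp
  qed
  then have "sigma_sets (space N) {A \<times> B |A B. A \<in> X.P.events \<and> B \<in> Y.P.events} \<subseteq> sets N"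
    by (intro sets.sigma_sets_subset) blast
  then show "sets (X.m \<Otimes>\<^sub>M Y.m) \<subseteq> sigma_sets (X.M \<times> Y.M) {U. openin prod.mtopology U}"
    by (simp add: sets_pair_measure N)
  have "U \<in> sets (X.m \<Otimes>\<^sub>M Y.m)" if "openin prod.mtopology U" for U
  proof -
    have "(\<Union>(a, b)\<in>{(a, b). X.basic_ball a \<times> Y.basic_ball b \<subseteq> U}. X.basic_ball a \<times> Y.basic_ball b) \<in> sets (X.m \<Otimes>\<^sub>M Y.m)"
      by (intro sets.countable_UN'') (auto simp: X.basic_ball_def Y.basic_ball_def)
    then show ?thesis by (subst openin_eq_Union_rectangles[OF that])
  qed
  then have "sigma_sets (space (X.m \<Otimes>\<^sub>M Y.m)) {U. openin prod.mtopology U} \<subseteq> sets (X.m \<Otimes>\<^sub>M Y.m)"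
    by (intro sets.sigma_sets_subset) blast
  then show "sigma_sets (X.M \<times> Y.M) {U. openin prod.mtopology U} \<subseteq> sets (X.m \<Otimes>\<^sub>M Y.m)"
    by (simp add: space_pair_measure)
qed

sublocale PP: pair_prob_space X.m Y.m ..

lemma pm_space_prod: "pm_space (pm_prod p X Y)"
  unfolding pm_space_def pm_prod_simps mcomplete_of_def
  using mcomplete_prod separable_prod sets_prod PP.prob_space_axioms by (simp add: space_pair_measure)

end

subsection \<open>Common bounds of spaces with prescribed atoms\<close>

lemma measurable_unit_lebesgue_iff:
  "a \<in> measurable unit_lebesgue N \<longleftrightarrow> a \<in> {0..1} \<rightarrow> space N \<and>
     (\<forall>E\<in>sets N. {t\<in>{0..1}. a t \<in> E} \<in> sets borel)"
proof -
  have eq: "a -` E \<inter> {0..1} = {t\<in>{0..1}. a t \<in> E}" for E by auto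
  have "{t\<in>{0..1}. a t \<in> E} \<in> sets unit_lebesgue \<longleftrightarrow> {t\<in>{0..1}. a t \<in> E} \<in> sets borel" for E
    by (auto simp: sets_unit_lebesgue)
  then show ?thesis
    by (simp only: measurable_def eq Pi_iff space_unit_lebesgue mem_Collect_eq)
qed

lemma emeasure_distr_unit_lebesgue:
  assumes "a \<in> measurable unit_lebesgue N" "E \<in> sets N"
  shows "emeasure (distr unit_lebesgue N a) E = emeasure lborel {t\<in>{0..1}. a t \<in> E}"
proof -
  have eq: "a -` E \<inter> {0..1} = {t\<in>{0..1}. a t \<in> E}" by auto
  show ?thesis using assms by (simp only: emeasure_distr space_unit_lebesgue eq)
    (rule emeasure_unit_lebesgue, auto)
qed

lemma prob_space_unit_lebesgue: "prob_space unit_lebesgue"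
  by (rule prob_spaceI) (simp add: emeasure_unit_lebesgue)

lemma suminf_case_nat_ennreal:
  fixes g :: "nat \<Rightarrow> ennreal"
  shows "(\<Sum>i. case_nat x g i) = x + (\<Sum>i. g i)"
proof -
  have "(\<lambda>i. case_nat x g (Suc i)) sums (\<Sum>i. g i)" by (simp add: summable_sums)
  then have "case_nat x g sums ((\<Sum>i. g i) + x)" using sums_Suc[of "case_nat x g"] by simp
  then show ?thesis by (simp add: sums_unique[symmetric] add.commute)
qed

lemma weights_remainder:
  assumes "\<alpha> \<in> weights"
  shows "0 \<le> case_nat (1 - suminf \<alpha>) \<alpha> i" "case_nat (1 - suminf \<alpha>) \<alpha> sums 1"
proof -
  show "0 \<le> case_nat (1 - suminf \<alpha>) \<alpha> i"
    using weightsD(1,3)[OF assms] by (cases i) auto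
  have "(\<lambda>i. case_nat (1 - suminf \<alpha>) \<alpha> (Suc i)) sums suminf \<alpha>"
    using weightsD(2)[OF assms] by (simp add: summable_sums)
  from sums_Suc[OF this] show "case_nat (1 - suminf \<alpha>) \<alpha> sums 1" by simp
qed

text \<open>Interval 0 has the length of the missing mass and carries \<open>a\<close>; interval i +
  1 has length \<open>\<alpha> i\<close> and is constant at \<open>f i\<close>. This accounts for
  the shift by \<open>case_nat\<close>.\<close>

lemma glue_atoms:
  assumes \<alpha>: "\<alpha> \<in> weights" and a: "a \<in> measurable unit_lebesgue N" and f: "\<And>i. f i \<in> space N"
  defines "H \<equiv> glue (case_nat (1 - suminf \<alpha>) \<alpha>) (case_nat a (\<lambda>i _. f i))"
  shows "H \<in> measurable unit_lebesgue N"
    and "E \<in> sets N \<Longrightarrow> emeasure (distr unit_lebesgue N H) E =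
      ennreal (1 - suminf \<alpha>) * emeasure lborel {u\<in>{0..1}. a u \<in> E} + (\<Sum>i. ennreal (\<alpha> i) * indicator E (f i))"
proof -
  let ?c = "case_nat (1 - suminf \<alpha>) \<alpha>"
  let ?a = "case_nat a (\<lambda>i _. f i)"
  note c = weights_remainder[OF \<alpha>]
  have a': "a \<in> {0..1} \<rightarrow> space N" "\<And>E. E \<in> sets N \<Longrightarrow> {t\<in>{0..1}. a t \<in> E} \<in> sets borel"
    using a unfolding measurable_unit_lebesgue_iff by blast+
  have in_N: "?a i \<in> {0..1} \<rightarrow> space N" for i using a'(1) f by (cases i) auto
  have pieces: "{u\<in>{0..1}. ?a i u \<in> E} \<in> sets borel" if "E \<in> sets N" for E i
    using a'(2)[OF that] by (cases i) (auto simp: Collect_conj_eq)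
  show H: "H \<in> measurable unit_lebesgue N"
    unfolding measurable_unit_lebesgue_iff H_def
    using glue_in[of ?c ?a, OF c in_N] glue_emeasure(1)[of ?c ?a, OF c pieces] by auto
  assume E: "E \<in> sets N"
  have const: "emeasure lborel {u \<in> {0..1::real}. P} = (if P then 1 else 0)" for P
  proof -
    have "{u \<in> {0..1::real}. P} = (if P then {0..1} else {})" by auto
    then show ?thesis by simp
  qed
  have "emeasure (distr unit_lebesgue N H) E = emeasure lborel {t\<in>{0..1}. H t \<in> E}"
    by (rule emeasure_distr_unit_lebesgue[OF H E])
  also have "\<dots> = (\<Sum>i. ennreal (?c i) * emeasure lborel {u\<in>{0..1}. ?a i u \<in> E})"
    unfolding H_def by (rule glue_emeasure(2)[of ?c ?a, OF c pieces[OF E]])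
  also have "(\<lambda>i. ennreal (?c i) * emeasure lborel {u\<in>{0..1}. ?a i u \<in> E}) =
     case_nat (ennreal (1 - suminf \<alpha>) * emeasure lborel {u\<in>{0..1}. a u \<in> E}) (\<lambda>i. ennreal (\<alpha> i) * indicator E (f i))"
  proof
    fix i
    show "ennreal (?c i) * emeasure lborel {u\<in>{0..1}. ?a i u \<in> E} =
      case_nat (ennreal (1 - suminf \<alpha>) * emeasure lborel {u\<in>{0..1}. a u \<in> E}) (\<lambda>i. ennreal (\<alpha> i) * indicator E (f i)) i"
      by (cases i) (simp_all only: nat.case const indicator_def of_bool_def)
  qed
  finally show "emeasure (distr unit_lebesgue N H) E =
      ennreal (1 - suminf \<alpha>) * emeasure lborel {u\<in>{0..1}. a u \<in> E} + (\<Sum>i. ennreal (\<alpha> i) * indicator E (f i))"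
    by (simp only: suminf_case_nat_ennreal)
qed

text \<open>What remains of the measure after removing the atoms has mass 1 -
  \<open>suminf \<alpha>\<close>. Normalized, it is a probability on the same metric space, and a
  parameter of it is the required map.\<close>

lemma ex_residual_map:
  assumes X: "pm_space X" and \<alpha>: "\<alpha> \<in> weights" and f: "\<And>i. f i \<in> mspace (pm_metric X)"
    and le: "\<And>E. E \<in> sets (pm_measure X) \<Longrightarrow>
      (\<Sum>i. ennreal (\<alpha> i) * indicator E (f i)) \<le> emeasure (pm_measure X) E"
  shows "\<exists>a. a \<in> measurable unit_lebesgue (pm_measure X) \<and>
    (\<forall>E\<in>sets (pm_measure X). emeasure (pm_measure X) E =
      ennreal (1 - suminf \<alpha>) * emeasure lborel {u\<in>{0..1}. a u \<in> E} + (\<Sum>i. ennreal (\<alpha> i) * indicator E (f i)))"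
proof -
  interpret X: pm_sp X by standard fact
  let ?W = "density (count_space UNIV) (\<lambda>i. ennreal (\<alpha> i))"
  define N where "N = distr ?W X.m f"
  have mf: "f \<in> measurable ?W X.m" using f by (simp add: measurable_def)
  have N: "emeasure N E = (\<Sum>i. ennreal (\<alpha> i) * indicator E (f i))" if "E \<in> X.P.events" for E
  proof -
    have "emeasure N E = emeasure ?W (f -` E)"
      using mf that by (simp add: N_def emeasure_distr)
    also have "\<dots> = (\<integral>\<^sup>+i. ennreal (\<alpha> i) * indicator (f -` E) i \<partial>count_space UNIV)"
      by (simp add: emeasure_density)
    also have "\<dots> = (\<Sum>i. ennreal (\<alpha> i) * indicator (f -` E) i)" by (rule nn_integral_count_space_nat)
    finally show ?thesis by (simp add: indicator_vimage)
  qed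
  have sN: "sets N = X.P.events" "space N = X.M" by (simp_all add: N_def)
  have MX: "X.M \<in> X.P.events" by (rule X.open_sets) simp
  define c where "c = 1 - suminf \<alpha>"
  have c: "0 \<le> c" using weightsD(3)[OF \<alpha>] by (simp add: c_def)
  have NM: "emeasure N X.M = ennreal (suminf \<alpha>)"
    using N[OF MX] f suminf_ennreal_weights(1)[OF \<alpha>] by simp
  have finN: "finite_measure N" by (rule finite_measureI) (simp add: sN NM)
  have leN: "emeasure N E \<le> emeasure X.m E" if "E \<in> X.P.events" for E
    using le[OF that] N[OF that] by simp
  show ?thesis
  proof (cases "c = 0")
    case True
    \<comment> \<open>Nothing is left to normalize when the weights sum to 1. The atomic measure
      lies below the whole one and has the same total, so passing to complements gives equality; the
      factor in front of \<open>a\<close> is 0 and a constant map will do.\<close>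
    have eq: "emeasure X.m E = emeasure N E" if E: "E \<in> X.P.events" for E
    proof (rule antisym)
      have E': "X.M - E \<in> X.P.events" using sets.compl_sets[OF E] by simp
      have EM: "X.M - (X.M - E) = E" using sets.sets_into_space[OF E] by auto
      have "suminf \<alpha> = 1" using True by (simp add: c_def)
      then have tot: "emeasure N X.M = emeasure X.m X.M"
        using NM X.P.emeasure_space_1 by simp
      have "emeasure X.m E = emeasure X.m X.M - emeasure X.m (X.M - E)"
        using emeasure_compl[OF E'] EM by simp
      also have "\<dots> \<le> emeasure X.m X.M - emeasure N (X.M - E)"
        by (rule ennreal_mono_minus) (rule leN[OF E'])
      also have "\<dots> = emeasure N X.M - emeasure N (X.M - E)" by (simp only: tot)
      also have "\<dots> = emeasure N E"
        using emeasure_compl[of "X.M - E" N] E' EM finite_measure.emeasure_finite[OF finN] by (simp add: sN)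
      finally show "emeasure X.m E \<le> emeasure N E" .
    qed (rule leN[OF E])
    obtain x where x: "x \<in> X.M" using X.nonempty by blast
    show ?thesis
      using True x eq N by (intro exI[of _ "\<lambda>_. x"]) (simp add: c_def)
  next
    case False
    then have c0: "c > 0" using c by simp
    define K where "K = scale_measure (ennreal (1 / c)) (diff_measure X.m N)"
    have sK: "sets K = X.P.events" "space K = X.M"
      by (simp_all add: K_def space_scale_measure)
    have K: "emeasure K E = ennreal (1 / c) * (emeasure X.m E - emeasure N E)" if "E \<in> X.P.events" for E
      unfolding K_def emeasure_scale_measure
      using emeasure_diff_measure[OF _ finN _ _ that] leN sN X.P.finite_measure_axioms by simp
    have cK: "ennreal c * emeasure K E = emeasure X.m E - emeasure N E" if "E \<in> X.P.events" for E
      using c0 by (simp add: K[OF that] mult.assoc[symmetric] ennreal_mult[symmetric])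
    have "emeasure X.m X.M - emeasure N X.M = ennreal c"
      using weightsD(1,2,3)[OF \<alpha>] X.P.emeasure_space_1 suminf_nonneg[of \<alpha>]
      by (simp add: NM c_def ennreal_minus[symmetric])
    then have "prob_space K"
      using c0 by (intro prob_spaceI) (simp add: sK K[OF MX] ennreal_mult[symmetric])
    then have XK: "pm_space (X\<lparr>pm_measure := K\<rparr>)"
      by (intro pm_space_change_measure X) (simp_all add: sK)
    obtain a where a: "parameter (X\<lparr>pm_measure := K\<rparr>) a"
      using pm_sp.ex_parameter[of "X\<lparr>pm_measure := K\<rparr>"] XK by (auto simp: pm_sp_def)
    then have a': "a \<in> {0..1} \<rightarrow> X.M" "\<And>E. E \<in> X.P.events \<Longrightarrow> {u\<in>{0..1}. a u \<in> E} \<in> sets borel"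
      "\<And>E. E \<in> X.P.events \<Longrightarrow> emeasure lborel {u\<in>{0..1}. a u \<in> E} = emeasure K E"
      unfolding parameter_iff[OF XK] by (simp_all add: sK)
    have "emeasure X.m E = ennreal c * emeasure lborel {u\<in>{0..1}. a u \<in> E} + emeasure N E"
      if "E \<in> X.P.events" for E
      using cK[OF that] a'(3)[OF that] leN[OF that] by (simp add: diff_add_cancel_ennreal)
    moreover have "a \<in> measurable unit_lebesgue X.m"
      unfolding measurable_unit_lebesgue_iff using a' by simp
    ultimately show ?thesis using N by (intro exI[of _ a]) (simp add: c_def)
  qed
qed

text \<open>A coupling: the i-th atom sits at the pair of the two i-th atoms, and both residual maps
  run on the same u. The marginals are then the given measures, and the projections from the maximum
  product are 1-Lipschitz.\<close>

lemma ex_common_bound: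
  fixes X :: "'a pm" and Y :: "'b pm"
  assumes X: "pm_space X" and Y: "pm_space Y" and \<alpha>: "\<alpha> \<in> weights"
    and aX: "has_atoms \<alpha> X" and aY: "has_atoms \<alpha> Y"
  shows "\<exists>Z :: ('a \<times> 'b) pm. pm_space Z \<and> has_atoms \<alpha> Z \<and> pm_lipschitz_le X Z \<and> pm_lipschitz_le Y Z"
proof -
  interpret pm_pair X Y \<infinity> using X Y by unfold_locales auto
  obtain f where f: "\<And>i. f i \<in> X.M"
    "\<And>E. E \<in> X.P.events \<Longrightarrow> (\<Sum>i. ennreal (\<alpha> i) * indicator E (f i)) \<le> emeasure X.m E"
    using aX unfolding has_atoms_def by blast
  obtain g where g: "\<And>i. g i \<in> Y.M"
    "\<And>E. E \<in> Y.P.events \<Longrightarrow> (\<Sum>i. ennreal (\<alpha> i) * indicator E (g i)) \<le> emeasure Y.m E"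
    using aY unfolding has_atoms_def by blast
  obtain a where a [measurable]: "a \<in> measurable unit_lebesgue X.m"
    and aE: "\<And>E. E \<in> X.P.events \<Longrightarrow> emeasure X.m E =
      ennreal (1 - suminf \<alpha>) * emeasure lborel {u\<in>{0..1}. a u \<in> E} + (\<Sum>i. ennreal (\<alpha> i) * indicator E (f i))"
    using ex_residual_map[OF X \<alpha> f] by blast
  obtain b where b [measurable]: "b \<in> measurable unit_lebesgue Y.m"
    and bE: "\<And>E. E \<in> Y.P.events \<Longrightarrow> emeasure Y.m E =
      ennreal (1 - suminf \<alpha>) * emeasure lborel {u\<in>{0..1}. b u \<in> E} + (\<Sum>i. ennreal (\<alpha> i) * indicator E (g i))"
    using ex_residual_map[OF Y \<alpha> g] by blast
  have aM: "a u \<in> X.M" "b u \<in> Y.M" if "u \<in> {0..1}" for u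
    using measurable_space[OF a, of u] measurable_space[OF b, of u] that by simp_all
  let ?N = "X.m \<Otimes>\<^sub>M Y.m"
  define ab where "ab u = (a u, b u)" for u
  define F where "F i = (f i, g i)" for i
  have ab: "ab \<in> measurable unit_lebesgue ?N" unfolding ab_def by measurable
  have F: "F i \<in> space ?N" for i using f g by (simp add: F_def space_pair_measure)
  define H where "H = glue (case_nat (1 - suminf \<alpha>) \<alpha>) (case_nat ab (\<lambda>i _. F i))"
  define Z where "Z = (pm_prod \<infinity> X Y)\<lparr>pm_measure := distr unit_lebesgue ?N H\<rparr>"
  note H = glue_atoms(1)[where f = F, OF \<alpha> ab F, folded H_def] and HE = glue_atoms(2)[where f = F, OF \<alpha> ab F, folded H_def]
  have mZ: "pm_measure Z = distr unit_lebesgue ?N H" and metZ: "pm_metric Z = pm_metric (pm_prod \<infinity> X Y)"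
    by (simp_all add: Z_def)
  have Z: "pm_space Z"
    unfolding Z_def using H prob_space.prob_space_distr[OF prob_space_unit_lebesgue H]
    by (intro pm_space_change_measure pm_space_prod) (simp_all add: pm_prod_simps)
  have "has_atoms \<alpha> Z"
    unfolding has_atoms_def metZ mZ pm_prod_simps
    using f(1) g(1) HE by (intro exI[of _ F]) (simp add: F_def)
  moreover have "pm_lipschitz_le X Z"
    unfolding pm_lipschitz_le_iff[OF Z X]
  proof (intro exI[of _ fst] conjI ballI)
    fix B assume B: "B \<in> X.P.events"
    have eq: "mspace (pm_metric Z) \<inter> fst -` B = B \<times> Y.M"
      using sets.sets_into_space[OF B] by (auto simp: metZ pm_prod_simps)
    have BM: "B \<times> Y.M \<in> sets ?N" using B Y.open_sets[of Y.M] by simp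
    show "mspace (pm_metric Z) \<inter> fst -` B \<in> sets (pm_measure Z)" unfolding eq using BM by (simp add: mZ)
    have "{u\<in>{0..1}. ab u \<in> B \<times> Y.M} = {u\<in>{0..1}. a u \<in> B}" using aM by (auto simp: ab_def)
    then show "emeasure (pm_measure Z) (mspace (pm_metric Z) \<inter> fst -` B) = emeasure X.m B"
      unfolding eq mZ HE[OF BM] aE[OF B] using g(1) by (simp add: F_def indicator_def)
  qed (auto simp: metZ pm_prod_simps D_bounds)
  moreover have "pm_lipschitz_le Y Z"
    unfolding pm_lipschitz_le_iff[OF Z Y]
  proof (intro exI[of _ snd] conjI ballI)
    fix B assume B: "B \<in> Y.P.events"
    have eq: "mspace (pm_metric Z) \<inter> snd -` B = X.M \<times> B"
      using sets.sets_into_space[OF B] by (auto simp: metZ pm_prod_simps)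
    have BM: "X.M \<times> B \<in> sets ?N" using B X.open_sets[of X.M] by simp
    show "mspace (pm_metric Z) \<inter> snd -` B \<in> sets (pm_measure Z)" unfolding eq using BM by (simp add: mZ)
    have "{u\<in>{0..1}. ab u \<in> X.M \<times> B} = {u\<in>{0..1}. b u \<in> B}" using aM by (auto simp: ab_def)
    then show "emeasure (pm_measure Z) (mspace (pm_metric Z) \<inter> snd -` B) = emeasure Y.m B"
      unfolding eq mZ HE[OF BM] bE[OF B] using f(1) by (simp add: F_def indicator_def)
  qed (auto simp: metZ pm_prod_simps D_bounds)
  ultimately show ?thesis using Z by blast
qed

subsection \<open>Limits of spaces with prescribed atoms\<close>

text \<open>An event contains the positions of the finitely many positive atoms counted in a partial
  sum. Positions may coincide, so the sum over \<open>F\<close> is compared with the mass of the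
  image and not atom by atom.\<close>

lemma (in pm_sp) has_atomsI_finite:
  assumes nn: "\<And>i. 0 \<le> \<beta> i" and f: "\<And>i. f i \<in> M"
    and le: "\<And>F. finite F \<Longrightarrow> (\<And>i. i \<in> F \<Longrightarrow> \<beta> i > 0) \<Longrightarrow> sum \<beta> F \<le> measure m (f ` F)"
  shows "has_atoms \<beta> X"
  unfolding has_atoms_def
proof (intro exI[of _ f] conjI allI ballI f)
  fix E assume E: "E \<in> P.events"
  show "(\<Sum>i. ennreal (\<beta> i) * indicator E (f i)) \<le> emeasure m E"
  proof (rule suminf_le_const)
    fix n
    define F where "F = {i. i < n \<and> \<beta> i > 0 \<and> f i \<in> E}"
    have fin: "finite F" by (simp add: F_def)
    have "(\<Sum>i<n. ennreal (\<beta> i) * indicator E (f i)) = (\<Sum>i\<in>F. ennreal (\<beta> i) * indicator E (f i))"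
      by (rule sum.mono_neutral_right) (auto simp: F_def indicator_def ennreal_eq_0_iff not_less)
    also have "\<dots> = (\<Sum>i\<in>F. ennreal (\<beta> i))"
      by (rule sum.cong) (auto simp: F_def)
    also have "\<dots> = ennreal (sum \<beta> F)" using nn by (simp add: sum_ennreal)
    also have "\<dots> \<le> ennreal (measure m (f ` F))"
      using fin by (intro ennreal_leI le) (auto simp: F_def)
    also have "\<dots> = emeasure m (f ` F)" by (rule P.emeasure_eq_measure[symmetric])
    also have "\<dots> \<le> emeasure m E" using E by (intro emeasure_mono) (auto simp: F_def)
    finally show "(\<Sum>i<n. ennreal (\<beta> i) * indicator E (f i)) \<le> emeasure m E" .
  qed simp
qed

lemma (in pm_sp) parameter_measure:
  assumes "parameter X a" "E \<in> P.events"
  shows "{t\<in>{0..1}. a t \<in> E} \<in> sets borel" "measure lborel {t\<in>{0..1}. a t \<in> E} = measure m E"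
  using assms unfolding parameter_iff[OF pm_space] by (simp_all add: measure_def)

lemma fmeasurable_subset_unit:
  assumes "B \<in> sets borel" "B \<subseteq> {0..1::real}" shows "B \<in> fmeasurable lborel"
proof (rule fmeasurableI)
  have "emeasure lborel B \<le> emeasure lborel {0..1::real}" using assms by (intro emeasure_mono) simp_all
  also have "\<dots> < \<infinity>" by simp
  finally show "emeasure lborel B < \<infinity>" .
qed (use assms in simp)

lemma measure_Int_ge:
  assumes A: "A \<in> sets borel" "A \<subseteq> {0..1::real}" and I: "I \<in> sets borel" "I \<subseteq> {0..1::real}"
  shows "measure lborel (A \<inter> I) \<ge> measure lborel A + measure lborel I - 1"
proof -
  have "measure lborel (A \<union> I) \<le> measure lborel {0..1::real}"
    using A I by (intro measure_mono_fmeasurable fmeasurable_subset_unit) simp_all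
  then show ?thesis
    using measure_Un3[OF fmeasurable_subset_unit[OF A] fmeasurable_subset_unit[OF I]] by simp
qed

text \<open>The preimages of the \<open>i\<close>-th atoms of the approximating spaces have almost the right measure, and
  the parameter of the limit space maps them into small balls. Balls of mass bounded below
  accumulate (Fatou), so along a subsequence the centres converge; the limits carry the mass.\<close>

lemma has_atoms_limit:
  fixes X :: "'a pm" and Y :: "nat \<Rightarrow> 'b pm"
  assumes X: "pm_space X" and Y: "\<And>n. pm_space (Y n)" and nn: "\<And>n i. 0 \<le> \<alpha> n i"
    and lim: "\<And>i. (\<lambda>n. \<alpha> n i) \<longlonglongrightarrow> \<beta> i" and atoms: "\<And>n. has_atoms (\<alpha> n) (Y n)"
    and box: "\<And>n. box_le X (Y n) (\<epsilon> n)" and \<epsilon>: "\<epsilon> \<longlonglongrightarrow> 0"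
  shows "has_atoms \<beta> X"
proof -
  interpret X: pm_sp X by standard fact
  have nn\<beta>: "0 \<le> \<beta> i" for i by (rule LIMSEQ_le_const[OF lim]) (use nn in auto)
  define W where "W n a b I \<longleftrightarrow> parameter X a \<and> parameter (Y n) b \<and> I \<in> sets borel \<and> I \<subseteq> {0..1} \<and>
      measure lborel I \<ge> 1 - \<epsilon> n \<and>
      (\<forall>s\<in>I. \<forall>t\<in>I. \<bar>X.d (a s) (a t) - mdist (pm_metric (Y n)) (b s) (b t)\<bar> \<le> \<epsilon> n)" for n a b I
  have "\<exists>q. W n (fst q) (fst (snd q)) (snd (snd q))" for n
    using box[of n] unfolding box_le_def W_def[symmetric] by auto
  then have "\<exists>q. \<forall>n. W n (fst (q n)) (fst (snd (q n))) (snd (snd (q n)))"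
    by (intro choice[of "\<lambda>n q. W n (fst q) (fst (snd q)) (snd (snd q))"] allI)
  then obtain a b I where W: "\<And>n. W n (a n) (b n) (I n)"
    using that[of "\<lambda>n. fst (q n)" "\<lambda>n. fst (snd (q n))" "\<lambda>n. snd (snd (q n))" for q] by blast
  have a: "\<And>n. parameter X (a n)" and b: "\<And>n. parameter (Y n) (b n)"
    and I: "\<And>n. I n \<in> sets borel" "\<And>n. I n \<subseteq> {0..1}" "\<And>n. measure lborel (I n) \<ge> 1 - \<epsilon> n"
    and close: "\<And>n s t. s \<in> I n \<Longrightarrow> t \<in> I n \<Longrightarrow>
       \<bar>X.d (a n s) (a n t) - mdist (pm_metric (Y n)) (b n s) (b n t)\<bar> \<le> \<epsilon> n"
    using W unfolding W_def by blast+
  define R where "R n f \<longleftrightarrow> (\<forall>i. f i \<in> mspace (pm_metric (Y n))) \<and> (\<forall>E\<in>sets (pm_measure (Y n)).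
        (\<Sum>i. ennreal (\<alpha> n i) * indicator E (f i)) \<le> emeasure (pm_measure (Y n)) E)" for n f
  have "\<exists>f. \<forall>n. R n (f n)"
    using atoms unfolding has_atoms_def R_def[symmetric] by (intro choice allI)
  then obtain f where R: "\<And>n. R n (f n)" by blast
  have f: "\<And>n i. f n i \<in> mspace (pm_metric (Y n))"
    and fle: "\<And>n E. E \<in> sets (pm_measure (Y n)) \<Longrightarrow>
        (\<Sum>i. ennreal (\<alpha> n i) * indicator E (f n i)) \<le> emeasure (pm_measure (Y n)) E"
    using R unfolding R_def by blast+
  \<comment> \<open>The good times at which the parameter of \<open>Y n\<close> sits at one of the
    atoms with index in \<open>F\<close>; discarding the bad times costs at most \<epsilon>
    n.\<close>
  define G where "G n F = {t\<in>{0..1}. b n t \<in> f n ` F} \<inter> I n" for n F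
  have G: "G n F \<in> sets borel" "measure lborel (G n F) \<ge> sum (\<alpha> n) F - \<epsilon> n" if F: "finite F" for n F
  proof -
    interpret Y: pm_sp "Y n" by standard (rule Y)
    have E: "f n ` F \<in> Y.P.events" using F f by (intro Y.finite_sets) auto
    note p = Y.parameter_measure[OF b E]
    show "G n F \<in> sets borel" unfolding G_def using p I by auto
    have "ennreal (sum (\<alpha> n) F) \<le> emeasure Y.m (f n ` F)"
      using F nn by (intro order_trans[OF atoms_le_finite fle[OF E]]) auto
    then have "sum (\<alpha> n) F \<le> measure Y.m (f n ` F)"
      using nn by (simp add: Y.P.emeasure_eq_measure sum_nonneg)
    then show "measure lborel (G n F) \<ge> sum (\<alpha> n) F - \<epsilon> n"
      using measure_Int_ge[OF p(1) _ I(1,2), of n] p(2) I(3)[of n] unfolding G_def by force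
  qed
  obtain z where z: "z \<in> X.M" using X.nonempty by blast
  have aM: "a n t \<in> X.M" if "t \<in> {0..1}" for n t
    using a[of n] that unfolding parameter_iff[OF X] by auto
  \<comment> \<open>At all times in \<open>G n {i}\<close> the parameter of \<open>Y n\<close> is at
    the same point, so the parameter of \<open>X\<close> moves by at most \<epsilon> n there. Any
    such time gives a centre; z is a placeholder when there is none.\<close>
  define x where "x n i = (if G n {i} = {} then z else a n (SOME t. t \<in> G n {i}))" for n i
  have x: "x n i \<in> X.M" and near: "\<And>t. t \<in> G n {i} \<Longrightarrow> X.d (x n i) (a n t) \<le> \<epsilon> n" for n i
  proof -
    have some: "(SOME t. t \<in> G n {i}) \<in> G n {i}" if "G n {i} \<noteq> {}"
      using that by (simp add: some_in_eq)
    show "x n i \<in> X.M" using z aM some by (auto simp: x_def G_def)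
    fix t assume t: "t \<in> G n {i}"
    define s where "s = (SOME t. t \<in> G n {i})"
    have s: "s \<in> G n {i}" unfolding s_def using t some by blast
    have "mdist (pm_metric (Y n)) (b n s) (b n t) = 0"
      using s t f[of n i] by (auto simp: G_def)
    then have "X.d (a n s) (a n t) \<le> \<epsilon> n" using close[of s n t] s t by (auto simp: G_def)
    then show "X.d (x n i) (a n t) \<le> \<epsilon> n" using t by (auto simp: x_def s_def)
  qed
  \<comment> \<open>Several atoms may converge to the same point and their masses must then add up,
    hence a finite set \<open>F\<close> instead of a single index.\<close>
  have mass: "measure X.m (\<Union>i\<in>F. X.mcball (l i) r) \<ge> sum (\<alpha> n) F - \<epsilon> n"
    if F: "finite F" and l: "\<And>i. i \<in> F \<Longrightarrow> l i \<in> X.M \<and> X.d (l i) (x n i) + \<epsilon> n \<le> r" for F l n r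
  proof -
    let ?U = "\<Union>i\<in>F. X.mcball (l i) r"
    have U: "?U \<in> X.P.events" using F by auto
    note p = X.parameter_measure[OF a[of n] U]
    have sub: "G n F \<subseteq> {t\<in>{0..1}. a n t \<in> ?U}"
    proof
      fix t assume t: "t \<in> G n F"
      then obtain i where i: "i \<in> F" "t \<in> G n {i}" by (auto simp: G_def)
      have tM: "t \<in> {0..1}" "a n t \<in> X.M" using t aM by (auto simp: G_def)
      have "X.d (l i) (a n t) \<le> X.d (l i) (x n i) + X.d (x n i) (a n t)"
        using l[OF i(1)] x tM by (intro X.triangle) auto
      also have "\<dots> \<le> r" using near[OF i(2)] l[OF i(1)] by linarith
      finally have "a n t \<in> X.mcball (l i) r" using l[OF i(1)] tM by simp
      then show "t \<in> {t\<in>{0..1}. a n t \<in> ?U}" using i(1) tM by blast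
    qed
    have "measure lborel (G n F) \<le> measure lborel {t\<in>{0..1}. a n t \<in> ?U}"
    proof (rule measure_mono_fmeasurable[OF sub])
      show "G n F \<in> sets lborel" using G(1)[OF F, of n] by simp
      show "{t\<in>{0..1}. a n t \<in> ?U} \<in> fmeasurable lborel"
        by (rule fmeasurable_subset_unit[OF p(1)]) blast
    qed
    then show ?thesis using G(2)[OF F, of n] p(2) by linarith
  qed
  \<comment> \<open>Only weights that stay positive in the limit keep enough mass to pin down a
    position; the other indices are unconstrained.\<close>
  define P where "P i s \<longleftrightarrow> (\<beta> i > 0 \<longrightarrow> (\<exists>l\<in>X.M. (\<lambda>k. X.d l (x (s k) i)) \<longlonglongrightarrow> 0))" for i and s :: "nat \<Rightarrow> nat"
  have sub: "\<exists>r'. strict_mono r' \<and> P i (s \<circ> r')" if s: "strict_mono s" for i and s :: "nat \<Rightarrow> nat"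
  proof (cases "\<beta> i > 0")
    case False
    show ?thesis by (intro exI[of _ id]) (use False in \<open>simp add: P_def strict_mono_def\<close>)
  next
    case True
    define \<delta> where "\<delta> = \<beta> i / 2"
    have \<delta>: "0 < \<delta>" "\<delta> < \<beta> i" using True by (auto simp: \<delta>_def)
    have "(\<lambda>n. \<alpha> n i - \<epsilon> n) \<longlonglongrightarrow> \<beta> i - 0" by (intro tendsto_diff lim \<epsilon>)
    then have "\<forall>\<^sub>F n in sequentially. \<alpha> n i - \<epsilon> n > \<delta>" using \<delta> by (intro order_tendstoD) auto
    then obtain N where N: "\<And>n. n \<ge> N \<Longrightarrow> \<alpha> n i - \<epsilon> n > \<delta>" unfolding eventually_sequentially by blast
    define B where "B k = X.mcball (x (s k) i) (\<epsilon> (s k))" for k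
    define U where "U j = (\<Union>k\<in>{j..}. B k)" for j
    have Bs: "B k \<in> X.P.events" for k by (simp add: B_def)
    have Us: "U j \<in> X.P.events" for j unfolding U_def using Bs by auto
    have "measure X.m (U j) \<ge> \<delta>" for j
    proof -
      define k where "k = max j N"
      have "s k \<ge> N" using seq_suble[OF s, of k] by (simp add: k_def)
      have "measure X.m (B k) \<ge> \<delta>"
        using mass[of "{i}" "\<lambda>_. x (s k) i" "s k" "\<epsilon> (s k)"] x N[OF \<open>s k \<ge> N\<close>] by (simp add: B_def)
      also have "measure X.m (B k) \<le> measure X.m (U j)"
      proof (rule X.P.finite_measure_mono[OF _ Us])
        show "B k \<subseteq> U j" unfolding U_def by (rule UN_upper) (simp add: k_def)
      qed
      finally show ?thesis .
    qed
    moreover have "(\<lambda>j. measure X.m (U j)) \<longlonglongrightarrow> measure X.m (\<Inter>j. U j)"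
    proof (rule X.P.finite_Lim_measure_decseq)
      show "decseq U" unfolding decseq_def U_def by (intro allI impI UN_mono) simp_all
    qed (use Us in blast)
    \<comment> \<open>The limsup of the balls has mass at least \<delta>, so some point y lies in
      infinitely many of them. The radii tend to 0, and the centres converge to y along those
      indices.\<close>
    ultimately have "measure X.m (\<Inter>j. U j) \<ge> \<delta>" by (intro LIMSEQ_le_const) auto
    then have "(\<Inter>j. U j) \<noteq> {}" using \<delta>(1) by auto
    then obtain y where y: "\<And>j. y \<in> U j" by blast
    have "infinite {k. y \<in> B k}"
    proof -
      have "\<exists>k\<ge>j. y \<in> B k" for j using y[of j] unfolding U_def by blast
      then show ?thesis unfolding infinite_nat_iff_unbounded_le by blast
    qed
    then obtain r :: "nat \<Rightarrow> nat" where r: "strict_mono r" "\<And>k. y \<in> B (r k)"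
      using infinite_enumerate by blast
    have "(\<lambda>k. X.d y (x ((s \<circ> r) k) i)) \<longlonglongrightarrow> 0"
    proof (rule tendsto_sandwich[OF _ _ tendsto_const])
      show "(\<lambda>k. \<epsilon> ((s \<circ> r) k)) \<longlonglongrightarrow> 0"
        using LIMSEQ_subseq_LIMSEQ[OF \<epsilon> strict_mono_o[OF s r(1)]] by (simp add: o_def)
      show "\<forall>\<^sub>F k in sequentially. X.d y (x ((s \<circ> r) k) i) \<le> \<epsilon> ((s \<circ> r) k)"
        using r(2) by (simp add: B_def X.commute)
    qed simp
    moreover have "y \<in> X.M" using r(2)[of 0] by (simp add: B_def)
    ultimately show ?thesis using r(1) unfolding P_def by blast
  qed
  interpret S: subseqs P by standard (rule sub)
  define \<rho> where "\<rho> = S.diagseq"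
  have \<rho>: "strict_mono \<rho>" unfolding \<rho>_def by (rule S.subseq_diagseq)
  have "\<exists>l\<in>X.M. (\<lambda>k. X.d l (x (\<rho> k) i)) \<longlonglongrightarrow> 0" if pos: "\<beta> i > 0" for i
  proof -
    have "P i (S.diagseq \<circ> ((+) (Suc i)))"
    proof (rule S.diagseq_holds)
      fix r s :: "nat \<Rightarrow> nat" and n assume r: "strict_mono r" and Ps: "P n s"
      show "P n (s \<circ> r)"
        unfolding P_def
      proof
        assume "\<beta> n > 0"
        then obtain l where l: "l \<in> X.M" "(\<lambda>k. X.d l (x (s k) n)) \<longlonglongrightarrow> 0" using Ps P_def by blast
        have "((\<lambda>k. X.d l (x (s k) n)) \<circ> r) \<longlonglongrightarrow> 0" by (rule LIMSEQ_subseq_LIMSEQ[OF l(2) r])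
        then show "\<exists>l\<in>X.M. (\<lambda>k. X.d l (x ((s \<circ> r) k) n)) \<longlonglongrightarrow> 0" using l(1) by (auto simp: o_def)
      qed
    qed
    then obtain l where l: "l \<in> X.M" "(\<lambda>k. X.d l (x (\<rho> (Suc i + k)) i)) \<longlonglongrightarrow> 0"
      using pos by (auto simp: P_def \<rho>_def)
    then have "(\<lambda>k. X.d l (x (\<rho> k) i)) \<longlonglongrightarrow> 0"
      using LIMSEQ_offset[of "\<lambda>k. X.d l (x (\<rho> k) i)" "Suc i" 0] by (simp add: add.commute)
    then show ?thesis using l(1) by blast
  qed
  then have "\<exists>l'. \<forall>i. \<beta> i > 0 \<longrightarrow> l' i \<in> X.M \<and> (\<lambda>k. X.d (l' i) (x (\<rho> k) i)) \<longlonglongrightarrow> 0"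
    by (intro choice[of "\<lambda>i l. \<beta> i > 0 \<longrightarrow> l \<in> X.M \<and> (\<lambda>k. X.d l (x (\<rho> k) i)) \<longlonglongrightarrow> 0"]) blast
  then obtain l' where l': "\<And>i. \<beta> i > 0 \<Longrightarrow> l' i \<in> X.M" "\<And>i. \<beta> i > 0 \<Longrightarrow> (\<lambda>k. X.d (l' i) (x (\<rho> k) i)) \<longlonglongrightarrow> 0"
    by blast
  define l where "l i = (if \<beta> i > 0 then l' i else z)" for i
  have lM: "l i \<in> X.M" for i using l'(1) z by (simp add: l_def)
  show ?thesis
  proof (rule X.has_atomsI_finite[OF nn\<beta> lM])
    fix F assume F: "finite F" "\<And>i. i \<in> F \<Longrightarrow> \<beta> i > 0"
    define V where "V j = (\<Union>i\<in>F. X.mcball (l i) (1 / real (Suc j)))" for j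
    have Vs: "V j \<in> X.P.events" for j unfolding V_def using F(1) by auto
    have "sum \<beta> F \<le> measure X.m (V j)" for j
    proof (rule LIMSEQ_le_const2)
      have "(\<lambda>k. sum (\<alpha> (\<rho> k)) F - \<epsilon> (\<rho> k)) \<longlonglongrightarrow> sum \<beta> F - 0"
        using LIMSEQ_subseq_LIMSEQ[OF lim \<rho>] LIMSEQ_subseq_LIMSEQ[OF \<epsilon> \<rho>]
        by (intro tendsto_diff tendsto_sum) (auto simp: o_def)
      then show "(\<lambda>k. sum (\<alpha> (\<rho> k)) F - \<epsilon> (\<rho> k)) \<longlonglongrightarrow> sum \<beta> F" by simp
      have "\<forall>\<^sub>F k in sequentially. \<forall>i\<in>F. X.d (l i) (x (\<rho> k) i) + \<epsilon> (\<rho> k) < 1 / real (Suc j)"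
      proof (rule eventually_ball_finite[OF F(1)], intro ballI)
        fix i assume i: "i \<in> F"
        have "(\<lambda>k. X.d (l i) (x (\<rho> k) i) + \<epsilon> (\<rho> k)) \<longlonglongrightarrow> 0 + 0"
          using l'(2)[OF F(2)[OF i]] F(2)[OF i] LIMSEQ_subseq_LIMSEQ[OF \<epsilon> \<rho>]
          by (intro tendsto_add) (auto simp: l_def o_def)
        then show "\<forall>\<^sub>F k in sequentially. X.d (l i) (x (\<rho> k) i) + \<epsilon> (\<rho> k) < 1 / real (Suc j)"
          by (intro order_tendstoD(2)) auto
      qed
      then obtain N where N: "\<And>k i. k \<ge> N \<Longrightarrow> i \<in> F \<Longrightarrow> X.d (l i) (x (\<rho> k) i) + \<epsilon> (\<rho> k) < 1 / real (Suc j)"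
        unfolding eventually_sequentially by blast
      have "sum (\<alpha> (\<rho> k)) F - \<epsilon> (\<rho> k) \<le> measure X.m (V j)" if "k \<ge> N" for k
        unfolding V_def using N[OF that] lM by (intro mass F(1)) (auto intro: less_imp_le)
      then show "\<exists>N. \<forall>k\<ge>N. sum (\<alpha> (\<rho> k)) F - \<epsilon> (\<rho> k) \<le> measure X.m (V j)" by blast
    qed
    moreover have "(\<lambda>j. measure X.m (V j)) \<longlonglongrightarrow> measure X.m (\<Inter>j. V j)"
    proof (rule X.P.finite_Lim_measure_decseq)
      show "decseq V"
        unfolding decseq_Suc_iff V_def
        by (intro allI UN_mono subset_refl X.mcball_subset_concentric) (simp add: field_simps)
    qed (use Vs in auto)
    ultimately have "sum \<beta> F \<le> measure X.m (\<Inter>j. V j)" by (intro LIMSEQ_le_const) auto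
    \<comment> \<open>A point outside the finite set has positive distance from each of its
      elements, hence leaves the balls of radius 1 / (j + 1).\<close>
    also have "(\<Inter>j. V j) \<subseteq> l ` F"
    proof
      fix y assume y: "y \<in> (\<Inter>j. V j)"
      then have yM: "y \<in> X.M" by (auto simp: V_def)
      show "y \<in> l ` F"
      proof (rule ccontr)
        assume "y \<notin> l ` F"
        then have "\<forall>i\<in>F. X.d (l i) y > 0" using lM yM by auto
        then have "\<forall>\<^sub>F j in sequentially. \<forall>i\<in>F. 1 / real (Suc j) < X.d (l i) y"
          by (intro eventually_ball_finite[OF F(1)]) (use order_tendstoD(2)[OF LIMSEQ_inverse_real_of_nat] in \<open>auto simp: inverse_eq_divide\<close>)
        then obtain j where "\<forall>i\<in>F. 1 / real (Suc j) < X.d (l i) y" unfolding eventually_sequentially by blast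
        moreover have "y \<in> V j" using y by blast
        then obtain i where "i \<in> F" "X.d (l i) y \<le> 1 / real (Suc j)" unfolding V_def by auto
        ultimately show False by (meson not_le)
      qed
    qed
    then have "measure X.m (\<Inter>j. V j) \<le> measure X.m (l ` F)"
      using F(1) lM by (intro X.P.finite_measure_mono X.finite_sets) auto
    finally show "sum \<beta> F \<le> measure X.m (l ` F)" .
  qed
qed

subsection \<open>Quantization\<close>

context pm_sp
begin

text \<open>Index of the first dense point closer than e, cut off at \<open>N\<close>. The cells
  below \<open>N\<close> lie in balls of radius e; the value \<open>N\<close> is the overflow cell,
  whose mass is small for suitable \<open>N\<close>.\<close>

definition cell :: "real \<Rightarrow> nat \<Rightarrow> 'a \<Rightarrow> nat" where
  "cell e N x = min N (LEAST i. d (dense_seq i) x < e)"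

lemma cell_le: "cell e N x \<le> N"
  by (simp add: cell_def)

lemma measurable_cell [measurable]: "cell e N \<in> measurable m (count_space UNIV)"
proof -
  have [measurable]: "Measurable.pred m (\<lambda>x. d (dense_seq i) x < e)" for i by measurable
  show ?thesis unfolding cell_def by measurable
qed

lemma cell_near:
  assumes "x \<in> M" "e > 0" "cell e N x < N" shows "d (dense_seq (cell e N x)) x < e"
proof -
  have "\<exists>i. d (dense_seq i) x < e" using dense_seq_near[OF assms(1,2)] by (simp add: commute[of _ x])
  then have "d (dense_seq (LEAST i. d (dense_seq i) x < e)) x < e" by (rule LeastI_ex)
  moreover have "cell e N x = (LEAST i. d (dense_seq i) x < e)"
    using assms(3) by (simp add: cell_def min_def split: if_splits)
  ultimately show ?thesis by simp
qed

lemma cell_sets [simp]: "{x \<in> M. cell e N x = k} \<in> P.events" "{x \<in> M. cell e N x < k} \<in> P.events"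
proof -
  have "{x \<in> space m. cell e N x = k} \<in> P.events" "{x \<in> space m. cell e N x < k} \<in> P.events"
    by measurable
  then show "{x \<in> M. cell e N x = k} \<in> P.events" "{x \<in> M. cell e N x < k} \<in> P.events" by simp_all
qed

lemma ex_small_overflow_cell:
  assumes "e > 0"
  shows "\<exists>N. measure m {x \<in> M. cell e N x = N} < e"
proof -
  define A where "A N = {x \<in> M. cell e N x = N}" for N
  have eq: "A N = {x \<in> M. N \<le> (LEAST i. d (dense_seq i) x < e)}" for N
    by (auto simp: A_def cell_def min_def)
  have "(\<lambda>N. measure m (A N)) \<longlonglongrightarrow> measure m (\<Inter>N. A N)"
  proof (rule P.finite_Lim_measure_decseq)
    show "range A \<subseteq> P.events" by (auto simp: A_def)
    show "decseq A" by (auto simp: decseq_def eq)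
  qed
  moreover have "(\<Inter>N. A N) = {}"
  proof -
    have "x \<notin> A (Suc (LEAST i. d (dense_seq i) x < e))" for x by (simp add: eq)
    then show ?thesis by blast
  qed
  ultimately have "(\<lambda>N. measure m (A N)) \<longlonglongrightarrow> 0" by simp
  then have "\<forall>\<^sub>F N in sequentially. measure m (A N) < e" using assms by (rule order_tendstoD)
  then show ?thesis unfolding eventually_sequentially A_def by blast
qed

text \<open>One parameter serves both spaces, composed with q for the second. Outside the overflow
  cell q moves points by less than e, so distances change by at most 2 e.\<close>

lemma box_le_quantization:
  assumes e: "e > 0" and N: "measure m {x \<in> M. cell e N x = N} < e"
    and q: "q = (\<lambda>x. dense_seq (cell e N x))"
  shows "pm_space (X\<lparr>pm_measure := distr m m q\<rparr>)" "box_le X (X\<lparr>pm_measure := distr m m q\<rparr>) (2 * e)"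
proof -
  let ?Z = "X\<lparr>pm_measure := distr m m q\<rparr>"
  have mq: "q \<in> measurable m m"
    unfolding q by (rule measurable_compose[OF measurable_cell]) simp
  show Z: "pm_space ?Z"
    by (intro pm_space_change_measure pm_space P.prob_space_distr mq) simp
  obtain a where a: "parameter X a" using ex_parameter by blast
  have ma: "a \<in> measurable unit_lebesgue m" and da: "distr unit_lebesgue m a = m"
    using a by (simp_all add: parameter_def)
  have aM: "a t \<in> M" if "t \<in> {0..1}" for t using measurable_space[OF ma, of t] that by simp
  have b: "parameter ?Z (q \<circ> a)"
    unfolding parameter_def
  proof
    have m1: "q \<circ> a \<in> measurable unit_lebesgue m" by (rule measurable_comp[OF ma mq])
    then show "q \<circ> a \<in> measurable unit_lebesgue (pm_measure ?Z)" by simp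
    have "distr unit_lebesgue (pm_measure ?Z) (q \<circ> a) = distr unit_lebesgue m (q \<circ> a)"
      by (rule distr_cong) simp_all
    also have "\<dots> = distr (distr unit_lebesgue m a) m q" by (rule distr_distr[OF mq ma, symmetric])
    finally show "distr unit_lebesgue (pm_measure ?Z) (q \<circ> a) = pm_measure ?Z" by (simp add: da)
  qed
  define I where "I = {t\<in>{0..1}. a t \<in> {x \<in> M. cell e N x < N}}"
  have I: "I \<in> sets borel" "measure lborel I = measure m {x \<in> M. cell e N x < N}"
    unfolding I_def by (rule parameter_measure[OF a cell_sets(2)])+
  have "{x \<in> M. cell e N x < N} = space m - {x \<in> M. cell e N x = N}"
    using cell_le[of e N] by (auto simp: le_less)
  then have "measure lborel I = 1 - measure m {x \<in> M. cell e N x = N}"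
    unfolding I(2) by (simp only: P.prob_compl[OF cell_sets(1)])
  then have mI: "measure lborel I \<ge> 1 - 2 * e" using N e by linarith
  have "\<bar>d (a s) (a t) - d ((q \<circ> a) s) ((q \<circ> a) t)\<bar> \<le> 2 * e" if "s \<in> I" "t \<in> I" for s t
  proof -
    have M: "a s \<in> M" "a t \<in> M" "q (a s) \<in> M" "q (a t) \<in> M" using that by (auto simp: I_def q)
    have n: "d (q (a s)) (a s) < e" "d (q (a t)) (a t) < e"
      using that cell_near[of _ e N] e by (auto simp: I_def q)
    have "\<bar>d (a s) (a t) - d (a t) (q (a s))\<bar> \<le> d (a s) (q (a s))"
      by (rule mdist_reverse_triangle[OF M(1,2,3)])
    moreover have "\<bar>d (a t) (q (a s)) - d (q (a s)) (q (a t))\<bar> \<le> d (a t) (q (a t))"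
      by (rule mdist_reverse_triangle[OF M(2,3,4)])
    ultimately show ?thesis using n by (simp add: commute[of "a s" "q (a s)"] commute[of "a t" "q (a t)"])
  qed
  then show "box_le X ?Z (2 * e)"
    unfolding box_le_def using a b I(1) mI
    by (intro exI[of _ a] exI[of _ "q \<circ> a"] exI[of _ I]) (auto simp: I_def)
qed

end

subsection \<open>Discrete spaces\<close>

definition discrete_pm :: "real \<Rightarrow> ('i \<Rightarrow> real) \<Rightarrow> 'i pm" where
  "discrete_pm D w = \<lparr>pm_metric = metric (UNIV, \<lambda>x y. if x = y then 0 else D),
     pm_measure = density (count_space UNIV) (\<lambda>i. ennreal (w i))\<rparr>"

lemma discrete_pm_simps:
  assumes "D > 0"
  shows "mspace (pm_metric (discrete_pm D w)) = UNIV"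
    "mdist (pm_metric (discrete_pm D w)) x y = (if x = y then 0 else D)"
    "pm_measure (discrete_pm D w) = density (count_space UNIV) (\<lambda>i. ennreal (w i))"
proof -
  interpret Metric_space UNIV "\<lambda>x y :: 'a. if x = y then 0 else D"
    using assms by unfold_locales auto
  show "mspace (pm_metric (discrete_pm D w)) = UNIV"
    "mdist (pm_metric (discrete_pm D w)) x y = (if x = y then 0 else D)"
    "pm_measure (discrete_pm D w) = density (count_space UNIV) (\<lambda>i. ennreal (w i))"
    by (simp_all add: discrete_pm_def)
qed

lemma pm_space_discrete:
  fixes w :: "'i :: countable \<Rightarrow> real"
  assumes D: "D > 0" and w: "(\<integral>\<^sup>+i. ennreal (w i) \<partial>count_space UNIV) = 1"
  shows "pm_space (discrete_pm D w)"
proof -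
  interpret Metric_space UNIV "\<lambda>x y :: 'i. if x = y then 0 else D"
    using D by unfold_locales auto
  have "mcomplete"
    unfolding mcomplete_def
  proof (intro allI impI)
    fix \<sigma> assume "MCauchy \<sigma>"
    then obtain N where N: "\<And>n n'. N \<le> n \<Longrightarrow> N \<le> n' \<Longrightarrow> (if \<sigma> n = \<sigma> n' then 0 else D) < D"
      unfolding MCauchy_def using D by meson
    have eq: "\<sigma> n = \<sigma> N" if "N \<le> n" for n using N[OF that order_refl] by (simp split: if_splits)
    have "limitin mtopology \<sigma> (\<sigma> N) sequentially"
      unfolding limit_metric_sequentially
    proof (intro conjI allI impI exI[of _ N])
      fix \<epsilon> :: real and n assume "\<epsilon> > 0" "N \<le> n"
      then show "(if \<sigma> n = \<sigma> N then 0 else D) < \<epsilon>" using eq[OF \<open>N \<le> n\<close>] by simp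
    qed simp_all
    then show "\<exists>x. limitin mtopology \<sigma> x sequentially" by blast
  qed
  moreover have "separable_space mtopology"
    by (rule separable_spaceI[of UNIV]) (auto intro!: exI)
  moreover have "openin mtopology U" for U
    unfolding openin_mtopology using D by (auto intro!: exI[of _ D] simp: subset_iff split: if_splits)
  then have "sigma_sets UNIV {U. openin mtopology U} = UNIV" by (auto intro: sigma_sets.Basic)
  moreover have "prob_space (density (count_space UNIV) (\<lambda>i. ennreal (w i)))"
    using w by (intro prob_spaceI) (simp add: emeasure_density)
  ultimately show ?thesis
    unfolding pm_space_def by (simp add: discrete_pm_def)
qed

lemma nn_integral_count_space_sum:
  fixes g :: "nat + nat \<Rightarrow> ennreal"
  shows "(\<integral>\<^sup>+x. g x \<partial>count_space UNIV) = (\<Sum>i. g (Inl i)) + (\<Sum>j. g (Inr j))"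
proof -
  have part: "(\<integral>\<^sup>+x. g x * indicator (range f) x \<partial>count_space UNIV) = (\<Sum>i. g (f i))"
    if "inj f" for f :: "nat \<Rightarrow> nat + nat"
  proof -
    have "(\<integral>\<^sup>+x. g x * indicator (range f) x \<partial>count_space UNIV) = (\<integral>\<^sup>+x. g x \<partial>count_space (range f))"
      by (rule nn_integral_count_space_indicator[symmetric]) simp
    also have "\<dots> = (\<integral>\<^sup>+i. g (f i) \<partial>count_space UNIV)"
      by (rule nn_integral_bij_count_space[symmetric]) (simp add: bij_betw_def that)
    finally show ?thesis by (simp add: nn_integral_count_space_nat)
  qed
  have "(\<integral>\<^sup>+x. g x \<partial>count_space UNIV) =
      (\<integral>\<^sup>+x. g x * indicator (range Inl) x + g x * indicator (range Inr) x \<partial>count_space UNIV)"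
  proof (rule nn_integral_cong)
    fix x :: "nat + nat"
    show "g x = g x * indicator (range Inl) x + g x * indicator (range Inr) x"
      by (cases x) (auto simp: indicator_def)
  qed
  also have "\<dots> = (\<Sum>i. g (Inl i)) + (\<Sum>j. g (Inr j))"
    by (subst nn_integral_add) (simp_all add: part)
  finally show ?thesis .
qed

subsection \<open>Products of spaces with prescribed atoms\<close>

text \<open>The inequality of measures is passed from sets to functions because the product argument
  integrates the masses of slices.\<close>

lemma (in pm_sp) atoms_nn_integral_le:
  assumes f: "\<And>i. f i \<in> M"
    and le: "\<And>E. E \<in> P.events \<Longrightarrow> (\<Sum>i. ennreal (\<alpha> i) * indicator E (f i)) \<le> emeasure m E"
    and h [measurable]: "h \<in> borel_measurable m"
  shows "(\<Sum>i. ennreal (\<alpha> i) * h (f i)) \<le> (\<integral>\<^sup>+x. h x \<partial>m)"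
proof -
  let ?W = "density (count_space UNIV) (\<lambda>i. ennreal (\<alpha> i))"
  define N where "N = distr ?W m f"
  have mf: "f \<in> measurable ?W m" using f by (simp add: measurable_def)
  have "emeasure N E \<le> emeasure m E" if "E \<in> P.events" for E
  proof -
    have "emeasure N E = emeasure ?W (f -` E)"
      using mf that by (simp add: N_def emeasure_distr)
    also have "\<dots> = (\<Sum>i. ennreal (\<alpha> i) * indicator (f -` E) i)"
      by (simp add: emeasure_density nn_integral_count_space_nat)
    finally show ?thesis using le[OF that] by (simp add: indicator_vimage)
  qed
  moreover have "sets N = P.events" by (simp add: N_def)
  ultimately have "N \<le> m" using le_measure[of N m] by simp
  then have "(\<integral>\<^sup>+x. h x \<partial>N) \<le> (\<integral>\<^sup>+x. h x \<partial>m)"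
    by (intro nn_integral_mono_measure) (simp_all add: N_def)
  moreover have "(\<integral>\<^sup>+x. h x \<partial>N) = (\<Sum>i. ennreal (\<alpha> i) * h (f i))"
    using mf by (simp add: N_def nn_integral_distr nn_integral_density nn_integral_count_space_nat)
  ultimately show ?thesis by simp
qed

text \<open>Fubini in inequality form: the atoms of \<open>Y\<close> inside a slice are bounded by
  its mass, and the weighted sum of slice masses over the atoms of \<open>X\<close> is bounded by
  their integral.\<close>

lemma (in pm_pair) has_atoms_prod:
  assumes \<alpha>: "\<alpha> \<in> weights" and \<beta>: "\<beta> \<in> weights" and X: "has_atoms \<alpha> X" and Y: "has_atoms \<beta> Y"
  shows "has_atoms (weights_mult \<alpha> \<beta>) (pm_prod p X Y)"
proof -
  obtain f where f: "\<And>i. f i \<in> X.M"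
    "\<And>E. E \<in> X.P.events \<Longrightarrow> (\<Sum>i. ennreal (\<alpha> i) * indicator E (f i)) \<le> emeasure X.m E"
    using X unfolding has_atoms_def by blast
  obtain g where g: "\<And>i. g i \<in> Y.M"
    "\<And>E. E \<in> Y.P.events \<Longrightarrow> (\<Sum>i. ennreal (\<beta> i) * indicator E (g i)) \<le> emeasure Y.m E"
    using Y unfolding has_atoms_def by blast
  obtain \<sigma> where \<sigma>: "rearranges (weights_mult \<alpha> \<beta>) (\<lambda>(i, j). \<alpha> i * \<beta> j) \<sigma>"
    using ex_rearrangement_mult[OF \<alpha> \<beta>] by blast
  define F where "F k = (f (fst (\<sigma> k)), g (snd (\<sigma> k)))" for k
  have "(\<Sum>k. ennreal (weights_mult \<alpha> \<beta> k) * indicator E (F k)) \<le> emeasure (X.m \<Otimes>\<^sub>M Y.m) E"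
    if E [measurable]: "E \<in> sets (X.m \<Otimes>\<^sub>M Y.m)" for E
  proof -
    have "(\<Sum>k. ennreal (weights_mult \<alpha> \<beta> k) * indicator E (F k)) =
       (\<Sum>i. ennreal (\<alpha> i) * (\<Sum>j. ennreal (\<beta> j) * indicator (Pair (f i) -` E) (g j)))"
      using suminf_weights_mult[OF \<alpha> \<beta> \<sigma>, of "\<lambda>p. indicator E (f (fst p), g (snd p))"]
      by (simp add: F_def indicator_vimage)
    also have "\<dots> \<le> (\<Sum>i. ennreal (\<alpha> i) * emeasure Y.m (Pair (f i) -` E))"
    proof (intro suminf_le mult_left_mono)
      fix i
      have "Pair (f i) -` E \<in> Y.P.events" by (rule sets_Pair1[OF E])
      then show "(\<Sum>j. ennreal (\<beta> j) * indicator (Pair (f i) -` E) (g j)) \<le> emeasure Y.m (Pair (f i) -` E)"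
        by (rule g(2))
    qed simp_all
    also have "\<dots> \<le> (\<integral>\<^sup>+x. emeasure Y.m (Pair x -` E) \<partial>X.m)"
      by (rule X.atoms_nn_integral_le[OF f]) (auto intro: Y.P.measurable_emeasure_Pair)
    also have "\<dots> = emeasure (X.m \<Otimes>\<^sub>M Y.m) E"
      by (rule Y.P.emeasure_pair_measure_alt[OF E, symmetric])
    finally show ?thesis .
  qed
  then show ?thesis
    unfolding has_atoms_def pm_prod_simps using f(1) g(1) by (intro exI[of _ F]) (simp add: F_def)
qed

text \<open>Discrete spaces whose points are at distance at least the diameter of the (finite) target,
  so that every map out of their product is Lipschitz. The first summand of \<open>nat + nat\<close> carries the
  prescribed atoms, the second one carries the remaining mass, distributed on the cells of the
  quantization in proportion to the residual measure of \<open>Z\<close>. A point of the product is sent to the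
  atom prescribed by \<open>\<sigma>\<close> if both coordinates are atoms, and to the cell of a non-atomic coordinate
  otherwise.\<close>

lemma ex_product_above_quantization:
  fixes Z :: "'a pm"
  assumes p: "1 \<le> p" and Z: "pm_space Z" and \<alpha>: "\<alpha> \<in> weights" and \<beta>: "\<beta> \<in> weights"
    and atoms: "has_atoms (weights_mult \<alpha> \<beta>) Z" and e: "e > 0"
  shows "\<exists>(Z' :: 'a pm) (A :: (nat + nat) pm) (B :: (nat + nat) pm).
    pm_space Z' \<and> pm_space A \<and> pm_space B \<and> has_atoms \<alpha> A \<and> has_atoms \<beta> B \<and>
    pm_lipschitz_le Z' (pm_prod p A B) \<and> box_le Z Z' (2 * e)"
proof -
  interpret Z: pm_sp Z by standard fact
  let ?\<gamma> = "weights_mult \<alpha> \<beta>"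
  obtain N where N: "measure Z.m {x \<in> Z.M. Z.cell e N x = N} < e"
    using Z.ex_small_overflow_cell[OF e] by blast
  define q where "q = (\<lambda>x. Z.dense_seq (Z.cell e N x))"
  define Z' where "Z' = Z\<lparr>pm_measure := distr Z.m Z.m q\<rparr>"
  note Q = Z.box_le_quantization[OF e N q_def, folded Z'_def]
  have mq: "q \<in> measurable Z.m Z.m"
    unfolding q_def by (rule measurable_compose[OF Z.measurable_cell]) simp
  obtain f where f: "\<And>i. f i \<in> Z.M"
    "\<And>E. E \<in> Z.P.events \<Longrightarrow> (\<Sum>i. ennreal (?\<gamma> i) * indicator E (f i)) \<le> emeasure Z.m E"
    using atoms unfolding has_atoms_def by blast
  obtain \<sigma> where \<sigma>: "rearranges ?\<gamma> (\<lambda>(i, j). \<alpha> i * \<beta> j) \<sigma>"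
    using ex_rearrangement_mult[OF \<alpha> \<beta>] by blast
  obtain a where a: "a \<in> measurable unit_lebesgue Z.m"
    and aE: "\<And>E. E \<in> Z.P.events \<Longrightarrow> emeasure Z.m E =
      ennreal (1 - suminf ?\<gamma>) * emeasure lborel {u\<in>{0..1}. a u \<in> E} + (\<Sum>i. ennreal (?\<gamma> i) * indicator E (f i))"
    using ex_residual_map[OF Z weights_mult_in[OF \<alpha> \<beta>] f] by blast
  \<comment> \<open>Capping at \<open>N\<close> makes this total on all labels while keeping only
    finitely many values; labels of actual cells never exceed \<open>N\<close>.\<close>
  define zz where "zz l = Z.dense_seq (min l N)" for l
  have q_zz: "q x = zz (Z.cell e N x)" for x using Z.cell_le[of e N x] by (simp add: q_def zz_def min_absorb1)
  define g where "g u = Z.cell e N (a u)" for u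
  have mg: "g \<in> measurable unit_lebesgue (count_space UNIV)"
    unfolding g_def by (rule measurable_compose[OF a Z.measurable_cell])
  have gs: "{u\<in>{0..1}. g u = l} \<in> sets borel" for l
    using mg[unfolded measurable_unit_lebesgue_iff, THEN conjunct2, THEN bspec, of "{l}"] by simp
  \<comment> \<open>The law of the cell label under the residual map of \<open>Z\<close>; both
    discrete factors distribute their missing mass by it.\<close>
  define \<rho> where "\<rho> l = measure lborel {u\<in>{0..1}. g u = l}" for l
  have \<rho>e: "ennreal (\<rho> l) = emeasure lborel {u\<in>{0..1}. g u = l}" for l
  proof -
    have "{u\<in>{0..1}. g u = l} \<in> fmeasurable lborel" by (rule fmeasurable_subset_unit[OF gs]) blast
    then show ?thesis unfolding \<rho>_def by (rule emeasure_eq_measure2[symmetric])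
  qed
  have T: "(\<Sum>l. ennreal (\<rho> l) * indicator S l) = emeasure lborel {u\<in>{0..1}. g u \<in> S}" for S
  proof -
    have "ennreal (\<rho> l) * indicator S l = emeasure lborel {u\<in>{0..1}. g u = l \<and> l \<in> S}" for l
      by (cases "l \<in> S") (simp_all add: \<rho>e)
    then have "(\<Sum>l. ennreal (\<rho> l) * indicator S l) = (\<Sum>l. emeasure lborel {u\<in>{0..1}. g u = l \<and> l \<in> S})"
      by simp
    also have "\<dots> = emeasure lborel (\<Union>l. {u\<in>{0..1}. g u = l \<and> l \<in> S})"
    proof (rule suminf_emeasure)
      have "{u\<in>{0..1}. g u = l \<and> l \<in> S} \<in> sets lborel" for l
        using gs[of l] by (cases "l \<in> S") simp_all
      then show "range (\<lambda>l. {u\<in>{0..1}. g u = l \<and> l \<in> S}) \<subseteq> sets lborel" by blast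
      show "disjoint_family (\<lambda>l. {u\<in>{0..1}. g u = l \<and> l \<in> S})"
        unfolding disjoint_family_on_def by blast
    qed
    also have "(\<Union>l. {u\<in>{0..1}. g u = l \<and> l \<in> S}) = {u\<in>{0..1}. g u \<in> S}" by blast
    finally show ?thesis .
  qed
  have \<rho>1: "(\<Sum>l. ennreal (\<rho> l)) = 1"
  proof -
    have "{u\<in>{0..1::real}. g u \<in> UNIV} = {0..1}" by auto
    then show ?thesis using T[of UNIV] by simp
  qed
  \<comment> \<open>The sum over all pairs bounds the diameter of the quantized target; the summand
    1 keeps the distance of the discrete spaces positive when that diameter is 0.\<close>
  define R where "R = 1 + (\<Sum>i\<le>N. \<Sum>j\<le>N. Z.d (Z.dense_seq i) (Z.dense_seq j))"
  have "0 \<le> (\<Sum>i\<le>N. \<Sum>j\<le>N. Z.d (Z.dense_seq i) (Z.dense_seq j))" by (intro sum_nonneg) simp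
  then have D0: "R > 0" by (simp add: R_def)
  have DD: "Z.d (zz k) (zz l) \<le> R" for k l
  proof -
    have "Z.d (zz k) (zz l) \<le> (\<Sum>j\<le>N. Z.d (zz k) (Z.dense_seq j))"
      unfolding zz_def by (rule member_le_sum[of "min l N"]) simp_all
    also have "\<dots> \<le> (\<Sum>i\<le>N. \<Sum>j\<le>N. Z.d (Z.dense_seq i) (Z.dense_seq j))"
      unfolding zz_def by (rule member_le_sum[of "min k N"]) (simp_all add: sum_nonneg)
    finally show ?thesis by (simp add: R_def)
  qed
  define w where "w \<alpha> = case_sum \<alpha> (\<lambda>l. (1 - suminf \<alpha>) * \<rho> l)" for \<alpha> :: "nat \<Rightarrow> real"
  have int: "(\<integral>\<^sup>+x. h x \<partial>density (count_space UNIV) (\<lambda>i. ennreal (w \<alpha> i))) =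
      (\<Sum>i. ennreal (\<alpha> i) * h (Inl i)) + ennreal (1 - suminf \<alpha>) * (\<Sum>l. ennreal (\<rho> l) * h (Inr l))"
    if \<alpha>: "\<alpha> \<in> weights" for \<alpha> h
  proof -
    have "(\<integral>\<^sup>+x. h x \<partial>density (count_space UNIV) (\<lambda>i. ennreal (w \<alpha> i))) =
        (\<integral>\<^sup>+x. ennreal (w \<alpha> x) * h x \<partial>count_space UNIV)"
      by (rule nn_integral_density) simp_all
    also have "\<dots> = (\<Sum>i. ennreal (\<alpha> i) * h (Inl i)) + (\<Sum>l. ennreal (1 - suminf \<alpha>) * (ennreal (\<rho> l) * h (Inr l)))"
      using weightsD(3)[OF \<alpha>]
      by (simp add: nn_integral_count_space_sum w_def ennreal_mult \<rho>_def mult.assoc)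
    finally show ?thesis by simp
  qed
  have sum1: "ennreal (suminf \<alpha>) + ennreal (1 - suminf \<alpha>) = 1" if "\<alpha> \<in> weights" for \<alpha>
    using weightsD[OF that] suminf_nonneg[of \<alpha>] by (simp add: ennreal_plus[symmetric] del: ennreal_plus)
  have w1: "(\<integral>\<^sup>+i. ennreal (w \<alpha> i) \<partial>count_space UNIV) = 1" if \<alpha>: "\<alpha> \<in> weights" for \<alpha>
    using int[OF \<alpha>, of "\<lambda>_. 1"] sum1[OF \<alpha>]
    by (simp add: \<rho>1 suminf_ennreal_weights(1)[OF \<alpha>] emeasure_density)
  define A where "A = discrete_pm R (w \<alpha>)"
  define B where "B = discrete_pm R (w \<beta>)"
  have A: "pm_space A" and B: "pm_space B"
    unfolding A_def B_def by (intro pm_space_discrete D0 w1 \<alpha> \<beta>)+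
  interpret pm_pair A B p by unfold_locales (fact A B p)+
  have mA: "X.m = density (count_space UNIV) (\<lambda>i. ennreal (w \<alpha> i))"
    and mB: "Y.m = density (count_space UNIV) (\<lambda>i. ennreal (w \<beta> i))"
    and M: "X.M = UNIV" "Y.M = UNIV"
    and dA: "\<And>x y. X.d x y = (if x = y then 0 else R)" and dB: "\<And>x y. Y.d x y = (if x = y then 0 else R)"
    by (simp_all add: A_def B_def discrete_pm_simps[OF D0])
  have em: "emeasure (density (count_space UNIV) (\<lambda>i. ennreal (w \<alpha> i))) E =
      (\<Sum>i. ennreal (\<alpha> i) * indicator E (Inl i)) + ennreal (1 - suminf \<alpha>) * (\<Sum>l. ennreal (\<rho> l) * indicator E (Inr l))"
    if "\<alpha> \<in> weights" for \<alpha> E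
    using int[OF that, of "indicator E"] by simp
  have atoms_d: "has_atoms \<alpha> (discrete_pm R (w \<alpha>))" if "\<alpha> \<in> weights" for \<alpha>
    unfolding has_atoms_def discrete_pm_simps[OF D0]
    by (intro exI[of _ Inl]) (simp add: em[OF that])
  \<comment> \<open>The quantized position of the atom of \<open>Z\<close> that \<sigma> attaches to
    (i, j). Pairs of zero weight get some value as well, still among the points
    \<open>zz l\<close>.\<close>
  define F where "F i j = q (f (inv_into {k. ?\<gamma> k > 0} \<sigma> (i, j)))" for i j
  have F\<sigma>: "F (fst (\<sigma> k)) (snd (\<sigma> k)) = q (f k)" if "?\<gamma> k > 0" for k
    using bij_betw_imp_inj_on[OF rearrangesD(4)[OF \<sigma>]] that by (simp add: F_def inv_into_f_f)
  define \<phi> where "\<phi> = (\<lambda>(x, y). case x of Inr l \<Rightarrow> zz l | Inl i \<Rightarrow> (case y of Inr l \<Rightarrow> zz l | Inl j \<Rightarrow> F i j))"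
  have \<phi>zz: "\<exists>l. \<phi> v = zz l" for v
    by (cases v) (auto simp: \<phi>_def F_def q_zz split: sum.split)
  have push: "emeasure (X.m \<Otimes>\<^sub>M Y.m) (\<phi> -` E) = emeasure (distr Z.m Z.m q) E" if E: "E \<in> Z.P.events" for E
  proof -
    let ?a = "suminf \<alpha>" and ?b = "suminf \<beta>"
    have nn: "0 \<le> ?a" "?a \<le> 1" "0 \<le> ?b" "?b \<le> 1"
      using weightsD[OF \<alpha>] weightsD[OF \<beta>] by (auto intro: suminf_nonneg)
    define S where "S = {l. zz l \<in> E}"
    define T where "T = emeasure lborel {u\<in>{0..1}. g u \<in> S}"
    have sU: "sets (X.m \<Otimes>\<^sub>M Y.m) = UNIV"
      using sets_pair_countable[of UNIV UNIV X.m Y.m] by (simp add: mA mB)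
    have em1: "emeasure Y.m (Pair x -` (\<phi> -` E)) =
       (case x of Inl i \<Rightarrow> (\<Sum>j. ennreal (\<beta> j) * indicator E (F i j)) + ennreal (1 - ?b) * T
          | Inr l \<Rightarrow> indicator S l)" for x
    proof (cases x)
      case (Inl i)
      have "emeasure Y.m (Pair x -` (\<phi> -` E)) =
         (\<Sum>j. ennreal (\<beta> j) * indicator E (F i j)) + ennreal (1 - ?b) * (\<Sum>l. ennreal (\<rho> l) * indicator S l)"
        unfolding mB em[OF \<beta>] by (simp add: Inl \<phi>_def S_def indicator_def)
      then show ?thesis unfolding T_def T by (simp add: Inl)
    next
      case (Inr l)
      have "Pair x -` (\<phi> -` E) = (if l \<in> S then Y.M else {})"
        by (auto simp: Inr \<phi>_def S_def M)
      then show ?thesis using Y.P.emeasure_space_1 by (simp add: Inr)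
    qed
    have "emeasure (X.m \<Otimes>\<^sub>M Y.m) (\<phi> -` E) = (\<integral>\<^sup>+x. emeasure Y.m (Pair x -` (\<phi> -` E)) \<partial>X.m)"
      by (rule Y.P.emeasure_pair_measure_alt) (simp add: sU)
    also have "\<dots> = (\<Sum>i. ennreal (\<alpha> i) * ((\<Sum>j. ennreal (\<beta> j) * indicator E (F i j)) + ennreal (1 - ?b) * T)) +
        ennreal (1 - ?a) * (\<Sum>l. ennreal (\<rho> l) * indicator S l)"
      unfolding em1 unfolding mA int[OF \<alpha>] by simp
    also have "(\<Sum>l. ennreal (\<rho> l) * indicator S l) = T" by (simp only: T T_def)
    also have "(\<Sum>i. ennreal (\<alpha> i) * ((\<Sum>j. ennreal (\<beta> j) * indicator E (F i j)) + ennreal (1 - ?b) * T)) =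
        (\<Sum>i. ennreal (\<alpha> i) * (\<Sum>j. ennreal (\<beta> j) * indicator E (F i j))) + (\<Sum>i. ennreal (\<alpha> i)) * (ennreal (1 - ?b) * T)"
      unfolding distrib_left by (subst suminf_add[symmetric]) simp_all
    also have "(\<Sum>i. ennreal (\<alpha> i) * (\<Sum>j. ennreal (\<beta> j) * indicator E (F i j))) =
        (\<Sum>k. ennreal (?\<gamma> k) * indicator E (F (fst (\<sigma> k)) (snd (\<sigma> k))))"
      using suminf_weights_mult[OF \<alpha> \<beta> \<sigma>, of "\<lambda>p. indicator E (F (fst p) (snd p))"] by simp
    also have "\<dots> = (\<Sum>k. ennreal (?\<gamma> k) * indicator (q -` E \<inter> Z.M) (f k))"
    proof (rule suminf_cong)
      fix k
      show "ennreal (?\<gamma> k) * indicator E (F (fst (\<sigma> k)) (snd (\<sigma> k))) = ennreal (?\<gamma> k) * indicator (q -` E \<inter> Z.M) (f k)"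
        using F\<sigma>[of k] rearrangesD(1)[OF \<sigma>, of k] f(1)[of k]
        by (cases "?\<gamma> k > 0") (simp_all add: indicator_def)
    qed
    also have "(\<Sum>k. ennreal (?\<gamma> k) * indicator (q -` E \<inter> Z.M) (f k)) + (\<Sum>i. ennreal (\<alpha> i)) * (ennreal (1 - ?b) * T) + ennreal (1 - ?a) * T
      = ennreal (1 - suminf ?\<gamma>) * T + (\<Sum>k. ennreal (?\<gamma> k) * indicator (q -` E \<inter> Z.M) (f k))"
    proof -
      have "ennreal (suminf ?\<gamma>) = ennreal ?a * ennreal ?b"
        using suminf_weights_mult[OF \<alpha> \<beta> \<sigma>, of "\<lambda>_. 1"]
        by (simp add: suminf_ennreal_weights(1) \<alpha> \<beta> weights_mult_in)
      then have "suminf ?\<gamma> = ?a * ?b"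
        using nn weightsD[OF weights_mult_in[OF \<alpha> \<beta>]] suminf_nonneg[of ?\<gamma>]
        by (simp add: ennreal_mult[symmetric] del: ennreal_mult)
      \<comment> \<open>The pairs whose first coordinate is an atom and second is not have mass a (1
        - b), those whose first coordinate is not an atom have mass 1 - a. Together they supply
        exactly the residual mass of \<open>Z\<close>, with labels distributed by \<rho> in both
        cases.\<close>
      then have "1 - suminf ?\<gamma> = ?a * (1 - ?b) + (1 - ?a)" by (simp add: algebra_simps)
      then have "ennreal (1 - suminf ?\<gamma>) = ennreal (?a * (1 - ?b) + (1 - ?a))" by (rule arg_cong)
      also have "\<dots> = ennreal (?a * (1 - ?b)) + ennreal (1 - ?a)" using nn by (intro ennreal_plus) simp_all
      also have "ennreal (?a * (1 - ?b)) = ennreal ?a * ennreal (1 - ?b)" using nn by (intro ennreal_mult) simp_all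
      finally have "ennreal (1 - suminf ?\<gamma>) = ennreal ?a * ennreal (1 - ?b) + ennreal (1 - ?a)" .
      then show ?thesis
        by (simp add: suminf_ennreal_weights(1)[OF \<alpha>] distrib_right mult.assoc add_ac)
    qed
    also have "\<dots> = emeasure Z.m (q -` E \<inter> Z.M)"
    proof -
      have "q -` E \<inter> Z.M \<in> Z.P.events" using measurable_sets[OF mq E] by simp
      moreover have "{u\<in>{0..1}. a u \<in> q -` E \<inter> Z.M} = {u\<in>{0..1}. g u \<in> S}"
        using measurable_space[OF a] by (auto simp: g_def S_def q_zz)
      ultimately show ?thesis by (simp add: aE T_def)
    qed
    finally show ?thesis using mq E by (simp add: emeasure_distr)
  qed
  have "pm_lipschitz_le Z' (pm_prod p A B)"
    unfolding pm_lipschitz_le_iff[OF pm_space_prod Q(1)]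
  proof (intro exI[of _ \<phi>] conjI ballI)
    have zzM: "zz l \<in> Z.M" for l by (simp add: zz_def)
    show "\<phi> \<in> mspace (pm_metric (pm_prod p A B)) \<rightarrow> mspace (pm_metric Z')"
      using \<phi>zz zzM by (auto simp: Z'_def) metis
    fix v w
    show "mdist (pm_metric Z') (\<phi> v) (\<phi> w) \<le> mdist (pm_metric (pm_prod p A B)) v w"
    proof (cases "v = w")
      case True
      then show ?thesis using \<phi>zz[of w] zzM by (auto simp: Z'_def)
    next
      case False
      then have "fst v \<noteq> fst w \<or> snd v \<noteq> snd w" by (auto simp: prod_eq_iff)
      then have "R \<le> mdist (pm_metric (pm_prod p A B)) v w"
        using D_bounds(1)[of v w] D_bounds(2)[of v w] by (auto simp: pm_prod_simps dA dB)
      moreover have "mdist (pm_metric Z') (\<phi> v) (\<phi> w) \<le> R"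
        using \<phi>zz[of v] \<phi>zz[of w] DD by (auto simp: Z'_def)
      ultimately show ?thesis by linarith
    qed
  next
    fix E assume "E \<in> sets (pm_measure Z')"
    then have E: "E \<in> Z.P.events" by (simp add: Z'_def)
    have sU: "sets (X.m \<Otimes>\<^sub>M Y.m) = UNIV"
      using sets_pair_countable[of UNIV UNIV X.m Y.m] by (simp add: mA mB)
    show "mspace (pm_metric (pm_prod p A B)) \<inter> \<phi> -` E \<in> sets (pm_measure (pm_prod p A B))"
      by (simp add: pm_prod_simps sU)
    show "emeasure (pm_measure (pm_prod p A B)) (mspace (pm_metric (pm_prod p A B)) \<inter> \<phi> -` E) = emeasure (pm_measure Z') E"
      using push[OF E] by (simp add: pm_prod_simps M Z'_def)
  qed
  moreover have "has_atoms \<alpha> A" "has_atoms \<beta> B"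
    unfolding A_def B_def by (intro atoms_d \<alpha> \<beta>)+
  ultimately show ?thesis using Q A B by blast
qed

subsection \<open>Approximation along convergent weights\<close>

lemma (in pm_sp) has_atoms_distr:
  assumes \<alpha>: "\<alpha> \<in> weights" and b: "b \<in> measurable unit_lebesgue m" and f: "\<And>i. f i \<in> M"
    and bf: "\<And>i t. sum \<alpha> {..<i} \<le> t \<Longrightarrow> t < sum \<alpha> {..<Suc i} \<Longrightarrow> b t = f i"
  shows "has_atoms \<alpha> (X\<lparr>pm_measure := distr unit_lebesgue m b\<rparr>)"
  unfolding has_atoms_def
proof (intro exI[of _ f] conjI allI ballI)
  fix i show "f i \<in> mspace (pm_metric (X\<lparr>pm_measure := distr unit_lebesgue m b\<rparr>))" using f by simp
next
  fix E assume "E \<in> sets (pm_measure (X\<lparr>pm_measure := distr unit_lebesgue m b\<rparr>))"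
  then have E: "E \<in> P.events" by simp
  define s where "s i = sum \<alpha> {..<i}" for i
  define J where "J i = (if f i \<in> E then {s i..<s (Suc i)} else {})" for i
  have em: "ennreal (\<alpha> i) * indicator E (f i) = emeasure lborel (J i)" for i
    using weightsD(1)[OF \<alpha>, of i] by (simp add: J_def s_def)
  have J_piece: "piece \<alpha> t = i" if "t \<in> J i" for t i
    using that by (intro piece_eqI weightsD(1)[OF \<alpha>]) (auto simp: J_def s_def split: if_splits)
  have "(\<Sum>i. ennreal (\<alpha> i) * indicator E (f i)) = (\<Sum>i. emeasure lborel (J i))" by (simp only: em)
  also have "\<dots> = emeasure lborel (\<Union>i. J i)"
  proof (rule suminf_emeasure)
    show "disjoint_family J" unfolding disjoint_family_on_def using J_piece by blast
  qed (auto simp: J_def)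
  also have "\<dots> \<le> emeasure lborel {t\<in>{0..1}. b t \<in> E}"
  proof (rule emeasure_mono)
    show "(\<Union>i. J i) \<subseteq> {t\<in>{0..1}. b t \<in> E}"
    proof
      fix t assume "t \<in> (\<Union>i. J i)"
      then obtain i where i: "t \<in> J i" by blast
      then have st: "s i \<le> t" "t < s (Suc i)" "f i \<in> E" by (auto simp: J_def split: if_splits)
      have "0 \<le> s i" unfolding s_def by (intro sum_nonneg weightsD(1)[OF \<alpha>])
      moreover have "s (Suc i) \<le> suminf \<alpha>"
        unfolding s_def using weightsD[OF \<alpha>] by (intro sum_le_suminf) simp_all
      ultimately have "t \<in> {0..1}" using st weightsD(3)[OF \<alpha>] by simp
      then show "t \<in> {t\<in>{0..1}. b t \<in> E}" using bf[of i t] st by (simp add: s_def)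
    qed
    show "{t\<in>{0..1}. b t \<in> E} \<in> sets lborel"
      using b E unfolding measurable_unit_lebesgue_iff by simp
  qed
  also have "\<dots> = emeasure (distr unit_lebesgue m b) E"
    by (rule emeasure_distr_unit_lebesgue[OF b E, symmetric])
  finally show "(\<Sum>i. ennreal (\<alpha> i) * indicator E (f i))
      \<le> emeasure (pm_measure (X\<lparr>pm_measure := distr unit_lebesgue m b\<rparr>)) E" by simp
qed

text \<open>A parameter of the measure conditioned on \<open>Q\<close>, altered on a null set so
  that it stays in \<open>Q\<close> everywhere: the approximation argument needs the cell at every
  time, not at almost every time.\<close>

lemma (in pm_sp) ex_conditional_parameter:
  assumes Q: "Q \<in> P.events" "measure m Q > 0"
  shows "\<exists>a. a \<in> measurable unit_lebesgue m \<and> (\<forall>u\<in>{0..1}. a u \<in> Q) \<and>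
    (\<forall>E\<in>P.events. measure m Q * measure lborel {u\<in>{0..1}. a u \<in> E} = measure m (E \<inter> Q))"
proof -
  define U where "U = uniform_measure m Q"
  have em: "emeasure m Q \<noteq> 0" "emeasure m Q \<noteq> \<infinity>"
    using Q by (simp_all add: P.emeasure_eq_measure)
  have U: "pm_space (X\<lparr>pm_measure := U\<rparr>)"
    using em unfolding U_def by (intro pm_space_change_measure pm_space prob_space_uniform_measure) simp_all
  interpret U: pm_sp "X\<lparr>pm_measure := U\<rparr>" by standard fact
  have UE: "E \<in> U.P.events \<longleftrightarrow> E \<in> P.events" for E by (simp add: U_def)
  have Um: "measure U.m E = measure m (Q \<inter> E) / measure m Q" if "E \<in> P.events" for E
    using em Q that unfolding U_def by (simp add: measure_uniform_measure)
  obtain a where a: "parameter (X\<lparr>pm_measure := U\<rparr>) a" using U.ex_parameter by blast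
  have aM: "a u \<in> M" if "u \<in> {0..1}" for u
    using a that unfolding parameter_iff[OF U] by auto
  have as: "{u\<in>{0..1}. a u \<in> E} \<in> sets borel"
    "measure lborel {u\<in>{0..1}. a u \<in> E} = measure m (Q \<inter> E) / measure m Q" if "E \<in> P.events" for E
    using U.parameter_measure[OF a, of E] that Um UE by simp_all
  have Qc: "M - Q \<in> P.events" using sets.compl_sets[OF Q(1)] by simp
  have "Q \<noteq> {}" using Q(2) by auto
  then obtain q where q: "q \<in> Q" by blast
  have QM: "Q \<subseteq> M" using sets.sets_into_space[OF Q(1)] by simp
  define b where "b u = (if a u \<in> Q then a u else q)" for u
  define N where "N E = (if q \<in> E then {u\<in>{0..1}. a u \<in> M - Q} else {})" for E
  have "{u\<in>{0..1}. a u \<in> M - Q} \<in> fmeasurable lborel"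
    by (rule fmeasurable_subset_unit[OF as(1)[OF Qc]]) blast
  then have "emeasure lborel {u\<in>{0..1}. a u \<in> M - Q} = ennreal (measure m (Q \<inter> (M - Q)) / measure m Q)"
    unfolding as(2)[OF Qc, symmetric] by (rule emeasure_eq_measure2)
  moreover have "Q \<inter> (M - Q) = {}" by blast
  ultimately have "emeasure lborel {u\<in>{0..1}. a u \<in> M - Q} = 0" by (simp only: measure_empty) simp
  then have N: "N E \<in> null_sets lborel" for E
    using as(1)[OF Qc] by (simp add: N_def null_sets_def)
  have eq: "{u\<in>{0..1}. b u \<in> E} = {u\<in>{0..1}. a u \<in> Q \<inter> E} \<union> N E" for E
    using aM by (auto simp: b_def N_def)
  have QE: "Q \<inter> E \<in> P.events" if "E \<in> P.events" for E using that Q(1) by simp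
  have bs: "{u\<in>{0..1}. b u \<in> E} \<in> sets borel" if "E \<in> P.events" for E
    unfolding eq using as(1)[OF QE[OF that]] N[of E] by (auto simp: null_sets_def)
  have "measure m Q * measure lborel {u\<in>{0..1}. b u \<in> E} = measure m (E \<inter> Q)" if E: "E \<in> P.events" for E
  proof -
    have "measure lborel {u\<in>{0..1}. b u \<in> E} = measure lborel {u\<in>{0..1}. a u \<in> Q \<inter> E}"
      unfolding eq measure_def using as(1)[OF QE[OF E]] N[of E] by (simp add: emeasure_Un_null_set)
    also have "\<dots> = measure m (Q \<inter> (Q \<inter> E)) / measure m Q" by (rule as(2)[OF QE[OF E]])
    also have "Q \<inter> (Q \<inter> E) = E \<inter> Q" by blast
    finally show ?thesis using Q(2) by simp
  qed
  moreover have "b \<in> measurable unit_lebesgue m"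
    unfolding measurable_unit_lebesgue_iff using bs q QM aM by (auto simp: b_def)
  moreover have "b u \<in> Q" for u using q by (simp add: b_def)
  ultimately show ?thesis by blast
qed

text \<open>The point \<open>t\<close> has the same label in both partitions of the unit interval unless it is close to
  an endpoint. The intervals of \<open>\<alpha>'\<close> from the \<open>H\<close>-th one on have length at most \<open>1 / (H + 1)\<close> and
  inherit the label of their left endpoint.\<close>

lemma piece_labels_agree:
  fixes c \<alpha>' :: "nat \<Rightarrow> real"
  assumes c: "\<And>i. 0 \<le> c i" "c sums 1" and \<alpha>': "\<alpha>' \<in> weights" and c0: "\<And>l. l \<ge> L \<Longrightarrow> c l = 0"
    and t: "0 \<le> t" "t < 1"
    and near: "\<And>l. l \<le> H \<Longrightarrow> \<bar>sum c {..<l} - sum \<alpha>' {..<l}\<bar> \<le> \<Delta>"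
    and far1: "\<And>l. l \<le> H \<Longrightarrow> \<bar>t - sum c {..<l}\<bar> > \<Delta>"
    and far2: "\<And>l. H \<le> l \<Longrightarrow> l < L \<Longrightarrow> \<bar>t - sum c {..<l}\<bar> > 1 / real (Suc H)"
  shows "(if t < suminf \<alpha>' then if piece \<alpha>' t < H then piece \<alpha>' t else piece c (sum \<alpha>' {..<piece \<alpha>' t})
     else piece c t) = piece c t"
proof (cases "t < suminf \<alpha>'")
  case True
  define i where "i = piece \<alpha>' t"
  have i: "sum \<alpha>' {..<i} \<le> t" "t < sum \<alpha>' {..<Suc i}"
    unfolding i_def using piece_bounds[of \<alpha>' t, OF weightsD(1,2)[OF \<alpha>'] t(1) True] by auto
  show ?thesis
  proof (cases "i < H")
    case iH: True
    have "sum c {..<i} \<le> t" using near[of i] far1[of i] i(1) iH by linarith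
    moreover have "t < sum c {..<Suc i}" using near[of "Suc i"] far1[of "Suc i"] i(2) iH by linarith
    ultimately have "piece c t = i" by (intro piece_eqI c)
    then show ?thesis using iH by (simp add: i_def[symmetric])
  next
    case iH: False
    have "sum \<alpha>' {..<H} \<le> sum \<alpha>' {..<i}" using iH by (intro partial_sum_mono weightsD(1)[OF \<alpha>']) simp
    then have tH: "t > sum c {..<H}" using near[of H] far1[of H] i(1) by linarith
    define l where "l = piece c t"
    have l: "sum c {..<l} \<le> t" "t < sum c {..<Suc l}"
      unfolding l_def using piece_bounds[of c t, OF c(1)] c(2) t by (auto simp: sums_iff)
    have lH: "H \<le> l"
    proof (rule ccontr)
      assume "\<not> H \<le> l"
      then have "sum c {..<Suc l} \<le> sum c {..<H}" by (intro partial_sum_mono c) simp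
      then show False using l tH by linarith
    qed
    have "l < L" using c0[of l] l by (cases "l < L") auto
    then have tl: "t > sum c {..<l} + 1 / real (Suc H)" using far2[OF lH] l by linarith
    \<comment> \<open>The i-th interval is at most as long as the gap by which t exceeds the left
      endpoint of its c-interval, so its own left endpoint lies in the same c-interval.\<close>
    have "\<alpha>' i \<le> 1 / real (Suc i)" by (rule weights_le[OF \<alpha>'])
    also have "\<dots> \<le> 1 / real (Suc H)" using iH by (intro divide_left_mono) auto
    finally have "sum c {..<l} \<le> sum \<alpha>' {..<i}" using tl i(2) by simp
    moreover have "sum \<alpha>' {..<i} < sum c {..<Suc l}" using i(1) l(2) by linarith
    ultimately have "piece c (sum \<alpha>' {..<i}) = l" by (intro piece_eqI c)
    then show ?thesis using iH True by (simp add: i_def[symmetric] l_def)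
  qed
qed simp

lemma measure_Union_intervals_le:
  fixes s :: "nat \<Rightarrow> real"
  assumes "0 \<le> \<delta>" "finite F"
  shows "(\<Union>l\<in>F. {s l - \<delta>..s l + \<delta>}) \<in> fmeasurable lborel"
    "measure lborel (\<Union>l\<in>F. {s l - \<delta>..s l + \<delta>}) \<le> real (card F) * (2 * \<delta>)"
proof -
  show "(\<Union>l\<in>F. {s l - \<delta>..s l + \<delta>}) \<in> fmeasurable lborel"
    using assms by (intro fmeasurable.finite_UN) (auto simp: fmeasurable_def)
  have "measure lborel (\<Union>l\<in>F. {s l - \<delta>..s l + \<delta>}) \<le> (\<Sum>l\<in>F. measure lborel {s l - \<delta>..s l + \<delta>})"
    using assms by (intro measure_UNION_le) auto
  also have "\<dots> = real (card F) * (2 * \<delta>)" using assms by simp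
  finally show "measure lborel (\<Union>l\<in>F. {s l - \<delta>..s l + \<delta>}) \<le> real (card F) * (2 * \<delta>)" .
qed

text \<open>Both \<open>X\<close> and its approximation are described by labels on [0,1] that name
  cells of small diameter. Reading the labels through the intervals of \<open>\<alpha>' n\<close>
  makes the second map constant on those intervals, and the labels differ only near
  endpoints.\<close>

lemma (in pm_sp) eventually_ex_approximation:
  assumes \<alpha>: "\<alpha> \<in> weights" and \<alpha>': "\<And>n. \<alpha>' n \<in> weights" and lim: "\<And>i. (\<lambda>n. \<alpha>' n i) \<longlonglongrightarrow> \<alpha> i"
    and atoms: "has_atoms \<alpha> X" and e: "e > 0"
  shows "\<forall>\<^sub>F n in sequentially. \<exists>X' :: 'a pm. pm_space X' \<and> has_atoms (\<alpha>' n) X' \<and> box_le X X' e"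
proof -
  \<comment> \<open>Three exceptional sets of measure at most \<eta> are removed, and each of the
    two points of a distance is displaced by less than \<eta>; both totals stay below e.\<close>
  define \<eta> where "\<eta> = e / 4"
  have \<eta>: "\<eta> > 0" using e by (simp add: \<eta>_def)
  obtain K where K: "measure m {x \<in> M. cell \<eta> K x = K} < \<eta>" using ex_small_overflow_cell[OF \<eta>] by blast
  \<comment> \<open>From the H-th one on the partition of \<open>X\<close> has K + 1 endpoints,
    whose neighbourhoods have width 2 / (H + 1); this choice makes their total length less than
    \<eta>.\<close>
  obtain H where H: "1 / real (Suc H) < \<eta> / (2 * real (K + 1))"
    using nat_approx_posE[of "\<eta> / (2 * real (K + 1))"] \<eta> by auto
  obtain f where f: "\<And>i. f i \<in> M"
    "\<And>E. E \<in> P.events \<Longrightarrow> (\<Sum>i. ennreal (\<alpha> i) * indicator E (f i)) \<le> emeasure m E"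
    using atoms unfolding has_atoms_def by blast
  define Q where "Q k = {x \<in> M. cell \<eta> K x = k}" for k
  have Qs: "Q k \<in> P.events" for k unfolding Q_def by (rule cell_sets)
  define w where "w k = measure m (Q k)" for k
  have decomp: "(\<Sum>k\<le>K. measure m (E \<inter> Q k)) = measure m E" if E: "E \<in> P.events" for E
  proof -
    have "(\<Union>k\<in>{..K}. E \<inter> Q k) = E"
      using sets.sets_into_space[OF E] cell_le by (auto simp: Q_def)
    moreover have "measure m (\<Union>k\<in>{..K}. E \<inter> Q k) = (\<Sum>k\<le>K. measure m (E \<inter> Q k))"
      using E Qs by (intro P.finite_measure_finite_Union) (auto simp: disjoint_family_on_def Q_def)
    ultimately show ?thesis by simp
  qed
  have MQ: "M \<inter> Q k = Q k" for k by (auto simp: Q_def)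
  have w_sum: "(\<Sum>k\<le>K. w k) = 1"
    using decomp[of M] P.prob_space open_sets[of M] by (simp add: w_def MQ)
  \<comment> \<open>Mass of cell k that the first H atoms leave over.\<close>
  define r where "r k = w k - sum \<alpha> {i\<in>{..<H}. cell \<eta> K (f i) = k}" for k
  have load: "sum \<alpha> F \<le> w k" if "finite F" "\<And>i. i \<in> F \<Longrightarrow> f i \<in> Q k" for F k
  proof -
    have "ennreal (sum \<alpha> F) \<le> emeasure m (Q k)"
      using that weightsD(1)[OF \<alpha>] by (intro order_trans[OF atoms_le_finite f(2)[OF Qs]])
    then show ?thesis using weightsD(1)[OF \<alpha>] by (simp add: P.emeasure_eq_measure w_def sum_nonneg)
  qed
  have r: "0 \<le> r k" for k
    unfolding r_def using load[of "{i\<in>{..<H}. cell \<eta> K (f i) = k}" k] f(1) by (simp add: Q_def)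
  define L where "L = H + K + 1"
  \<comment> \<open>The first H intervals have the lengths of the first H weights, so their
    endpoints are limits of those of \<open>\<alpha>' n\<close>. The next K + 1 carry the leftovers
    of the cells 0 to K, which include the tail of the atoms.\<close>
  define c where "c l = (if l < H then \<alpha> l else if l < L then r (l - H) else 0)" for l
  define kl where "kl l = (if l < H then cell \<eta> K (f l) else l - H)" for l
  have c: "0 \<le> c l" for l using r weightsD(1)[OF \<alpha>] by (simp add: c_def)
  have c0: "c l = 0" if "l \<ge> L" for l using that by (simp add: c_def L_def)
  have klK: "kl l \<le> K" if "l < L" for l
    using that cell_le[of \<eta> K "f l"] by (auto simp: kl_def L_def)
  \<comment> \<open>Collecting the intervals by cell restores the cell masses: the atoms among the
    first H in cell k and its leftover add up to w k.\<close>
  have group: "(\<Sum>l<L. c l * h (kl l)) = (\<Sum>k\<le>K. w k * h k)" for h :: "nat \<Rightarrow> real"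
  proof -
    have part: "sum c {l\<in>{..<L}. kl l = k} = w k" if k: "k \<le> K" for k
    proof -
      have "{l\<in>{..<L}. kl l = k} = insert (H + k) {i\<in>{..<H}. cell \<eta> K (f i) = k}"
        using k by (auto simp: kl_def L_def)
      then have "sum c {l\<in>{..<L}. kl l = k} = c (H + k) + sum c {i\<in>{..<H}. cell \<eta> K (f i) = k}"
        by simp
      also have "sum c {i\<in>{..<H}. cell \<eta> K (f i) = k} = sum \<alpha> {i\<in>{..<H}. cell \<eta> K (f i) = k}"
        by (rule sum.cong) (auto simp: c_def)
      finally show ?thesis using k by (simp add: c_def L_def r_def)
    qed
    have "(\<Sum>l<L. c l * h (kl l)) = (\<Sum>k\<le>K. \<Sum>l\<in>{l\<in>{..<L}. kl l = k}. c l * h (kl l))"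
      using klK by (intro sum.group[symmetric]) auto
    also have "\<dots> = (\<Sum>k\<le>K. sum c {l\<in>{..<L}. kl l = k} * h k)"
      by (intro sum.cong refl) (simp add: sum_distrib_right)
    also have "\<dots> = (\<Sum>k\<le>K. w k * h k)" by (rule sum.cong) (simp_all only: part atMost_iff)
    finally show ?thesis .
  qed
  have c_sums: "c sums 1"
  proof -
    have "c sums (\<Sum>l<L. c l)" by (rule sums_finite) (auto simp: c0 not_less)
    then show ?thesis using group[of "\<lambda>_. 1"] w_sum by simp
  qed
  have c_pos: "w (kl l) > 0" if "c l > 0" for l
  proof (cases "l < H")
    case True
    then have "\<alpha> l \<le> w (kl l)" using load[of "{l}" "kl l"] f(1) by (simp add: kl_def Q_def)
    then show ?thesis using that True by (simp add: c_def)
  next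
    case False
    have "0 \<le> sum \<alpha> {i\<in>{..<H}. cell \<eta> K (f i) = kl l}" using weightsD(1)[OF \<alpha>] by (intro sum_nonneg)
    then have "r (kl l) \<le> w (kl l)" by (simp add: r_def)
    then show ?thesis using that False by (auto simp: c_def kl_def split: if_splits)
  qed
  define cond where "cond k a \<longleftrightarrow> a \<in> measurable unit_lebesgue m \<and> (w k > 0 \<longrightarrow> (\<forall>u\<in>{0..1}. a u \<in> Q k)) \<and>
    (\<forall>E\<in>P.events. w k * measure lborel {u\<in>{0..1}. a u \<in> E} = measure m (E \<inter> Q k))" for k a
  have "\<exists>a. cond k a" for k
  proof (cases "w k > 0")
    case True
    then show ?thesis using ex_conditional_parameter[OF Qs, of k] by (auto simp: cond_def w_def)
  next
    case False
    then have w0: "w k = 0" using measure_nonneg[of m "Q k"] by (simp add: w_def)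
    have "measure m (E \<inter> Q k) = 0" if "E \<in> P.events" for E
    proof -
      have "measure m (E \<inter> Q k) \<le> w k" unfolding w_def by (intro P.finite_measure_mono Qs) auto
      then show ?thesis using w0 measure_nonneg[of m "E \<inter> Q k"] by linarith
    qed
    then have "cond k (\<lambda>_. dense_seq 0)" by (simp add: cond_def w0)
    then show ?thesis by blast
  qed
  then have "\<exists>a. \<forall>k. cond k (a k)" by (intro choice allI)
  then obtain a where a: "\<And>k. cond k (a k)" by blast
  have am: "a k \<in> measurable unit_lebesgue m" and aQ: "w k > 0 \<Longrightarrow> u \<in> {0..1} \<Longrightarrow> a k u \<in> Q k"
    and aE: "E \<in> P.events \<Longrightarrow> w k * measure lborel {u\<in>{0..1}. a k u \<in> E} = measure m (E \<inter> Q k)" for k u E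
    using a[of k] unfolding cond_def by blast+
  have as: "{u\<in>{0..1}. a k u \<in> E} \<in> sets borel" if "E \<in> P.events" for k E
    using am[of k] that unfolding measurable_unit_lebesgue_iff by blast
  \<comment> \<open>On interval l the parameter follows the measure conditioned on the cell of that
    interval, also for l < H, where it is not kept at the atom. Only the cell matters for the
    comparison with b.\<close>
  define A where "A = glue c (\<lambda>l. a (kl l))"
  have A: "parameter X A"
    unfolding parameter_iff[OF pm_space]
  proof (intro conjI ballI)
    have "a (kl l) \<in> {0..1} \<rightarrow> M" for l using am[of "kl l"] unfolding measurable_unit_lebesgue_iff by simp
    then show "A \<in> {0..1} \<rightarrow> M"
      unfolding A_def using glue_in[of c "\<lambda>l. a (kl l)" M, OF c c_sums] by blast
    fix E assume E: "E \<in> P.events"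
    note g = glue_emeasure[of c "\<lambda>l. a (kl l)" E, OF c c_sums as[OF E], folded A_def]
    show "{t\<in>{0..1}. A t \<in> E} \<in> sets borel" by (rule g(1))
    have fm: "{u\<in>{0..1}. a k u \<in> E} \<in> fmeasurable lborel" for k
      by (rule fmeasurable_subset_unit[OF as[OF E]]) blast
    have "emeasure lborel {t\<in>{0..1}. A t \<in> E} =
        (\<Sum>l. ennreal (c l * measure lborel {u\<in>{0..1}. a (kl l) u \<in> E}))"
      unfolding g(2) by (simp only: emeasure_eq_measure2[OF fm] ennreal_mult[OF c measure_nonneg])
    also have "\<dots> = (\<Sum>l<L. ennreal (c l * measure lborel {u\<in>{0..1}. a (kl l) u \<in> E}))"
      by (rule suminf_finite) (auto simp: c0 not_less)
    also have "\<dots> = ennreal (\<Sum>l<L. c l * measure lborel {u\<in>{0..1}. a (kl l) u \<in> E})"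
      using c by (intro sum_ennreal) simp
    also have "(\<Sum>l<L. c l * measure lborel {u\<in>{0..1}. a (kl l) u \<in> E}) = measure m E"
      unfolding group[of "\<lambda>k. measure lborel {u\<in>{0..1}. a k u \<in> E}"] using decomp[OF E] aE[OF E] by simp
    finally show "emeasure lborel {t\<in>{0..1}. A t \<in> E} = emeasure m E"
      by (simp add: P.emeasure_eq_measure)
  qed
  have A_cell: "cell \<eta> K (A t) = kl (piece c t)" "A t \<in> M" if t: "0 \<le> t" "t < 1" for t
  proof -
    obtain l u where lu: "c l > 0" "sum c {..<l} \<le> t" "t < sum c {..<Suc l}" "u \<in> {0..1}" "A t = a (kl l) u"
      unfolding A_def using glue_unfold[of c t "\<lambda>l. a (kl l)", OF c c_sums t] by blast
    have "piece c t = l" by (rule piece_eqI[OF c lu(2,3)])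
    then show "cell \<eta> K (A t) = kl (piece c t)" "A t \<in> M"
      using aQ[OF c_pos[OF lu(1)] lu(4)] lu(5) by (simp_all add: Q_def)
  qed
  \<comment> \<open>There are H + 1 endpoints with index at most H, each excluded with a
    neighbourhood of width 2 \<Delta>; their total is \<eta>.\<close>
  define \<Delta> where "\<Delta> = \<eta> / (2 * real (H + 1))"
  have \<Delta>: "\<Delta> > 0" using \<eta> by (simp add: \<Delta>_def)
  have "\<forall>\<^sub>F n in sequentially. \<forall>l\<in>{..H}. \<bar>sum c {..<l} - sum (\<alpha>' n) {..<l}\<bar> < \<Delta>"
  proof (intro eventually_ball_finite ballI)
    fix l assume l: "l \<in> {..H}"
    have eq: "sum c {..<l} = sum \<alpha> {..<l}" using l by (intro sum.cong) (auto simp: c_def)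
    have "(\<lambda>n. sum (\<alpha>' n) {..<l}) \<longlonglongrightarrow> sum \<alpha> {..<l}" by (intro tendsto_sum lim)
    then have "\<forall>\<^sub>F n in sequentially. dist (sum (\<alpha>' n) {..<l}) (sum \<alpha> {..<l}) < \<Delta>"
      using \<Delta> by (rule tendstoD)
    then show "\<forall>\<^sub>F n in sequentially. \<bar>sum c {..<l} - sum (\<alpha>' n) {..<l}\<bar> < \<Delta>"
      by (rule eventually_mono) (simp add: eq dist_real_def abs_minus_commute)
  qed simp
  then show ?thesis
  proof (rule eventually_mono)
    fix n assume near: "\<forall>l\<in>{..H}. \<bar>sum c {..<l} - sum (\<alpha>' n) {..<l}\<bar> < \<Delta>"
    let ?\<beta> = "\<alpha>' n"
    \<comment> \<open>Position of the i-th atom of the approximating space: the centre of the cell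
      of the i-th interval for i < H, and of the cell met at its left endpoint otherwise.\<close>
    define F where "F i = dense_seq (kl (if i < H then i else piece c (sum ?\<beta> {..<i})))" for i
    \<comment> \<open>Times beyond the total of \<open>\<alpha>' n\<close> carry no prescribed atom
      and keep their old label.\<close>
    define lab where "lab t = (if t < suminf ?\<beta> then if piece ?\<beta> t < H then piece ?\<beta> t else piece c (sum ?\<beta> {..<piece ?\<beta> t})
       else piece c t)" for t
    have lab_m: "lab \<in> measurable borel (count_space UNIV)"
    proof -
      have [measurable]: "(\<lambda>t. piece c (sum ?\<beta> {..<piece ?\<beta> t})) \<in> measurable borel (count_space UNIV)"
        by (rule measurable_compose[OF measurable_piece[of ?\<beta>], of "\<lambda>i. piece c (sum ?\<beta> {..<i})"]) simp
      show ?thesis unfolding lab_def by measurable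
    qed
    define b where "b t = dense_seq (kl (lab t))" for t
    have "b \<in> measurable borel m"
      unfolding b_def by (rule measurable_compose[OF lab_m]) simp
    then have bm: "b \<in> measurable unit_lebesgue m"
      unfolding unit_lebesgue_def by (intro measurable_restrict_space1) (simp add: measurable_def)
    define X' where "X' = X\<lparr>pm_measure := distr unit_lebesgue m b\<rparr>"
    have X': "pm_space X'"
      unfolding X'_def
      by (intro pm_space_change_measure pm_space prob_space.prob_space_distr[OF prob_space_unit_lebesgue] bm) simp
    have atoms': "has_atoms ?\<beta> X'"
      unfolding X'_def
    proof (rule has_atoms_distr[OF \<alpha>' bm])
      show "F i \<in> M" for i by (simp add: F_def)
      fix i t assume t: "sum ?\<beta> {..<i} \<le> t" "t < sum ?\<beta> {..<Suc i}"
      have "piece ?\<beta> t = i" by (rule piece_eqI[OF weightsD(1)[OF \<alpha>'] t])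
      moreover have "sum ?\<beta> {..<Suc i} \<le> suminf ?\<beta>"
        using weightsD[OF \<alpha>'[of n]] by (intro sum_le_suminf) simp_all
      ultimately show "b t = F i" using t by (simp add: b_def lab_def F_def)
    qed
    have b_par: "parameter X' b"
      unfolding parameter_def X'_def using bm by (auto intro: distr_cong)
    define B1 where "B1 = (\<Union>l\<in>{..H}. {sum c {..<l} - \<Delta>..sum c {..<l} + \<Delta>})"
    define B2 where "B2 = (\<Union>l\<in>{H..<L}. {sum c {..<l} - 1 / real (Suc H)..sum c {..<l} + 1 / real (Suc H)})"
    define G where "G = {t\<in>{0..1}. A t \<in> Q K}"
    have B1: "B1 \<in> fmeasurable lborel" "measure lborel B1 \<le> \<eta>"
    proof -
      show "B1 \<in> fmeasurable lborel" unfolding B1_def using \<Delta> by (intro measure_Union_intervals_le(1)) auto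
      have "measure lborel B1 \<le> real (card {..H}) * (2 * \<Delta>)"
        unfolding B1_def using \<Delta> by (intro measure_Union_intervals_le(2)) auto
      also have "\<dots> = 2 * real (H + 1) * (\<eta> / (2 * real (H + 1)))" by (simp only: \<Delta>_def card_atMost Suc_eq_plus1 mult_ac)
      also have "\<dots> = \<eta>" by simp
      finally show "measure lborel B1 \<le> \<eta>" .
    qed
    have B2: "B2 \<in> fmeasurable lborel" "measure lborel B2 \<le> \<eta>"
    proof -
      show "B2 \<in> fmeasurable lborel" unfolding B2_def by (rule measure_Union_intervals_le(1)) auto
      have "measure lborel B2 \<le> real (card {H..<L}) * (2 * (1 / real (Suc H)))"
        unfolding B2_def by (rule measure_Union_intervals_le(2)) auto
      also have "\<dots> = 2 * real (K + 1) * (1 / real (Suc H))" by (simp add: L_def)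
      also have "\<dots> \<le> 2 * real (K + 1) * (\<eta> / (2 * real (K + 1)))" using H by (intro mult_left_mono) auto
      finally show "measure lborel B2 \<le> \<eta>" by simp
    qed
    have Gb: "G \<in> sets borel" "measure lborel G = w K"
      unfolding G_def w_def by (rule parameter_measure[OF A Qs])+
    have Gfm: "G \<in> fmeasurable lborel" by (rule fmeasurable_subset_unit[OF Gb(1)]) (auto simp: G_def)
    have wK: "w K < \<eta>" using K by (simp add: w_def Q_def)
    define I where "I = {0..<1} - (B1 \<union> B2 \<union> G)"
    have I: "I \<in> sets borel" "I \<subseteq> {0..1}"
      using B1(1) B2(1) Gb(1) by (auto simp: I_def fmeasurable_def)
    have mI: "measure lborel I \<ge> 1 - e"
    proof -
      have "1 = measure lborel {0..<1::real}" by simp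
      also have "\<dots> \<le> measure lborel (I \<union> (B1 \<union> B2 \<union> G))"
      proof (rule measure_mono_fmeasurable)
        show "I \<union> (B1 \<union> B2 \<union> G) \<in> fmeasurable lborel"
          by (intro fmeasurable.Un fmeasurable_subset_unit[OF I] B1(1) B2(1) Gfm)
      qed (auto simp: I_def)
      also have "\<dots> \<le> measure lborel I + measure lborel (B1 \<union> B2 \<union> G)"
        using I B1(1) B2(1) Gb by (intro measure_Un_le) (auto simp: fmeasurable_def)
      also have "measure lborel (B1 \<union> B2 \<union> G) \<le> measure lborel (B1 \<union> B2) + measure lborel G"
        using B1(1) B2(1) Gb by (intro measure_Un_le) (auto simp: fmeasurable_def)
      also have "measure lborel (B1 \<union> B2) \<le> measure lborel B1 + measure lborel B2"
        using B1(1) B2(1) by (intro measure_Un_le) (auto simp: fmeasurable_def)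
      finally have "1 \<le> measure lborel I + (\<eta> + \<eta> + \<eta>)" using B1(2) B2(2) Gb(2) wK by simp
      then show ?thesis using \<eta> by (simp add: \<eta>_def)
    qed
    have close: "d (A t) (b t) < \<eta>" "A t \<in> M" "b t \<in> M" if t: "t \<in> I" for t
    proof -
      have t01: "0 \<le> t" "t < 1" and tB: "t \<notin> B1" "t \<notin> B2" "t \<notin> G" using t by (auto simp: I_def)
      have lab: "lab t = piece c t"
        unfolding lab_def
      proof (rule piece_labels_agree[of c ?\<beta> L t H \<Delta>, OF c c_sums \<alpha>' c0 t01])
        fix l assume "l \<le> H"
        then show "\<bar>sum c {..<l} - sum ?\<beta> {..<l}\<bar> \<le> \<Delta>" using near by (auto intro: less_imp_le)
        show "\<Delta> < \<bar>t - sum c {..<l}\<bar>" using tB(1) \<open>l \<le> H\<close> by (force simp: B1_def)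
      next
        fix l assume "H \<le> l" "l < L"
        then show "1 / real (Suc H) < \<bar>t - sum c {..<l}\<bar>" using tB(2) by (force simp: B2_def)
      qed
      have "cell \<eta> K (A t) \<noteq> K" using tB(3) t01 A_cell(2)[OF t01] by (simp add: G_def Q_def)
      then have "cell \<eta> K (A t) < K" using cell_le[of \<eta> K "A t"] by simp
      then have "d (dense_seq (cell \<eta> K (A t))) (A t) < \<eta>" by (rule cell_near[OF A_cell(2)[OF t01] \<eta>])
      then show "d (A t) (b t) < \<eta>"
        unfolding b_def lab A_cell(1)[OF t01] by (simp only: commute)
      show "A t \<in> M" "b t \<in> M" using A_cell(2)[OF t01] by (simp_all add: b_def)
    qed
    have "\<bar>d (A s) (A t) - d (b s) (b t)\<bar> \<le> e" if s: "s \<in> I" and t: "t \<in> I" for s t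
    proof -
      note S = close[OF s] and T = close[OF t]
      have "\<bar>d (A s) (A t) - d (A t) (b s)\<bar> \<le> d (A s) (b s)"
        by (rule mdist_reverse_triangle[OF S(2) T(2) S(3)])
      moreover have "\<bar>d (A t) (b s) - d (b s) (b t)\<bar> \<le> d (A t) (b t)"
        by (rule mdist_reverse_triangle[OF T(2) S(3) T(3)])
      ultimately show ?thesis using S(1) T(1) \<eta> by (simp add: \<eta>_def)
    qed
    then have "box_le X X' e"
      unfolding box_le_def using A b_par I mI
      by (intro exI[of _ A] exI[of _ b] exI[of _ I]) (simp add: X'_def)
    then show "\<exists>X' :: 'a pm. pm_space X' \<and> has_atoms ?\<beta> X' \<and> box_le X X' e"
      using X' atoms' by blast
  qed
qed

subsection \<open>The sets of classes with prescribed atoms are pyramids\<close>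

lemma pm_lipschitz_leI:
  assumes "\<phi> \<in> measurable (pm_measure X) (pm_measure Y)" "pm_space X" "pm_space Y"
    "\<And>x x'. x \<in> mspace (pm_metric X) \<Longrightarrow> x' \<in> mspace (pm_metric X) \<Longrightarrow>
        mdist (pm_metric Y) (\<phi> x) (\<phi> x') \<le> mdist (pm_metric X) x x'"
    "distr (pm_measure X) (pm_measure Y) \<phi> = pm_measure Y"
  shows "pm_lipschitz_le Y X"
proof -
  interpret X: pm_sp X by standard fact
  interpret Y: pm_sp Y by standard fact
  have "\<phi> \<in> X.M \<rightarrow> Y.M" using measurable_space[OF assms(1)] by simp
  then show ?thesis using assms unfolding pm_lipschitz_le_def by blast
qed

lemma pm_lipschitz_leE:
  assumes X: "pm_space X" and Y: "pm_space Y" and le: "pm_lipschitz_le Y X"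
  obtains \<phi> where "\<phi> \<in> measurable (pm_measure X) (pm_measure Y)"
    "\<And>x x'. x \<in> mspace (pm_metric X) \<Longrightarrow> x' \<in> mspace (pm_metric X) \<Longrightarrow>
        mdist (pm_metric Y) (\<phi> x) (\<phi> x') \<le> mdist (pm_metric X) x x'"
    "distr (pm_measure X) (pm_measure Y) \<phi> = pm_measure Y"
proof -
  interpret X: pm_sp X by standard fact
  interpret Y: pm_sp Y by standard fact
  obtain \<phi> where \<phi>: "\<phi> \<in> X.M \<rightarrow> Y.M" "\<And>x x'. x \<in> X.M \<Longrightarrow> x' \<in> X.M \<Longrightarrow> Y.d (\<phi> x) (\<phi> x') \<le> X.d x x'"
    "\<And>B. B \<in> Y.P.events \<Longrightarrow> X.M \<inter> \<phi> -` B \<in> X.P.events"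
    "\<And>B. B \<in> Y.P.events \<Longrightarrow> emeasure X.m (X.M \<inter> \<phi> -` B) = emeasure Y.m B"
    using le unfolding pm_lipschitz_le_iff[OF X Y] by blast
  have m: "\<phi> \<in> measurable X.m Y.m"
    using \<phi>(1,3) by (simp add: measurable_def Int_commute)
  have "distr X.m Y.m \<phi> = Y.m"
    by (rule measure_eqI) (simp_all add: emeasure_distr m Int_commute \<phi>(4))
  then show thesis using that m \<phi>(2) by blast
qed

lemma pm_lipschitz_le_refl: "pm_space X \<Longrightarrow> pm_lipschitz_le X X"
  by (rule pm_lipschitz_leI[of id]) (simp_all add: distr_id2 id_def)

lemma pm_lipschitz_le_trans:
  assumes X: "pm_space X" and Y: "pm_space Y" and Z: "pm_space Z"
    and XY: "pm_lipschitz_le X Y" and YZ: "pm_lipschitz_le Y Z"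
  shows "pm_lipschitz_le X Z"
proof -
  interpret Y: pm_sp Y by standard fact
  interpret Z: pm_sp Z by standard fact
  obtain \<phi> where \<phi>: "\<phi> \<in> measurable Y.m (pm_measure X)"
    "\<And>x x'. x \<in> Y.M \<Longrightarrow> x' \<in> Y.M \<Longrightarrow> mdist (pm_metric X) (\<phi> x) (\<phi> x') \<le> Y.d x x'"
    "distr Y.m (pm_measure X) \<phi> = pm_measure X"
    using pm_lipschitz_leE[OF Y X XY] by blast
  obtain \<psi> where \<psi>: "\<psi> \<in> measurable Z.m Y.m"
    "\<And>x x'. x \<in> Z.M \<Longrightarrow> x' \<in> Z.M \<Longrightarrow> Y.d (\<psi> x) (\<psi> x') \<le> Z.d x x'"
    "distr Z.m Y.m \<psi> = Y.m"
    using pm_lipschitz_leE[OF Z Y YZ] by blast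
  show ?thesis
  proof (rule pm_lipschitz_leI[OF measurable_comp[OF \<psi>(1) \<phi>(1)] Z X])
    fix x x' assume x: "x \<in> Z.M" "x' \<in> Z.M"
    then have "\<psi> x \<in> Y.M" "\<psi> x' \<in> Y.M" using measurable_space[OF \<psi>(1)] by simp_all
    then show "mdist (pm_metric X) ((\<phi> \<circ> \<psi>) x) ((\<phi> \<circ> \<psi>) x') \<le> Z.d x x'"
      using \<phi>(2)[of "\<psi> x" "\<psi> x'"] \<psi>(2)[OF x] by simp
  next
    show "distr Z.m (pm_measure X) (\<phi> \<circ> \<psi>) = pm_measure X"
      using distr_distr[OF \<phi>(1) \<psi>(1)] \<psi>(3) \<phi>(3) by simp
  qed
qed

lemma pm_lipschitz_le_prod:
  assumes p: "1 \<le> p" and A: "pm_space A" and B: "pm_space B" and A': "pm_space A'" and B': "pm_space B'"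
    and leA: "pm_lipschitz_le A A'" and leB: "pm_lipschitz_le B B'"
  shows "pm_lipschitz_le (pm_prod p A B) (pm_prod p A' B')"
proof -
  interpret U: pm_pair A B p by unfold_locales (fact A B p)+
  interpret V: pm_pair A' B' p by unfold_locales (fact A' B' p)+
  obtain f where f: "f \<in> measurable V.X.m U.X.m"
    "\<And>x x'. x \<in> V.X.M \<Longrightarrow> x' \<in> V.X.M \<Longrightarrow> U.X.d (f x) (f x') \<le> V.X.d x x'" "distr V.X.m U.X.m f = U.X.m"
    using pm_lipschitz_leE[OF A' A leA] by blast
  obtain g where g: "g \<in> measurable V.Y.m U.Y.m"
    "\<And>x x'. x \<in> V.Y.M \<Longrightarrow> x' \<in> V.Y.M \<Longrightarrow> U.Y.d (g x) (g x') \<le> V.Y.d x x'" "distr V.Y.m U.Y.m g = U.Y.m"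
    using pm_lipschitz_leE[OF B' B leB] by blast
  note [measurable] = f(1) g(1)
  show ?thesis
  proof (rule pm_lipschitz_leI[of "\<lambda>(x, y). (f x, g y)"], unfold U.pm_prod_simps V.pm_prod_simps)
    show "(\<lambda>(x, y). (f x, g y)) \<in> measurable (V.X.m \<Otimes>\<^sub>M V.Y.m) (U.X.m \<Otimes>\<^sub>M U.Y.m)" by measurable
    show "U.D (case v of (x, y) \<Rightarrow> (f x, g y)) (case w of (x, y) \<Rightarrow> (f x, g y)) \<le> V.D v w"
      if "v \<in> V.X.M \<times> V.Y.M" "w \<in> V.X.M \<times> V.Y.M" for v w
      using that f(2) g(2) by (auto simp: U.D_def V.D_def lp_prod_dist_def intro!: lp_norm2_mono[OF p])
    show "distr (V.X.m \<Otimes>\<^sub>M V.Y.m) (U.X.m \<Otimes>\<^sub>M U.Y.m) (\<lambda>(x, y). (f x, g y)) = U.X.m \<Otimes>\<^sub>M U.Y.m"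
      using pair_measure_distr[OF f(1) g(1)] f(3) g(3) U.Y.P.sigma_finite_measure_axioms by simp
  qed (fact U.pm_space_prod V.pm_space_prod)+
qed

lemma lipschitz_le_pm_class:
  fixes X :: "'a pm" and Y :: "'b pm" and \<iota> :: "'a \<Rightarrow> real" and \<kappa> :: "'b \<Rightarrow> real"
  assumes X: "pm_space X" and Y: "pm_space Y" and inj: "inj \<iota>" "inj \<kappa>" and le: "pm_lipschitz_le Y X"
  shows "lipschitz_le (pm_class Y) (pm_class X)"
proof -
  obtain f where f: "pm_isometry (pm_rep (pm_class X)) X f" using pm_class_props(3)[OF X inj(1)] by blast
  obtain g where g: "pm_isometry Y (pm_rep (pm_class Y)) g" using pm_class_props(2)[OF Y inj(2)] by blast
  note RX = pm_rep_props[OF pm_class_props(1)[OF X inj(1)]] and RY = pm_rep_props[OF pm_class_props(1)[OF Y inj(2)]]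
  show ?thesis
    unfolding lipschitz_le_def by (rule pm_lipschitz_le_isometry[OF X Y RX(1) RY(1) RX(2) le f g])
qed

lemma box_dist_pm_class_le:
  fixes Y :: "'b pm" and \<kappa> :: "'b \<Rightarrow> real"
  assumes Y: "pm_space Y" and inj: "inj \<kappa>" and le: "box_le (pm_rep A) Y \<epsilon>" and \<epsilon>: "\<epsilon> > 0"
  shows "box_dist A (pm_class Y) \<le> \<epsilon>"
proof -
  obtain g where g: "pm_isometry Y (pm_rep (pm_class Y)) g" using pm_class_props(2)[OF Y inj] by blast
  note RY = pm_rep_props[OF pm_class_props(1)[OF Y inj]]
  show ?thesis
    unfolding box_dist_def by (rule pm_box_le[OF box_le_isometry[OF Y RY(1) g le] \<epsilon>])
qed

text \<open>With constant weights this is closedness under the box distance; with varying weights it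
  yields the second condition of weak convergence.\<close>

lemma atom_pyramid_limit:
  assumes A: "A \<in> pm_classes" and \<alpha>: "\<And>k. \<alpha> k \<in> weights" and lim: "\<And>i. (\<lambda>k. \<alpha> k i) \<longlonglongrightarrow> \<beta> i"
    and B: "\<And>k. B k \<in> atom_pyramid (\<alpha> k)" and close: "\<And>k. box_dist A (B k) < 1 / real (Suc k)"
  shows "A \<in> atom_pyramid \<beta>"
proof -
  note R = pm_rep_props(1)[OF A]
  have Bk: "pm_space (pm_rep (B k))" "has_atoms (\<alpha> k) (pm_rep (B k))" for k
    using B[of k] pm_rep_props(1) by (simp_all add: atom_pyramid_iff)
  have "\<exists>\<epsilon>. 0 < \<epsilon> \<and> \<epsilon> < 1 / real (Suc k) \<and> box_le (pm_rep A) (pm_rep (B k)) \<epsilon>" for k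
    by (rule box_le_of_pm_box[OF R Bk(1) close[unfolded box_dist_def]])
  then have "\<exists>\<epsilon>. \<forall>k. 0 < \<epsilon> k \<and> \<epsilon> k < 1 / real (Suc k) \<and> box_le (pm_rep A) (pm_rep (B k)) (\<epsilon> k)"
    by (intro choice allI)
  then obtain \<epsilon> where \<epsilon>: "\<And>k. 0 < \<epsilon> k" "\<And>k. \<epsilon> k < 1 / real (Suc k)"
    "\<And>k. box_le (pm_rep A) (pm_rep (B k)) (\<epsilon> k)" by blast
  have "(\<lambda>k. 1 / real (Suc k)) \<longlonglongrightarrow> 0" using LIMSEQ_inverse_real_of_nat by (simp add: inverse_eq_divide)
  then have "\<epsilon> \<longlonglongrightarrow> 0"
    by (rule tendsto_sandwich[OF _ _ tendsto_const, rotated 2]) (use \<epsilon> in \<open>auto intro!: always_eventually less_imp_le\<close>)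
  then have "has_atoms \<beta> (pm_rep A)"
    by (rule has_atoms_limit[OF R Bk(1) weightsD(1)[OF \<alpha>] lim Bk(2) \<epsilon>(3)])
  then show ?thesis using A by (simp add: atom_pyramid_iff)
qed

lemma atom_pyramid_box_closed:
  assumes \<alpha>: "\<alpha> \<in> weights" and A: "A \<in> box_closure (atom_pyramid \<alpha>)"
  shows "A \<in> atom_pyramid \<alpha>"
proof -
  have "\<exists>B. B \<in> atom_pyramid \<alpha> \<and> box_dist A B < 1 / real (Suc k)" for k
  proof -
    have "1 / real (Suc k) > 0" by simp
    then show ?thesis using A unfolding box_closure_def by blast
  qed
  then have "\<exists>B. \<forall>k. B k \<in> atom_pyramid \<alpha> \<and> box_dist A (B k) < 1 / real (Suc k)" by (intro choice allI)
  then obtain B where B: "\<And>k. B k \<in> atom_pyramid \<alpha>" "\<And>k. box_dist A (B k) < 1 / real (Suc k)" by blast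
  have "A \<in> pm_classes" using A by (simp add: box_closure_def)
  from atom_pyramid_limit[of A "\<lambda>_. \<alpha>", OF this \<alpha> tendsto_const B] show ?thesis .
qed

text \<open>In a one-point space all atoms pile up, which is allowed because the weights sum to at
  most 1. This provides non-emptiness of the pyramids.\<close>

lemma ex_has_atoms:
  assumes \<alpha>: "\<alpha> \<in> weights"
  shows "\<exists>X :: unit pm. pm_space X \<and> has_atoms \<alpha> X"
proof -
  define X where "X = discrete_pm 1 (\<lambda>_ :: unit. 1)"
  have X: "pm_space X" unfolding X_def by (rule pm_space_discrete) (simp_all add: nn_integral_count_space_finite)
  have "(\<Sum>i. ennreal (\<alpha> i) * indicator E ()) \<le> emeasure (pm_measure X) E" for E
  proof (cases "() \<in> E")
    case True
    then have "E = UNIV" by auto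
    then show ?thesis
      using suminf_ennreal_weights(2)[OF \<alpha>] by (simp add: X_def discrete_pm_simps emeasure_density nn_integral_count_space_finite)
  qed simp
  then have "has_atoms \<alpha> X"
    unfolding has_atoms_def by (intro exI[of _ "\<lambda>_. ()"]) (simp add: X_def discrete_pm_simps)
  then show ?thesis using X by blast
qed

lemma pyramid_atom_pyramid:
  assumes \<alpha>: "\<alpha> \<in> weights"
  shows "pyramid (atom_pyramid \<alpha>)"
  unfolding pyramid_def
proof (intro conjI ballI impI)
  show sub: "atom_pyramid \<alpha> \<subseteq> pm_classes" by (auto simp: atom_pyramid_iff)
  obtain X :: "unit pm" where X: "pm_space X" "has_atoms \<alpha> X" using ex_has_atoms[OF \<alpha>] by blast
  have inj: "inj (\<lambda>_ :: unit. 0 :: real)" by (simp add: inj_on_def)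
  have "pm_class X \<in> atom_pyramid \<alpha>"
    using pm_class_in_atom_pyramid[where \<alpha> = \<alpha>, OF X(1) inj weightsD(1)[OF \<alpha>]] X(2) by blast
  then show "atom_pyramid \<alpha> \<noteq> {}" by blast
  show "box_closure (atom_pyramid \<alpha>) = atom_pyramid \<alpha>"
  proof (intro equalityI subsetI)
    fix A assume A: "A \<in> atom_pyramid \<alpha>"
    then have Ac: "A \<in> pm_classes" using sub by blast
    obtain a where a: "parameter (pm_rep A) a"
      using pm_sp.ex_parameter[of "pm_rep A"] pm_rep_props(1)[OF Ac] by (auto simp: pm_sp_def)
    have "box_dist A A < \<epsilon>" if "\<epsilon> > 0" for \<epsilon>
    proof -
      have "box_le (pm_rep A) (pm_rep A) (\<epsilon> / 2)"
        unfolding box_le_def using a that by (intro exI[of _ a] exI[of _ "{0..1}"]) simp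
      then have "box_dist A A \<le> \<epsilon> / 2" unfolding box_dist_def using that by (intro pm_box_le) simp_all
      then show ?thesis using that by simp
    qed
    then show "A \<in> box_closure (atom_pyramid \<alpha>)" using A Ac by (auto simp: box_closure_def)
  qed (rule atom_pyramid_box_closed[OF \<alpha>])
next
  fix A B assume "A \<in> atom_pyramid \<alpha>" "B \<in> pm_classes" "lipschitz_le B A"
  then show "B \<in> atom_pyramid \<alpha>"
    unfolding atom_pyramid_iff lipschitz_le_def
    using has_atoms_lipschitz[where \<alpha> = \<alpha>, OF pm_rep_props(1)[of A] pm_rep_props(1)[of B] _ _ weightsD(1)[OF \<alpha>]] by blast
next
  fix A B assume AB: "A \<in> atom_pyramid \<alpha>" "B \<in> atom_pyramid \<alpha>"
  then have A: "A \<in> pm_classes" "has_atoms \<alpha> (pm_rep A)" and B: "B \<in> pm_classes" "has_atoms \<alpha> (pm_rep B)"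
    by (simp_all add: atom_pyramid_iff)
  obtain Z :: "(real \<times> real) pm" where Z: "pm_space Z" "has_atoms \<alpha> Z"
    "pm_lipschitz_le (pm_rep A) Z" "pm_lipschitz_le (pm_rep B) Z"
    using ex_common_bound[OF pm_rep_props(1)[OF A(1)] pm_rep_props(1)[OF B(1)] \<alpha> A(2) B(2)] by blast
  obtain \<iota> :: "real \<times> real \<Rightarrow> real" where \<iota>: "inj \<iota>" using inj_real_pair by blast
  have "lipschitz_le A (pm_class Z)" "lipschitz_le B (pm_class Z)"
    using lipschitz_le_pm_class[OF Z(1) pm_rep_props(1)[OF A(1)] \<iota> inj_on_id Z(3)] pm_rep_props(3)[OF A(1)]
      lipschitz_le_pm_class[OF Z(1) pm_rep_props(1)[OF B(1)] \<iota> inj_on_id Z(4)] pm_rep_props(3)[OF B(1)] by simp_all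
  moreover have "pm_class Z \<in> atom_pyramid \<alpha>"
    using pm_class_in_atom_pyramid[where \<alpha> = \<alpha>, OF Z(1) \<iota> weightsD(1)[OF \<alpha>]] Z(2) by blast
  ultimately show "\<exists>C\<in>atom_pyramid \<alpha>. lipschitz_le A C \<and> lipschitz_le B C" by blast
qed

subsection \<open>Products of pyramids\<close>

lemma prod_class_props:
  assumes p: "1 \<le> p" and A: "A \<in> pm_classes" and B: "B \<in> pm_classes"
  shows "pm_space (pm_prod p (pm_rep A) (pm_rep B))" "prod_class p A B \<in> pm_classes"
proof -
  interpret pm_pair "pm_rep A" "pm_rep B" p
    by unfold_locales (fact pm_rep_props(1)[OF A] pm_rep_props(1)[OF B] p)+
  obtain \<iota> :: "real \<times> real \<Rightarrow> real" where \<iota>: "inj \<iota>" using inj_real_pair by blast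
  show P: "pm_space (pm_prod p (pm_rep A) (pm_rep B))" by (rule pm_space_prod)
  show "prod_class p A B \<in> pm_classes"
    unfolding prod_class_def by (rule pm_class_props(1)[OF P \<iota>])
qed

lemma pyramid_of_prod_class_subset:
  assumes p: "1 \<le> p" and \<alpha>: "\<alpha> \<in> weights" and \<beta>: "\<beta> \<in> weights"
    and A: "A \<in> atom_pyramid \<alpha>" and B: "B \<in> atom_pyramid \<beta>"
  shows "pyramid_of (prod_class p A B) \<subseteq> atom_pyramid (weights_mult \<alpha> \<beta>)"
proof
  fix C assume C: "C \<in> pyramid_of (prod_class p A B)"
  have A': "A \<in> pm_classes" "has_atoms \<alpha> (pm_rep A)" and B': "B \<in> pm_classes" "has_atoms \<beta> (pm_rep B)"
    using A B by (simp_all add: atom_pyramid_iff)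
  interpret pm_pair "pm_rep A" "pm_rep B" p
    by unfold_locales (fact pm_rep_props(1)[OF A'(1)] pm_rep_props(1)[OF B'(1)] p)+
  obtain \<iota> :: "real \<times> real \<Rightarrow> real" where \<iota>: "inj \<iota>" using inj_real_pair by blast
  note w = weights_mult_in[OF \<alpha> \<beta>]
  have "prod_class p A B \<in> atom_pyramid (weights_mult \<alpha> \<beta>)"
    unfolding prod_class_def
    using pm_class_in_atom_pyramid[where \<alpha> = "weights_mult \<alpha> \<beta>", OF pm_space_prod \<iota> weightsD(1)[OF w]] has_atoms_prod[OF \<alpha> \<beta> A'(2) B'(2)] by blast
  then show "C \<in> atom_pyramid (weights_mult \<alpha> \<beta>)"
    using C pyramid_atom_pyramid[OF w] unfolding pyramid_def pyramid_of_def by blast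
qed

lemma pyramid_prod_atom_pyramid:
  assumes p: "1 \<le> p" and \<alpha>: "\<alpha> \<in> weights" and \<beta>: "\<beta> \<in> weights"
  shows "pyramid_prod p (atom_pyramid \<alpha>) (atom_pyramid \<beta>) = atom_pyramid (weights_mult \<alpha> \<beta>)"
proof (intro equalityI subsetI)
  note w = weights_mult_in[OF \<alpha> \<beta>]
  fix C assume C: "C \<in> pyramid_prod p (atom_pyramid \<alpha>) (atom_pyramid \<beta>)"
  have "(\<Union>A\<in>atom_pyramid \<alpha>. \<Union>B\<in>atom_pyramid \<beta>. pyramid_of (prod_class p A B)) \<subseteq> atom_pyramid (weights_mult \<alpha> \<beta>)"
    using pyramid_of_prod_class_subset[OF p \<alpha> \<beta>] by blast
  then have "C \<in> box_closure (atom_pyramid (weights_mult \<alpha> \<beta>))"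
    using C unfolding pyramid_prod_def box_closure_def by blast
  then show "C \<in> atom_pyramid (weights_mult \<alpha> \<beta>)" by (rule atom_pyramid_box_closed[OF w])
next
  fix C assume "C \<in> atom_pyramid (weights_mult \<alpha> \<beta>)"
  then have C: "C \<in> pm_classes" "has_atoms (weights_mult \<alpha> \<beta>) (pm_rep C)" by (simp_all add: atom_pyramid_iff)
  note R = pm_rep_props[OF C(1)]
  have "\<exists>C'\<in>(\<Union>A\<in>atom_pyramid \<alpha>. \<Union>B\<in>atom_pyramid \<beta>. pyramid_of (prod_class p A B)). box_dist C C' < \<epsilon>"
    if \<epsilon>: "\<epsilon> > 0" for \<epsilon>
  proof -
    have "\<epsilon> / 4 > 0" using \<epsilon> by simp
    then obtain Z' :: "real pm" and A B :: "(nat + nat) pm" where Z': "pm_space Z'" and AB: "pm_space A" "pm_space B"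
      and at: "has_atoms \<alpha> A" "has_atoms \<beta> B" and le: "pm_lipschitz_le Z' (pm_prod p A B)"
      and box: "box_le (pm_rep C) Z' (2 * (\<epsilon> / 4))"
      using ex_product_above_quantization[OF p R(1) \<alpha> \<beta> C(2)] by blast
    define \<iota> :: "nat + nat \<Rightarrow> real" where "\<iota> x = real (to_nat x)" for x
    have \<iota>: "inj \<iota>" by (simp add: \<iota>_def inj_on_def)
    obtain \<kappa> :: "real \<times> real \<Rightarrow> real" where \<kappa>: "inj \<kappa>" using inj_real_pair by blast
    have cA: "pm_class A \<in> atom_pyramid \<alpha>" and cB: "pm_class B \<in> atom_pyramid \<beta>"
      using pm_class_in_atom_pyramid[where \<alpha> = \<alpha>, OF AB(1) \<iota> weightsD(1)[OF \<alpha>]]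
        pm_class_in_atom_pyramid[where \<alpha> = \<beta>, OF AB(2) \<iota> weightsD(1)[OF \<beta>]] at by blast+
    have clA: "pm_class A \<in> pm_classes" and clB: "pm_class B \<in> pm_classes"
      using cA cB by (simp_all add: atom_pyramid_iff)
    note RA = pm_rep_props[OF clA] and RB = pm_rep_props[OF clB]
    \<comment> \<open>Some weights may vanish, so \<open>A\<close> may fail to have full support.
      Its representative has full support and is mapped onto the support of \<open>A\<close>, which
      is the direction needed here.\<close>
    have leA: "pm_lipschitz_le A (pm_rep (pm_class A))"
      using pm_lipschitz_le_isometry[OF AB(1) AB(1) RA(1) AB(1) RA(2) pm_lipschitz_le_refl[OF AB(1)] _ pm_isometry_id[OF AB(1)]]
        pm_class_props(3)[OF AB(1) \<iota>] by blast
    have leB: "pm_lipschitz_le B (pm_rep (pm_class B))"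
      using pm_lipschitz_le_isometry[OF AB(2) AB(2) RB(1) AB(2) RB(2) pm_lipschitz_le_refl[OF AB(2)] _ pm_isometry_id[OF AB(2)]]
        pm_class_props(3)[OF AB(2) \<iota>] by blast
    interpret pm_pair A B p by unfold_locales (fact AB p)+
    note prod = prod_class_props[OF p clA clB]
    have "pm_lipschitz_le Z' (pm_prod p (pm_rep (pm_class A)) (pm_rep (pm_class B)))"
      by (rule pm_lipschitz_le_trans[OF Z' pm_space_prod prod(1) le
            pm_lipschitz_le_prod[OF p AB RA(1) RB(1) leA leB]])
    then have "lipschitz_le (pm_class Z') (prod_class p (pm_class A) (pm_class B))"
      unfolding prod_class_def by (rule lipschitz_le_pm_class[OF prod(1) Z' \<kappa> inj_on_id])
    then have "pm_class Z' \<in> pyramid_of (prod_class p (pm_class A) (pm_class B))"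
      using pm_class_props(1)[OF Z' inj_on_id] by (simp add: pyramid_of_def)
    moreover have "box_dist C (pm_class Z') \<le> 2 * (\<epsilon> / 4)"
      using \<epsilon> by (intro box_dist_pm_class_le[OF Z' inj_on_id box]) simp
    then have "box_dist C (pm_class Z') < \<epsilon>" using \<epsilon> by simp
    ultimately show ?thesis using cA cB by blast
  qed
  then show "C \<in> pyramid_prod p (atom_pyramid \<alpha>) (atom_pyramid \<beta>)"
    using C(1) unfolding pyramid_prod_def box_closure_def by blast
qed

subsection \<open>Recovering the weights\<close>

text \<open>Adding the elements in increasing order, the next one is at least the number of elements
  before it, so its weight is at most the weight at that position.\<close>

lemma sum_le_initial:
  fixes \<alpha> :: "nat \<Rightarrow> real"
  assumes mono: "\<And>i j. i \<le> j \<Longrightarrow> \<alpha> j \<le> \<alpha> i" and fin: "finite G"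
  shows "sum \<alpha> G \<le> sum \<alpha> {..<card G}"
  using fin
proof (induction G rule: finite_linorder_max_induct)
  case (insert b A)
  have "card A \<le> b" using insert(2) card_mono[of "{..<b}" A] by (auto simp: subset_iff)
  moreover have "b \<notin> A" using insert(2) by auto
  ultimately show ?case using insert(1,3) mono[of "card A" b] by simp
qed simp

text \<open>The missing mass is spread over [0,1] by Lebesgue measure, which charges no finite set,
  and the atoms sit at the distinct points 2, 3, 4 and so on. Hence k points carry at most the k
  largest weights.\<close>

lemma ex_space_with_exact_atoms:
  assumes \<alpha>: "\<alpha> \<in> weights"
  shows "\<exists>X :: real pm. pm_space X \<and> has_atoms \<alpha> X \<and>
    (\<forall>F. finite F \<longrightarrow> F \<subseteq> mspace (pm_metric X) \<longrightarrow> emeasure (pm_measure X) F \<le> ennreal (sum \<alpha> {..<card F}))"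
proof -
  define f :: "nat \<Rightarrow> real" where "f i = real i + 2" for i
  have id: "(\<lambda>u. u) \<in> measurable unit_lebesgue (borel :: real measure)"
    unfolding measurable_unit_lebesgue_iff by (auto simp: Collect_conj_eq)
  define H where "H = glue (case_nat (1 - suminf \<alpha>) \<alpha>) (case_nat (\<lambda>u. u) (\<lambda>i _. f i))"
  define N where "N = distr unit_lebesgue borel H"
  note H = glue_atoms(1)[where f = f, OF \<alpha> id, folded H_def, simplified]
  have HE: "emeasure N E = ennreal (1 - suminf \<alpha>) * emeasure lborel {u\<in>{0..1}. u \<in> E} + (\<Sum>i. ennreal (\<alpha> i) * indicator E (f i))"
    if "E \<in> sets borel" for E
    unfolding N_def H_def using that by (intro glue_atoms(2)[OF \<alpha> id]) simp_all
  define X :: "real pm" where "X = \<lparr>pm_metric = euclidean_metric, pm_measure = N\<rparr>"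
  have sN: "sets N = sets borel" "space N = UNIV" by (simp_all add: N_def)
  have "pm_space X"
    unfolding pm_space_def X_def
  proof (simp add: sN, intro conjI)
    show "mcomplete_of (euclidean_metric :: real metric)"
      using complete_UNIV by (simp add: mcomplete_of_def)
    show "separable_space (euclidean :: real topology)"
    proof -
      obtain C :: "real set" where C: "countable C" "\<And>S. open S \<Longrightarrow> S \<noteq> {} \<Longrightarrow> \<exists>c\<in>C. c \<in> S"
        using countable_dense_exists by metis
      have "separable_space (Met_TC.mtopology :: real topology)"
      proof (rule Met_TC.separable_spaceI[OF C(1)])
        fix x e :: real assume "e > 0"
        then show "\<exists>c\<in>C. dist x c < e" using C(2)[of "ball x e"] by auto
      qed simp
      then show ?thesis by simp
    qed
    show "prob_space N" unfolding N_def by (rule prob_space.prob_space_distr[OF prob_space_unit_lebesgue H])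
    show "sets borel = sigma_sets UNIV {U :: real set. open U}" by (simp add: borel_def)
  qed
  moreover have "has_atoms \<alpha> X"
    unfolding has_atoms_def by (intro exI[of _ f]) (simp add: X_def sN HE)
  moreover have "emeasure N F \<le> ennreal (sum \<alpha> {..<card F})" if F: "finite F" for F
  proof -
    define G where "G = {i. f i \<in> F}"
    have inj: "inj_on f G" by (simp add: f_def inj_on_def)
    have img: "f ` G \<subseteq> F" by (auto simp: G_def)
    have G: "finite G" "card G \<le> card F"
      using finite_imageD[OF finite_subset[OF img F] inj] card_inj_on_le[OF inj img F] by simp_all
    have "emeasure lborel {u\<in>{0..1}. u \<in> F} = 0"
      using F by (intro emeasure_lborel_countable countable_finite) simp
    moreover have "F \<in> sets borel" using F by (intro borel_closed finite_imp_closed)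
    ultimately have "emeasure N F = (\<Sum>i. ennreal (\<alpha> i) * indicator F (f i))" by (simp add: HE)
    also have "\<dots> = (\<Sum>i\<in>G. ennreal (\<alpha> i) * indicator F (f i))"
      using G by (intro suminf_finite) (auto simp: G_def)
    also have "\<dots> = (\<Sum>i\<in>G. ennreal (\<alpha> i))" by (intro sum.cong) (auto simp: G_def)
    also have "\<dots> = ennreal (sum \<alpha> G)" using weightsD(1)[OF \<alpha>] by (simp add: sum_ennreal)
    also have "sum \<alpha> G \<le> sum \<alpha> {..<card G}" by (rule sum_le_initial[OF weightsD(5)[OF \<alpha>] G(1)])
    also have "\<dots> \<le> sum \<alpha> {..<card F}" by (rule partial_sum_mono[OF weightsD(1)[OF \<alpha>] G(2)])
    finally show ?thesis by (simp add: ennreal_leI)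
  qed
  ultimately show ?thesis by (intro exI[of _ X]) (simp add: X_def)
qed

text \<open>In the extremal space for \<alpha>, the positions of the first k atoms prescribed by
  \<beta> form at most k points. Their mass is at least the sum for \<beta> and at most the sum for
  \<alpha>.\<close>

lemma partial_sums_le_of_subset:
  assumes \<alpha>: "\<alpha> \<in> weights" and \<beta>: "\<beta> \<in> weights" and sub: "atom_pyramid \<alpha> \<subseteq> atom_pyramid \<beta>"
  shows "sum \<beta> {..<k} \<le> sum \<alpha> {..<k}"
proof -
  obtain X :: "real pm" where X: "pm_space X" "has_atoms \<alpha> X"
    and max: "\<And>F. finite F \<Longrightarrow> F \<subseteq> mspace (pm_metric X) \<Longrightarrow> emeasure (pm_measure X) F \<le> ennreal (sum \<alpha> {..<card F})"
    using ex_space_with_exact_atoms[OF \<alpha>] by blast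
  interpret X: pm_sp X by standard fact
  have "pm_class X \<in> atom_pyramid \<beta>"
    using pm_class_in_atom_pyramid[where \<alpha> = \<alpha>, OF X(1) inj_on_id weightsD(1)[OF \<alpha>]] X(2) sub by blast
  then have "has_atoms \<beta> X"
    using pm_class_in_atom_pyramid[where \<alpha> = \<beta>, OF X(1) inj_on_id weightsD(1)[OF \<beta>]] by blast
  then obtain f where f: "\<And>i. f i \<in> X.M"
    "\<And>E. E \<in> X.P.events \<Longrightarrow> (\<Sum>i. ennreal (\<beta> i) * indicator E (f i)) \<le> emeasure X.m E"
    unfolding has_atoms_def by blast
  let ?F = "f ` {..<k}"
  have F: "finite ?F" "?F \<subseteq> X.M" "card ?F \<le> k" using f card_image_le[of "{..<k}" f] by auto
  have "ennreal (sum \<beta> {..<k}) \<le> (\<Sum>i. ennreal (\<beta> i) * indicator ?F (f i))"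
    using weightsD(1)[OF \<beta>] by (intro atoms_le_finite) simp_all
  also have "\<dots> \<le> emeasure X.m ?F" by (rule f(2)[OF X.finite_sets[OF F(1,2)]])
  also have "\<dots> \<le> ennreal (sum \<alpha> {..<card ?F})" by (rule max[OF F(1,2)])
  also have "\<dots> \<le> ennreal (sum \<alpha> {..<k})"
    by (intro ennreal_leI partial_sum_mono weightsD(1)[OF \<alpha>] F(3))
  finally show ?thesis using weightsD(1)[OF \<alpha>] by (simp add: sum_nonneg)
qed

lemma inj_on_atom_pyramid: "inj_on atom_pyramid weights"
proof (rule inj_onI)
  fix \<alpha> \<beta> assume \<alpha>: "\<alpha> \<in> weights" and \<beta>: "\<beta> \<in> weights" and eq: "atom_pyramid \<alpha> = atom_pyramid \<beta>"
  have sums: "sum \<alpha> {..<k} = sum \<beta> {..<k}" for k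
    using partial_sums_le_of_subset[OF \<alpha> \<beta>, of k] partial_sums_le_of_subset[OF \<beta> \<alpha>, of k] eq by simp
  show "\<alpha> = \<beta>"
  proof
    fix k show "\<alpha> k = \<beta> k" using sums[of k] sums[of "Suc k"] by simp
  qed
qed

subsection \<open>Weak convergence\<close>

text \<open>Choosing \<open>B n\<close> within 1 / (n + 1) of the infimum gives one sequence that
  works for all e at once.\<close>

lemma ex_sequence_tendsto_zero:
  fixes h :: "'b \<Rightarrow> real"
  assumes ne: "\<And>n. S n \<noteq> {}" and nn: "\<And>n b. b \<in> S n \<Longrightarrow> 0 \<le> h b"
    and small: "\<And>e. e > 0 \<Longrightarrow> \<forall>\<^sub>F n in sequentially. \<exists>b\<in>S n. h b < e"
  shows "\<exists>B. (\<forall>n :: nat. B n \<in> S n) \<and> (\<lambda>n. h (B n)) \<longlonglongrightarrow> 0"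
proof -
  have "\<exists>b. b \<in> S n \<and> h b < Inf (h ` S n) + 1 / real (Suc n)" for n
    using cInf_lessD[of "h ` S n" "Inf (h ` S n) + 1 / real (Suc n)"] ne[of n] by auto
  then have "\<exists>B. \<forall>n. B n \<in> S n \<and> h (B n) < Inf (h ` S n) + 1 / real (Suc n)" by (intro choice allI)
  then obtain B where B: "\<And>n. B n \<in> S n" "\<And>n. h (B n) < Inf (h ` S n) + 1 / real (Suc n)" by blast
  have "(\<lambda>n. h (B n)) \<longlonglongrightarrow> 0"
  proof (rule tendstoI)
    fix e :: real assume e: "e > 0"
    have "(\<lambda>n. 1 / real (Suc n)) \<longlonglongrightarrow> 0" using LIMSEQ_inverse_real_of_nat by (simp add: inverse_eq_divide)
    then have "\<forall>\<^sub>F n in sequentially. 1 / real (Suc n) < e / 2" by (rule order_tendstoD(2)) (rule half_gt_zero[OF e])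
    moreover have "\<forall>\<^sub>F n in sequentially. \<exists>b\<in>S n. h b < e / 2" using e by (intro small) simp
    ultimately show "\<forall>\<^sub>F n in sequentially. dist (h (B n)) 0 < e"
    proof eventually_elim
      case (elim n)
      then obtain b where b: "b \<in> S n" "h b < e / 2" by blast
      have "Inf (h ` S n) \<le> h b" using b(1) nn by (intro cInf_lower bdd_belowI[of _ 0]) auto
      then have "h (B n) < e" using b(2) B(2)[of n] elim by linarith
      then show ?case using nn[OF B(1)] by simp
    qed
  qed
  then show ?thesis using B(1) by blast
qed

lemma box_dist_nonneg: "A \<in> pm_classes \<Longrightarrow> B \<in> pm_classes \<Longrightarrow> 0 \<le> box_dist A B"
  unfolding box_dist_def by (intro pm_box_nonneg pm_rep_props)

lemma weakly_converges_atom_pyramid: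
  assumes \<alpha>: "\<alpha> \<in> weights" and \<alpha>': "\<And>n. \<alpha>' n \<in> weights" and lim: "\<And>i. (\<lambda>n. \<alpha>' n i) \<longlonglongrightarrow> \<alpha> i"
  shows "weakly_converges (\<lambda>n. atom_pyramid (\<alpha>' n)) (atom_pyramid \<alpha>)"
  unfolding weakly_converges_def
proof (intro conjI ballI)
  fix A assume "A \<in> atom_pyramid \<alpha>"
  then have A: "A \<in> pm_classes" "has_atoms \<alpha> (pm_rep A)" by (simp_all add: atom_pyramid_iff)
  interpret R: pm_sp "pm_rep A" by standard (rule pm_rep_props(1)[OF A(1)])
  show "\<exists>B. (\<forall>n. B n \<in> atom_pyramid (\<alpha>' n)) \<and> (\<lambda>n. box_dist A (B n)) \<longlonglongrightarrow> 0"
  proof (rule ex_sequence_tendsto_zero)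
    show "atom_pyramid (\<alpha>' n) \<noteq> {}" for n using pyramid_atom_pyramid[OF \<alpha>'] unfolding pyramid_def by blast
    show "0 \<le> box_dist A B" if "B \<in> atom_pyramid (\<alpha>' n)" for n B
      using that A(1) by (intro box_dist_nonneg) (simp_all add: atom_pyramid_iff)
    fix e :: real assume "e > 0"
    then have e: "e / 2 > 0" by simp
    show "\<forall>\<^sub>F n in sequentially. \<exists>B\<in>atom_pyramid (\<alpha>' n). box_dist A B < e"
    proof (rule eventually_mono[OF R.eventually_ex_approximation[OF \<alpha> \<alpha>' lim A(2) e]])
      fix n assume "\<exists>X' :: real pm. pm_space X' \<and> has_atoms (\<alpha>' n) X' \<and> box_le (pm_rep A) X' (e / 2)"
      then obtain X' :: "real pm" where X': "pm_space X'" "has_atoms (\<alpha>' n) X'" "box_le (pm_rep A) X' (e / 2)" by blast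
      have "pm_class X' \<in> atom_pyramid (\<alpha>' n)"
        using pm_class_in_atom_pyramid[where \<alpha> = "\<alpha>' n", OF X'(1) inj_on_id weightsD(1)[OF \<alpha>']] X'(2) by blast
      moreover have "box_dist A (pm_class X') \<le> e / 2" by (rule box_dist_pm_class_le[OF X'(1) inj_on_id X'(3) e])
      then have "box_dist A (pm_class X') < e" using e by simp
      ultimately show "\<exists>B\<in>atom_pyramid (\<alpha>' n). box_dist A B < e" by blast
    qed
  qed
next
  fix A assume A: "A \<in> pm_classes - atom_pyramid \<alpha>"
  define u where "u n = (INF B\<in>atom_pyramid (\<alpha>' n). ereal (box_dist A B))" for n
  show "liminf (\<lambda>n. INF B\<in>atom_pyramid (\<alpha>' n). ereal (box_dist A B)) > 0"
  proof (rule ccontr)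
    assume "\<not> ?thesis"
    then have le: "liminf u \<le> 0" unfolding u_def[abs_def] by (simp only: not_less)
    \<comment> \<open>The chosen indices n may repeat; k \<le> n is enough for them to tend to
      infinity, so the weights still converge along them.\<close>
    have "\<exists>n B. k \<le> n \<and> B \<in> atom_pyramid (\<alpha>' n) \<and> box_dist A B < 1 / real (Suc k)" for k
    proof (rule ccontr)
      assume no: "\<not> ?thesis"
      have "\<forall>\<^sub>F n in sequentially. ereal (1 / real (Suc k)) \<le> u n"
        unfolding eventually_sequentially u_def using no by (intro exI[of _ k]) (auto intro!: INF_greatest simp: not_less)
      then have "ereal (1 / real (Suc k)) \<le> liminf u" by (rule Liminf_bounded)
      then have "ereal (1 / real (Suc k)) \<le> 0" using le by (rule order_trans)
      then show False by simp
    qed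
    then have "\<exists>q. k \<le> fst q \<and> snd q \<in> atom_pyramid (\<alpha>' (fst q)) \<and> box_dist A (snd q) < 1 / real (Suc k)" for k
      by simp
    then have "\<exists>q. \<forall>k. k \<le> fst (q k) \<and> snd (q k) \<in> atom_pyramid (\<alpha>' (fst (q k))) \<and> box_dist A (snd (q k)) < 1 / real (Suc k)"
      by (intro choice[of "\<lambda>k q. k \<le> fst q \<and> snd q \<in> atom_pyramid (\<alpha>' (fst q)) \<and> box_dist A (snd q) < 1 / real (Suc k)"] allI)
    then obtain q where q: "\<And>k. k \<le> fst (q k)" "\<And>k. snd (q k) \<in> atom_pyramid (\<alpha>' (fst (q k)))"
      "\<And>k. box_dist A (snd (q k)) < 1 / real (Suc k)" by blast
    have "filterlim (\<lambda>k. fst (q k)) sequentially sequentially"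
      by (rule filterlim_at_top_mono[OF filterlim_ident]) (use q(1) in simp)
    then have "(\<lambda>k. \<alpha>' (fst (q k)) i) \<longlonglongrightarrow> \<alpha> i" for i by (rule filterlim_compose[OF lim])
    then have "A \<in> atom_pyramid \<alpha>"
      using A by (intro atom_pyramid_limit[of A "\<lambda>k. \<alpha>' (fst (q k))" \<alpha> "\<lambda>k. snd (q k)"] \<alpha>' q) simp_all
    then show False using A by simp
  qed
qed

text \<open>A member of \<open>P\<close> is approximated from the sets \<open>S n\<close>, while
  non-members of \<open>Q\<close> stay away from them. Applied in both directions this is uniqueness
  of weak limits.\<close>

lemma weakly_converges_subset:
  assumes P: "weakly_converges S P" and Q: "weakly_converges S Q" and sub: "P \<subseteq> pm_classes"
  shows "P \<subseteq> Q"
proof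
  fix A assume A: "A \<in> P"
  show "A \<in> Q"
  proof (rule ccontr)
    assume "A \<notin> Q"
    then have pos: "liminf (\<lambda>n. INF B\<in>S n. ereal (box_dist A B)) > 0"
      using Q A sub unfolding weakly_converges_def by blast
    obtain B where B: "\<And>n. B n \<in> S n" "(\<lambda>n. box_dist A (B n)) \<longlonglongrightarrow> 0"
      using P A unfolding weakly_converges_def by blast
    have "liminf (\<lambda>n. INF B\<in>S n. ereal (box_dist A B)) \<le> liminf (\<lambda>n. ereal (box_dist A (B n)))"
      using B(1) by (intro Liminf_mono always_eventually allI INF_lower)
    also have "\<dots> = ereal 0" using B(2) by (intro lim_imp_Liminf) simp_all
    finally have "0 < ereal 0" by (rule less_le_trans[OF pos])
    then show False by simp
  qed
qed

lemma weakly_converges_subseq: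
  assumes S: "weakly_converges S P" and r: "strict_mono r"
  shows "weakly_converges (S \<circ> r) P"
  unfolding weakly_converges_def
proof (intro conjI ballI)
  fix A assume "A \<in> P"
  then obtain B where B: "\<And>n. B n \<in> S n" "(\<lambda>n. box_dist A (B n)) \<longlonglongrightarrow> 0"
    using S unfolding weakly_converges_def by blast
  have "(\<lambda>n. box_dist A ((B \<circ> r) n)) \<longlonglongrightarrow> 0"
    using LIMSEQ_subseq_LIMSEQ[OF B(2) r] by (simp add: o_def)
  then show "\<exists>B. (\<forall>n. B n \<in> (S \<circ> r) n) \<and> (\<lambda>n. box_dist A (B n)) \<longlonglongrightarrow> 0"
    using B(1) by (intro exI[of _ "B \<circ> r"]) simp
next
  fix A assume "A \<in> pm_classes - P"
  then have "0 < liminf (\<lambda>n. INF B\<in>S n. ereal (box_dist A B))" using S unfolding weakly_converges_def by blast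
  also have "\<dots> \<le> liminf ((\<lambda>n. INF B\<in>S n. ereal (box_dist A B)) \<circ> r)" by (rule liminf_subseq_mono[OF r])
  finally show "0 < liminf (\<lambda>n. INF B\<in>(S \<circ> r) n. ereal (box_dist A B))" by (simp add: o_def)
qed

subsection \<open>The topology of the weights\<close>

definition weights_dist :: "(nat \<Rightarrow> real) \<Rightarrow> (nat \<Rightarrow> real) \<Rightarrow> real" where
  "weights_dist = mdist (funspace UNIV euclidean_metric)"

lemma weights_in_funspace: "weights \<subseteq> mspace (funspace UNIV euclidean_metric)"
proof
  fix \<alpha> assume \<alpha>: "\<alpha> \<in> weights"
  have "bounded (range \<alpha>)"
    using weightsD(1)[OF \<alpha>] weights_le_1[OF \<alpha>] by (intro boundedI[of _ 1]) auto
  then show "\<alpha> \<in> mspace (funspace UNIV euclidean_metric)"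
    by (simp add: Met_TC.fspace_def)
qed

lemma weights_dist_le:
  assumes "\<alpha> \<in> weights" "\<beta> \<in> weights" "\<And>i. \<bar>\<alpha> i - \<beta> i\<bar> \<le> e"
  shows "weights_dist \<alpha> \<beta> \<le> e"
proof -
  have "(SUP i. dist (\<alpha> i) (\<beta> i)) \<le> e" using assms(3) by (intro cSUP_least) (auto simp: dist_real_def)
  then show ?thesis using weights_in_funspace assms(1,2) by (auto simp: weights_dist_def Met_TC.fdist_def)
qed

lemma le_weights_dist:
  assumes "\<alpha> \<in> weights" "\<beta> \<in> weights" shows "\<bar>\<alpha> i - \<beta> i\<bar> \<le> weights_dist \<alpha> \<beta>"
proof -
  have F: "\<alpha> \<in> Met_TC.fspace UNIV" "\<beta> \<in> Met_TC.fspace UNIV" using weights_in_funspace assms by auto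
  have "dist (\<alpha> i) (\<beta> i) \<le> (SUP i. dist (\<alpha> i) (\<beta> i))"
    by (rule cSUP_upper[OF _ Met_TC.bdd_above_dist[OF F]]) simp_all
  then show ?thesis using F by (simp add: weights_dist_def Met_TC.fdist_def dist_real_def)
qed

interpretation W: Metric_space weights weights_dist
  unfolding weights_dist_def by (rule Metric_space.subspace[OF Metric_space_mspace_mdist weights_in_funspace])

lemma weights_topology_eq: "weights_topology = W.mtopology"
proof -
  interpret F: Metric_space "mspace (funspace UNIV (euclidean_metric :: real metric))" weights_dist
    unfolding weights_dist_def by (rule Metric_space_mspace_mdist)
  interpret Submetric "mspace (funspace UNIV (euclidean_metric :: real metric))" weights_dist weights
    by standard (rule weights_in_funspace)
  show ?thesis
    unfolding weights_topology_def mtopology_of_def weights_dist_def[symmetric] by (rule mtopology_submetric[symmetric])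
qed

text \<open>Since \<open>\<alpha> i \<le> 1 / (i + 1)\<close>, pointwise and uniform convergence of weights agree.\<close>

lemma limitin_weights_iff:
  assumes x: "\<And>n. x n \<in> weights" and l: "l \<in> weights"
  shows "limitin W.mtopology x l sequentially \<longleftrightarrow> (\<forall>i. (\<lambda>n. x n i) \<longlonglongrightarrow> l i)"
proof
  assume lim: "limitin W.mtopology x l sequentially"
  show "\<forall>i. (\<lambda>n. x n i) \<longlonglongrightarrow> l i"
  proof
    fix i
    show "(\<lambda>n. x n i) \<longlonglongrightarrow> l i"
    proof (rule tendstoI)
      fix e :: real assume "e > 0"
      then have "\<forall>\<^sub>F n in sequentially. x n \<in> weights \<and> weights_dist (x n) l < e"
        using lim unfolding W.limitin_metric by blast
      then show "\<forall>\<^sub>F n in sequentially. dist (x n i) (l i) < e"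
        by (rule eventually_mono) (use le_weights_dist[OF x l, of _ i] in \<open>auto simp: dist_real_def intro: le_less_trans\<close>)
    qed
  qed
next
  assume pt: "\<forall>i. (\<lambda>n. x n i) \<longlonglongrightarrow> l i"
  show "limitin W.mtopology x l sequentially"
    unfolding W.limitin_metric
  proof (intro conjI allI impI l)
    fix e :: real assume e: "e > 0"
    then obtain N where N: "1 / real (Suc N) < e / 2" using nat_approx_posE[of "e / 2"] by auto
    have "\<forall>\<^sub>F n in sequentially. \<forall>i\<in>{..N}. dist (x n i) (l i) < e / 2"
      using pt e by (intro eventually_ball_finite ballI tendstoD[of _ _ sequentially]) simp_all
    then show "\<forall>\<^sub>F n in sequentially. x n \<in> weights \<and> weights_dist (x n) l < e"
    proof (rule eventually_mono)
      fix n assume n: "\<forall>i\<in>{..N}. dist (x n i) (l i) < e / 2"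
      have "\<bar>x n i - l i\<bar> \<le> e / 2" for i
      proof (cases "i \<le> N")
        case True
        then show ?thesis using n by (auto simp: dist_real_def intro: less_imp_le)
      next
        case False
        then have "1 / real (Suc i) \<le> 1 / real (Suc N)" by (intro divide_left_mono) auto
        then have "x n i \<le> e / 2" "l i \<le> e / 2" using weights_le[OF x, of n i] weights_le[OF l, of i] N by linarith+
        then show ?thesis using weightsD(1)[OF x, of n i] weightsD(1)[OF l, of i] by linarith
      qed
      then have "weights_dist (x n) l \<le> e / 2" by (intro weights_dist_le x l)
      then show "x n \<in> weights \<and> weights_dist (x n) l < e" using x e by simp
    qed
  qed
qed

text \<open>Diagonal argument in [0,1]. Mass can escape to late indices, so a limit of sequences
  with sum 1 may have a smaller sum; the condition of sum at most 1 is the one that survives, by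
  finite partial sums.\<close>

lemma weights_sequentially_compact:
  fixes x :: "nat \<Rightarrow> nat \<Rightarrow> real"
  assumes x: "\<And>n. x n \<in> weights"
  shows "\<exists>l r. l \<in> weights \<and> strict_mono r \<and> (\<forall>i. (\<lambda>n. x (r n) i) \<longlonglongrightarrow> l i)"
proof -
  define P where "P i s \<longleftrightarrow> convergent (\<lambda>k. x (s k) i)" for i and s :: "nat \<Rightarrow> nat"
  have sub: "\<exists>r'. strict_mono r' \<and> P i (s \<circ> r')" for i and s :: "nat \<Rightarrow> nat"
  proof -
    have "seq_compact {0..1 :: real}" using compact_Icc by (simp add: compact_eq_seq_compact_metric)
    moreover have "\<forall>k. x (s k) i \<in> {0..1}" using weightsD(1)[OF x] weights_le_1[OF x] by simp
    ultimately obtain l r where "strict_mono r" "((\<lambda>k. x (s k) i) \<circ> r) \<longlonglongrightarrow> l"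
      by (rule seq_compactE)
    then show ?thesis unfolding P_def convergent_def by (auto simp: o_def)
  qed
  interpret S: subseqs P by standard (rule sub)
  define r where "r = S.diagseq"
  have r: "strict_mono r" unfolding r_def by (rule S.subseq_diagseq)
  have "\<exists>l. (\<lambda>k. x (r k) i) \<longlonglongrightarrow> l" for i
  proof -
    have "P i (S.diagseq \<circ> ((+) (Suc i)))"
    proof (rule S.diagseq_holds)
      fix r s :: "nat \<Rightarrow> nat" and n assume r: "strict_mono r" and Ps: "P n s"
      then show "P n (s \<circ> r)"
        unfolding P_def using convergent_subseq_convergent[of "\<lambda>k. x (s k) n" r] by (simp add: o_def)
    qed
    then obtain l where "(\<lambda>k. x (r (Suc i + k)) i) \<longlonglongrightarrow> l" by (auto simp: P_def r_def convergent_def)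
    then show ?thesis using LIMSEQ_offset[of "\<lambda>k. x (r k) i" "Suc i" l] by (auto simp: add.commute)
  qed
  then have "\<exists>l. \<forall>i. (\<lambda>k. x (r k) i) \<longlonglongrightarrow> l i" by (intro choice allI)
  then obtain l where l: "\<And>i. (\<lambda>k. x (r k) i) \<longlonglongrightarrow> l i" by blast
  have nn: "0 \<le> l i" for i by (rule LIMSEQ_le_const[OF l]) (use weightsD(1)[OF x] in auto)
  have "l \<in> weights"
  proof (rule weightsI[OF nn])
    show "l (Suc i) \<le> l i" for i by (rule LIMSEQ_le[OF l l]) (use weightsD(4)[OF x] in auto)
    show "(\<Sum>i. ennreal (l i)) \<le> 1"
    proof (rule suminf_le_const)
      fix n
      have "(\<lambda>k. sum (x (r k)) {..<n}) \<longlonglongrightarrow> sum l {..<n}" by (intro tendsto_sum l)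
      moreover have "sum (x (r k)) {..<n} \<le> 1" for k
      proof -
        have "sum (x (r k)) {..<n} \<le> suminf (x (r k))"
          by (intro sum_le_suminf weightsD(1,2)[OF x]) simp_all
        then show ?thesis using weightsD(3)[OF x, of "r k"] by linarith
      qed
      ultimately have "sum l {..<n} \<le> 1" by (intro LIMSEQ_le_const2) auto
      then show "(\<Sum>i<n. ennreal (l i)) \<le> 1" using nn by (simp add: sum_ennreal)
    qed simp
  qed
  then show ?thesis using r l by blast
qed

section \<open>Continuity and closedness of the map from weights to pyramids\<close>

lemma topspace_atom_pyramid_topology: "topspace atom_pyramid_topology = atom_pyramid ` weights"
  using pyramid_atom_pyramid
  by (auto simp: atom_pyramid_topology_def topspace_weak_topology pyramids_def)

text \<open>Weakly open sets are the sequentially open ones. A failure of continuity at \<alpha>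
  gives weights within 1 / (n + 1) of \<alpha> whose pyramids avoid U although they converge weakly
  to a member of U.\<close>

lemma continuous_map_atom_pyramid: "continuous_map W.mtopology weak_topology atom_pyramid"
  unfolding W.continuous_map_from_metric topspace_weak_topology
proof (intro conjI ballI allI impI)
  show "atom_pyramid \<in> weights \<rightarrow> pyramids" using pyramid_atom_pyramid by (auto simp: pyramids_def)
  fix \<alpha> U assume \<alpha>: "\<alpha> \<in> weights" and U: "openin weak_topology U \<and> atom_pyramid \<alpha> \<in> U"
  show "\<exists>r>0. \<forall>x. x \<in> weights \<and> weights_dist \<alpha> x < r \<longrightarrow> atom_pyramid x \<in> U"
  proof (rule ccontr)
    assume no: "\<not> ?thesis"
    have "\<exists>x. x \<in> weights \<and> weights_dist \<alpha> x < 1 / real (Suc n) \<and> atom_pyramid x \<notin> U" for n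
    proof -
      have "1 / real (Suc n) > 0" by simp
      then show ?thesis using no by blast
    qed
    then have "\<exists>x. \<forall>n. x n \<in> weights \<and> weights_dist \<alpha> (x n) < 1 / real (Suc n) \<and> atom_pyramid (x n) \<notin> U"
      by (intro choice allI)
    then obtain x where x: "\<And>n. x n \<in> weights" "\<And>n. weights_dist \<alpha> (x n) < 1 / real (Suc n)"
      "\<And>n. atom_pyramid (x n) \<notin> U" by blast
    have "(\<lambda>n. x n i) \<longlonglongrightarrow> \<alpha> i" for i
    proof (rule LIM_zero_cancel, rule tendsto_rabs_zero_cancel, rule tendsto_sandwich[OF _ _ tendsto_const])
      show "(\<lambda>n. 1 / real (Suc n)) \<longlonglongrightarrow> 0" using LIMSEQ_inverse_real_of_nat by (simp add: inverse_eq_divide)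
      show "\<forall>\<^sub>F n in sequentially. \<bar>x n i - \<alpha> i\<bar> \<le> 1 / real (Suc n)"
      proof (rule always_eventually, rule allI)
        fix n
        show "\<bar>x n i - \<alpha> i\<bar> \<le> 1 / real (Suc n)"
          using le_weights_dist[OF \<alpha> x(1), of i n] x(2)[of n] by linarith
      qed
    qed simp
    then have "weakly_converges (\<lambda>n. atom_pyramid (x n)) (atom_pyramid \<alpha>)"
      by (rule weakly_converges_atom_pyramid[OF \<alpha> x(1)])
    moreover have "\<forall>n. atom_pyramid (x n) \<in> pyramids" using pyramid_atom_pyramid[OF x(1)] by (simp add: pyramids_def)
    moreover have "\<forall>P\<in>U. \<forall>S. (\<forall>n. S n \<in> pyramids) \<and> weakly_converges S P \<longrightarrow> (\<forall>\<^sub>F n in sequentially. S n \<in> U)"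
      using U unfolding openin_weak_topology weakly_open_def by blast
    then have "\<forall>S. (\<forall>n. S n \<in> pyramids) \<and> weakly_converges S (atom_pyramid \<alpha>) \<longrightarrow> (\<forall>\<^sub>F n in sequentially. S n \<in> U)"
      by (rule bspec) (use U in simp)
    then have "(\<forall>n. atom_pyramid (x n) \<in> pyramids) \<and> weakly_converges (\<lambda>n. atom_pyramid (x n)) (atom_pyramid \<alpha>) \<longrightarrow>
        (\<forall>\<^sub>F n in sequentially. atom_pyramid (x n) \<in> U)"
      by (rule spec)
    ultimately have "\<forall>\<^sub>F n in sequentially. atom_pyramid (x n) \<in> U" by blast
    then show False using x(3) by simp
  qed
qed

text \<open>If pyramids from the image occur infinitely often along a sequence converging to
  \<open>P\<close>, their weights subconverge to some l in C. Both \<open>P\<close> and the pyramid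
  of l are then limits of one subsequence, hence equal.\<close>

lemma closedin_atom_pyramid_image:
  assumes C: "closedin W.mtopology C"
  shows "closedin weak_topology (atom_pyramid ` C)"
proof -
  have CW: "C \<subseteq> weights" using closedin_subset[OF C] by simp
  have sub: "atom_pyramid ` C \<subseteq> pyramids" using CW pyramid_atom_pyramid by (auto simp: pyramids_def)
  have "weakly_open (pyramids - atom_pyramid ` C)"
    unfolding weakly_open_def
  proof (intro conjI ballI allI impI)
    fix P S assume P: "P \<in> pyramids - atom_pyramid ` C" and S: "(\<forall>n. S n \<in> pyramids) \<and> weakly_converges S P"
    show "\<forall>\<^sub>F n in sequentially. S n \<in> pyramids - atom_pyramid ` C"
    proof (rule ccontr)
      assume no: "\<not> ?thesis"
      have "\<exists>n\<ge>N. S n \<in> atom_pyramid ` C" for N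
        using no S unfolding eventually_sequentially by blast
      then have "infinite {n. S n \<in> atom_pyramid ` C}"
        unfolding infinite_nat_iff_unbounded_le by simp
      then have "\<exists>r :: nat \<Rightarrow> nat. strict_mono r \<and> (\<forall>n. r n \<in> {n. S n \<in> atom_pyramid ` C})"
        by (rule infinite_enumerate)
      then obtain r :: "nat \<Rightarrow> nat" where r: "strict_mono r" "\<forall>n. r n \<in> {n. S n \<in> atom_pyramid ` C}"
        by (elim exE conjE)
      have r2: "S (r n) \<in> atom_pyramid ` C" for n using spec[OF r(2), of n] by (simp only: mem_Collect_eq)
      have "\<exists>x. x \<in> C \<and> S (r n) = atom_pyramid x" for n using r2[of n] by blast
      then have "\<exists>x. \<forall>n. x n \<in> C \<and> S (r n) = atom_pyramid (x n)" by (intro choice allI)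
      then obtain x where x: "\<And>n. x n \<in> C" "\<And>n. S (r n) = atom_pyramid (x n)" by blast
      have xW: "x n \<in> weights" for n using x(1) CW by blast
      obtain l r' where l: "l \<in> weights" "strict_mono r'" "\<And>i. (\<lambda>n. x (r' n) i) \<longlonglongrightarrow> l i"
        using weights_sequentially_compact[of x] xW by blast
      have "limitin W.mtopology (x \<circ> r') l sequentially"
        using limitin_weights_iff[of "x \<circ> r'" l] l xW by simp
      moreover have "range (x \<circ> r') \<subseteq> C" using x(1) by auto
      ultimately have lC: "l \<in> C" using C unfolding W.metric_closedin_iff_sequentially_closed by blast
      have "weakly_converges (\<lambda>n. atom_pyramid (x (r' n))) (atom_pyramid l)"
        by (rule weakly_converges_atom_pyramid[OF l(1) xW l(3)])
      moreover have "(S \<circ> r) \<circ> r' = (\<lambda>n. atom_pyramid (x (r' n)))" using x(2) by auto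
      ultimately have 1: "weakly_converges ((S \<circ> r) \<circ> r') (atom_pyramid l)" by simp
      have 2: "weakly_converges ((S \<circ> r) \<circ> r') P"
        using S r(1) l(2) by (intro weakly_converges_subseq) blast+
      have "P \<subseteq> pm_classes" "atom_pyramid l \<subseteq> pm_classes"
        using P pyramid_atom_pyramid[OF l(1)] by (simp_all add: pyramids_def pyramid_def)
      then have "P = atom_pyramid l"
        using weakly_converges_subset[OF 1 2] weakly_converges_subset[OF 2 1] by blast
      then show False using P lC by blast
    qed
  qed simp
  then show ?thesis
    using sub unfolding closedin_def topspace_weak_topology openin_weak_topology by blast
qed

lemma homeomorphic_map_atom_pyramid: "homeomorphic_map weights_topology atom_pyramid_topology atom_pyramid"
  unfolding weights_topology_eq
proof (rule bijective_closed_imp_homeomorphic_map)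
  show "continuous_map W.mtopology atom_pyramid_topology atom_pyramid"
    unfolding atom_pyramid_topology_def continuous_map_in_subtopology
    using continuous_map_atom_pyramid by simp
  show "closed_map W.mtopology atom_pyramid_topology atom_pyramid"
    unfolding closed_map_def
  proof (intro allI impI)
    fix C assume C: "closedin W.mtopology C"
    have "atom_pyramid ` C \<subseteq> atom_pyramid ` weights" using closedin_subset[OF C] by auto
    then show "closedin atom_pyramid_topology (atom_pyramid ` C)"
      unfolding atom_pyramid_topology_def closedin_subtopology using closedin_atom_pyramid_image[OF C] by blast
  qed
  show "atom_pyramid ` topspace W.mtopology = topspace atom_pyramid_topology"
    by (simp add: topspace_atom_pyramid_topology)
  show "inj_on atom_pyramid (topspace W.mtopology)" using inj_on_atom_pyramid by simp
qed

subsection \<open>The isomorphism of topological monoids\<close>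

lemma monoid_weights: "Group.monoid weights_monoid"
  by (rule monoidI)
    (simp_all add: weights_monoid_def weights_mult_in weights_one_in weights_mult_assoc
      weights_mult_one_left weights_mult_one_right)

lemma topological_monoid_weights: "topological_monoid weights_monoid weights_topology"
  unfolding topological_monoid_def weights_topology_eq
proof (intro conjI monoid_weights)
  show "topspace W.mtopology = carrier weights_monoid" by (simp add: weights_monoid_def)
  show "continuous_map (prod_topology W.mtopology W.mtopology) W.mtopology (\<lambda>(x, y). x \<otimes>\<^bsub>weights_monoid\<^esub> y)"
    unfolding W.continuous_map_to_metric
  proof (intro ballI allI impI)
    fix z and \<epsilon> :: real assume "z \<in> topspace (prod_topology W.mtopology W.mtopology)" and \<epsilon>: "0 < \<epsilon>"
    then obtain \<alpha> \<beta> where z: "z = (\<alpha>, \<beta>)" and \<alpha>: "\<alpha> \<in> weights" and \<beta>: "\<beta> \<in> weights" by auto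
    let ?U = "W.mball \<alpha> (\<epsilon> / 3) \<times> W.mball \<beta> (\<epsilon> / 3)"
    show "\<exists>U. openin (prod_topology W.mtopology W.mtopology) U \<and> z \<in> U \<and>
        (\<forall>y\<in>U. (case y of (x, y) \<Rightarrow> x \<otimes>\<^bsub>weights_monoid\<^esub> y) \<in> W.mball (case z of (x, y) \<Rightarrow> x \<otimes>\<^bsub>weights_monoid\<^esub> y) \<epsilon>)"
    proof (intro exI[of _ ?U] conjI ballI)
      show "openin (prod_topology W.mtopology W.mtopology) ?U" by (simp add: openin_prod_Times_iff)
      show "z \<in> ?U" using \<alpha> \<beta> \<epsilon> z by simp
      fix y assume "y \<in> ?U"
      then obtain \<alpha>' \<beta>' where y: "y = (\<alpha>', \<beta>')" and \<alpha>': "\<alpha>' \<in> weights" and \<beta>': "\<beta>' \<in> weights"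
        and close: "weights_dist \<alpha> \<alpha>' < \<epsilon> / 3" "weights_dist \<beta> \<beta>' < \<epsilon> / 3" by auto
      have "\<bar>\<alpha> i - \<alpha>' i\<bar> \<le> \<epsilon> / 3" "\<bar>\<beta> i - \<beta>' i\<bar> \<le> \<epsilon> / 3" for i
        using le_weights_dist[OF \<alpha> \<alpha>', of i] le_weights_dist[OF \<beta> \<beta>', of i] close by linarith+
      then have "weights_dist (weights_mult \<alpha> \<beta>) (weights_mult \<alpha>' \<beta>') \<le> \<epsilon> / 3 + \<epsilon> / 3"
        by (intro weights_dist_le weights_mult_in weights_mult_close \<alpha> \<beta> \<alpha>' \<beta>')
      also have "\<dots> < \<epsilon>" using \<epsilon> by simp
      finally show "(case y of (x, y) \<Rightarrow> x \<otimes>\<^bsub>weights_monoid\<^esub> y) \<in> W.mball (case z of (x, y) \<Rightarrow> x \<otimes>\<^bsub>weights_monoid\<^esub> y) \<epsilon>"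
        using \<alpha> \<beta> \<alpha>' \<beta>' by (simp add: y z weights_monoid_def weights_mult_in)
    qed
  qed
qed

text \<open>With g the inverse homeomorphism, the product of pyramids is the product of weights
  conjugated by g, so the monoid laws and continuity are inherited.\<close>

lemma topological_monoid_atom_pyramid:
  assumes p: "1 \<le> p"
  shows "topological_monoid (atom_pyramid_monoid p) atom_pyramid_topology"
  unfolding topological_monoid_def
proof (intro conjI)
  note mult = pyramid_prod_atom_pyramid[OF p]
  show "Group.monoid (atom_pyramid_monoid p)"
    by (rule monoidI)
      (auto simp: atom_pyramid_monoid_def mult weights_mult_in weights_one_in weights_mult_assoc
        weights_mult_one_left weights_mult_one_right)
  show "topspace atom_pyramid_topology = carrier (atom_pyramid_monoid p)"
    by (simp add: topspace_atom_pyramid_topology atom_pyramid_monoid_def)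
  obtain g where g: "homeomorphic_maps weights_topology atom_pyramid_topology atom_pyramid g"
    using homeomorphic_map_atom_pyramid unfolding homeomorphic_map_maps by blast
  have cg: "continuous_map atom_pyramid_topology weights_topology g"
    and ch: "continuous_map weights_topology atom_pyramid_topology atom_pyramid"
    and hg: "\<And>P. P \<in> atom_pyramid ` weights \<Longrightarrow> atom_pyramid (g P) = P"
    using g unfolding homeomorphic_maps_def topspace_atom_pyramid_topology by auto
  have gW: "g P \<in> weights" if "P \<in> atom_pyramid ` weights" for P
    using continuous_map_image_subset_topspace[OF cg] that
    unfolding topspace_atom_pyramid_topology weights_topology_eq by auto
  have "continuous_map (prod_topology atom_pyramid_topology atom_pyramid_topology)
      (prod_topology weights_topology weights_topology) (\<lambda>(x, y). (g x, g y))"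
    using cg by (simp add: continuous_map_prod_top)
  moreover have "continuous_map (prod_topology weights_topology weights_topology) weights_topology
      (\<lambda>(x, y). x \<otimes>\<^bsub>weights_monoid\<^esub> y)"
    using topological_monoid_weights unfolding topological_monoid_def by blast
  ultimately have "continuous_map (prod_topology atom_pyramid_topology atom_pyramid_topology) atom_pyramid_topology
      (atom_pyramid \<circ> ((\<lambda>(x, y). x \<otimes>\<^bsub>weights_monoid\<^esub> y) \<circ> (\<lambda>(x, y). (g x, g y))))"
    using ch by (intro continuous_map_compose)
  then show "continuous_map (prod_topology atom_pyramid_topology atom_pyramid_topology) atom_pyramid_topology
      (\<lambda>(x, y). x \<otimes>\<^bsub>atom_pyramid_monoid p\<^esub> y)"
  proof (rule continuous_map_eq)
    fix z assume "z \<in> topspace (prod_topology atom_pyramid_topology atom_pyramid_topology)"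
    then obtain P Q where z: "z = (P, Q)" and PQ: "P \<in> atom_pyramid ` weights" "Q \<in> atom_pyramid ` weights"
      by (auto simp: topspace_atom_pyramid_topology)
    have "atom_pyramid (weights_mult (g P) (g Q)) = pyramid_prod p (atom_pyramid (g P)) (atom_pyramid (g Q))"
      by (rule mult[OF gW[OF PQ(1)] gW[OF PQ(2)], symmetric])
    then show "(atom_pyramid \<circ> ((\<lambda>(x, y). x \<otimes>\<^bsub>weights_monoid\<^esub> y) \<circ> (\<lambda>(x, y). (g x, g y)))) z =
        (case z of (x, y) \<Rightarrow> x \<otimes>\<^bsub>atom_pyramid_monoid p\<^esub> y)"
      by (simp add: z weights_monoid_def atom_pyramid_monoid_def hg[OF PQ(1)] hg[OF PQ(2)])
  qed
qed

theorem theorem0p8: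
  fixes p :: ereal
  assumes "1 \<le> p"
  shows "(\<forall>\<alpha>\<in>weights. \<forall>\<beta>\<in>weights.
            pyramid_prod p (atom_pyramid \<alpha>) (atom_pyramid \<beta>) = atom_pyramid (weights_mult \<alpha> \<beta>)) \<and>
         topological_monoid_iso weights_monoid weights_topology
           (atom_pyramid_monoid p) atom_pyramid_topology atom_pyramid"
proof (intro conjI ballI)
  note mult = pyramid_prod_atom_pyramid[OF assms]
  show "pyramid_prod p (atom_pyramid \<alpha>) (atom_pyramid \<beta>) = atom_pyramid (weights_mult \<alpha> \<beta>)"
    if "\<alpha> \<in> weights" "\<beta> \<in> weights" for \<alpha> \<beta>
    using that by (rule mult)
  have "atom_pyramid \<in> Group.iso weights_monoid (atom_pyramid_monoid p)"
    using inj_on_atom_pyramid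
    by (auto simp: iso_def hom_def bij_betw_def weights_monoid_def atom_pyramid_monoid_def mult)
  then show "topological_monoid_iso weights_monoid weights_topology
           (atom_pyramid_monoid p) atom_pyramid_topology atom_pyramid"
    unfolding topological_monoid_iso_def
    using topological_monoid_weights topological_monoid_atom_pyramid[OF assms] homeomorphic_map_atom_pyramid
    by (simp add: weights_monoid_def atom_pyramid_monoid_def)
qed

end
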